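(* Let $n\in\mathbb N$, $s,\beta>0$ with $\beta s\ge4n$, let $a\in\mathcal G^\beta_s(\mathbb R^n)$, and let $1<p<\infty$. Let $\varphi\in C_0^\infty(\mathbb R^n)$ and $V\in C^1(\mathbb R^n\times\mathbb R)$, both real-valued. Assume that there exist constants $\alpha>1$ and $C>0$ and a function $h\in L^p(\mathbb R^n)$ such that $$|V(x,y)|+\left|\frac{\partial}{\partial x_i}V(x,y)\right|\le C\,(h(x)+|y|^\alpha),\quad i=1,\dots,n,$$ $$\left|\frac{\partial}{\partial y}V(x,y)\right|\le C\,(1+|y|^\alpha).$$ Suppose that $m>0$ and that $m>\dfrac{n}{\alpha p}$ and $s>\dfrac{4m\alpha}{\beta}$. Then, for all sufficiently small $\delta>0$, the equation $$[1+a(-\Delta)]^{s/2}(u)=\delta\,\varphi(x)\,V(x,u)$$ has a solution $u\in\mathcal H^{s,p}(a)$.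
   Context: For $n\in\mathbb N$ and $s,\beta>0$ with $\beta s\ge 4n$, the class $\mathcal G^\beta_s(\mathbb R^n)$ consists of the scalar functions $a$ on $\mathbb R$ such that: ($G_1$) $a\in C^n([0,\infty))$ and $t\mapsto a(t^2)$, $t\in\mathbb R$, is non-negative; ($G_2$) there are constants $R,M>0$ with $M(1+|x|^2)^{\beta/2}\le a(|x|^2)$ for all $x\in\mathbb R^n$ with $|x|>R$; ($G_3$) for each integer $k>0$ there are $N=N(k,s)>0$ and $\rho\ge0$ such that $|a^{(k)}(|x|^2)|\le N(1+|x|^2)^{k(\frac{\beta s}{4n}-1)+\frac\beta2}$ whenever $|x|>\rho$ (the derivatives involved are understood to exist there). $\mathcal F$ denotes the Fourier transform. For $a\in\mathcal G^\beta_s(\mathbb R^n)$ and $1<p<\infty$, $T_s$ is the bounded operator on $L^p(\mathbb R^n)$ which is the unique bounded extension of $f\mapsto\mathcal F^{-1}\big((1+a(|\xi|^2))^{-s/2}\mathcal F f\big)$, $f\in L^2\cap L^p$. Define $$\mathcal H^{s,p}(a)=\{u\in L^p(\mathbb R^n):\mathcal F^{-1}((1+a(|\xi|^2))^{s/2}\mathcal F u)\in L^p(\mathbb R^n)\},\quad \|u\|_{\mathcal H^{s,p}(a)}=\|\mathcal F^{-1}((1+a(|\xi|^2))^{s/2}\mathcal F u)\|_{L^p},$$ where $\mathcal F^{-1}((1+a(|\xi|^2))^{s/2}\mathcal F u)=g$ (in the sense of tempered distributions) is identified with $u=T_s g$; i.e. $\mathcal H^{s,p}(a)=T_s(L^p)$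 with $\|T_sg\|_{\mathcal H^{s,p}(a)}=\|g\|_{L^p}$. The operator $[1+a(-\Delta)]^{s/2}$ is $u\mapsto\mathcal F^{-1}((1+a(|\xi|^2))^{s/2}\mathcal F u)$ on $\mathcal H^{s,p}(a)$, so $[1+a(-\Delta)]^{s/2}u=g$ means $u=T_s g$. *)

theory Defs
  imports "HOL-Analysis.Analysis"
begin

text \<open>
  \<open>Ck_on k S f\<close>: \<open>f\<close> is \<open>k\<close> times continuously differentiable on \<open>S\<close>. Derivatives are taken
  within \<open>S\<close>, hence one-sided at the end point when \<open>S = {0..}\<close>. It is meant for sets on which
  derivatives within the set are unique (here \<open>{0..}\<close> and \<open>UNIV\<close>).
\<close>

primrec Ck_on :: "nat \<Rightarrow> 'a::euclidean_space set \<Rightarrow> ('a \<Rightarrow> 'b::real_normed_vector) \<Rightarrow> bool" where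
  "Ck_on 0 S f \<longleftrightarrow> continuous_on S f"
| "Ck_on (Suc k) S f \<longleftrightarrow>
     (\<exists>f'. (\<forall>x\<in>S. (f has_derivative f' x) (at x within S)) \<and> (\<forall>v. Ck_on k S (\<lambda>x. f' x v)))"

definition test_function :: "('a::euclidean_space \<Rightarrow> real) \<Rightarrow> bool" where
  "test_function \<phi> \<longleftrightarrow> (\<forall>k. Ck_on k UNIV \<phi>) \<and> compact (closure {x. \<phi> x \<noteq> 0})"

text \<open>
  The class \<open>\<G>\<^sup>\<beta>\<^sub>s(\<real>\<^sup>n)\<close> with \<open>n = CARD('n)\<close>. In the third condition the derivatives of order \<open>k\<close> are
  required to exist at all points \<open>|x|\<^sup>2\<close> with \<open>|x| > \<rho>\<close>; these points form the open half-line
  \<open>{\<rho>\<^sup>2<..}\<close>, so the iterated two-sided derivative is the right one there.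
\<close>

definition class_G :: "'n::finite itself \<Rightarrow> real \<Rightarrow> real \<Rightarrow> (real \<Rightarrow> real) set" where
  "class_G N \<beta> s = {a.
     Ck_on CARD('n) {0..} a \<and> (\<forall>t. 0 \<le> a (t\<^sup>2)) \<and>
     (\<exists>R>0. \<exists>M>0. \<forall>x::real^'n. norm x > R \<longrightarrow>
        M * (1 + (norm x)\<^sup>2) powr (\<beta> / 2) \<le> a ((norm x)\<^sup>2)) \<and>
     (\<forall>k::nat. k > 0 \<longrightarrow> (\<exists>N>0. \<exists>\<rho>\<ge>0. \<forall>x::real^'n. norm x > \<rho> \<longrightarrow>
        (\<forall>j<k. (deriv ^^ j) a field_differentiable at ((norm x)\<^sup>2)) \<and>
        \<bar>(deriv ^^ k) a ((norm x)\<^sup>2)\<bar>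
          \<le> N * (1 + (norm x)\<^sup>2) powr (real k * (\<beta> * s / (4 * real CARD('n)) - 1) + \<beta> / 2)))}"

text \<open>
  \<open>L\<^sup>p\<close> consists of functions; equality in \<open>L\<^sup>p\<close> is equality almost everywhere.
\<close>

definition Lp :: "real \<Rightarrow> ('a::euclidean_space \<Rightarrow> 'b::real_normed_vector) set" where
  "Lp p = {f \<in> borel_measurable lebesgue. integrable lebesgue (\<lambda>x. norm (f x) powr p)}"

definition Lp_norm :: "real \<Rightarrow> ('a::euclidean_space \<Rightarrow> 'b::real_normed_vector) \<Rightarrow> real" where
  "Lp_norm p f = (LINT x|lebesgue. norm (f x) powr p) powr (1 / p)"

text \<open>
  The unitary Fourier transform with kernel \<open>exp (- i x \<bullet> \<xi>)\<close>, for which \<open>-\<Delta>\<close> has the symbol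
  \<open>|\<xi>|\<^sup>2\<close>; first as an integral for \<open>L\<^sup>1\<close> functions, then its continuous extension to \<open>L\<^sup>2\<close>.
  The latter is a relation because \<open>L\<^sup>2\<close> functions are determined only almost everywhere;
  \<open>has_fourier_L2 f g\<close> means \<open>\<F> f = g\<close>, equivalently \<open>\<F>\<^sup>-\<^sup>1 g = f\<close>, in \<open>L\<^sup>2\<close>.
\<close>

definition fourier :: "(real^'n \<Rightarrow> complex) \<Rightarrow> real^'n \<Rightarrow> complex" where
  "fourier f \<xi> = of_real ((2 * pi) powr (- real CARD('n) / 2)) *
     (LINT x|lebesgue. cis (- (x \<bullet> \<xi>)) * f x)"

definition has_fourier_L2 :: "(real^'n \<Rightarrow> complex) \<Rightarrow> (real^'n \<Rightarrow> complex) \<Rightarrow> bool" where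
  "has_fourier_L2 f g \<longleftrightarrow> f \<in> Lp 2 \<and> g \<in> Lp 2 \<and>
     (\<exists>F::nat \<Rightarrow> real^'n \<Rightarrow> complex. (\<forall>k. F k \<in> Lp 1 \<inter> Lp 2 \<and> fourier (F k) \<in> Lp 2) \<and>
        (\<lambda>k. Lp_norm 2 (\<lambda>x. F k x - f x)) \<longlonglongrightarrow> 0 \<and>
        (\<lambda>k. Lp_norm 2 (\<lambda>\<xi>. fourier (F k) \<xi> - g \<xi>)) \<longlonglongrightarrow> 0)"

definition bounded_Lp_operator ::
    "real \<Rightarrow> ((real^'n \<Rightarrow> complex) \<Rightarrow> real^'n \<Rightarrow> complex) \<Rightarrow> bool" where
  "bounded_Lp_operator p T \<longleftrightarrow>
     (\<forall>f\<in>Lp p. T f \<in> Lp p) \<and>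
     (\<forall>f\<in>Lp p. \<forall>g\<in>Lp p. \<forall>c d.
        AE x in lebesgue. T (\<lambda>x. c * f x + d * g x) x = c * T f x + d * T g x) \<and>
     (\<exists>C. \<forall>f\<in>Lp p. Lp_norm p (T f) \<le> C * Lp_norm p f)"

text \<open>
  \<open>T f = \<F>\<^sup>-\<^sup>1((1 + a(|\<xi>|\<^sup>2))\<^sup>-\<^sup>s\<^sup>/\<^sup>2 \<F> f)\<close> for all \<open>f \<in> L\<^sup>2 \<inter> L\<^sup>p\<close>.
\<close>

definition extends_multiplier ::
    "(real \<Rightarrow> real) \<Rightarrow> real \<Rightarrow> real \<Rightarrow> ((real^'n \<Rightarrow> complex) \<Rightarrow> real^'n \<Rightarrow> complex) \<Rightarrow> bool" where
  "extends_multiplier a s p T \<longleftrightarrow>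
     (\<forall>f\<in>Lp 2 \<inter> Lp p. \<exists>g. has_fourier_L2 f g \<and>
        has_fourier_L2 (T f) (\<lambda>\<xi>. of_real ((1 + a ((norm \<xi>)\<^sup>2)) powr (- s / 2)) * g \<xi>))"

text \<open>
  The operator \<open>T\<^sub>s\<close> on \<open>L\<^sup>p\<close>. The extension is unique only up to equality almost everywhere of its
  values, whence the indefinite choice of representatives.
\<close>

definition T_op ::
    "(real \<Rightarrow> real) \<Rightarrow> real \<Rightarrow> real \<Rightarrow> (real^'n \<Rightarrow> complex) \<Rightarrow> real^'n \<Rightarrow> complex" where
  "T_op a s p = (SOME T. bounded_Lp_operator p T \<and> extends_multiplier a s p T)"

definition H_space :: "(real \<Rightarrow> real) \<Rightarrow> real \<Rightarrow> real \<Rightarrow> (real^'n \<Rightarrow> complex) set" where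
  "H_space a s p = {u \<in> Lp p. \<exists>g\<in>Lp p. AE x in lebesgue. u x = T_op a s p g x}"

text \<open>
  \<open>op_eq a s p u g\<close> means \<open>[1 + a(-\<Delta>)]\<^sup>s\<^sup>/\<^sup>2 u = g\<close> in \<open>L\<^sup>p\<close>.
\<close>

definition op_eq ::
    "(real \<Rightarrow> real) \<Rightarrow> real \<Rightarrow> real \<Rightarrow> (real^'n \<Rightarrow> complex) \<Rightarrow> (real^'n \<Rightarrow> complex) \<Rightarrow> bool" where
  "op_eq a s p u g \<longleftrightarrow>
     u \<in> H_space a s p \<and> g \<in> Lp p \<and> (AE x in lebesgue. u x = T_op a s p g x)"

end

theory Submission
  imports Defs "HOL-Probability.Characteristic_Functions" "HOL-Probability.Sinc_Integral"
begin

text \<open>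
  \<open>T\<^sub>s\<close> is the convolution with \<open>K = \<F>\<^sup>-\<^sup>1((1 + a(|\<xi>|\<^sup>2))\<^sup>-\<^sup>s\<^sup>/\<^sup>2)\<close>, up to normalisation. As
  \<open>\<beta> s \<ge> 4 n\<close>, the multiplier
  decays like \<open>|\<xi>|\<^sup>-\<^sup>2\<^sup>n\<close>, so \<open>K\<close> is bounded and continuous, and its derivatives of order \<open>n\<close> along
  the axes decay like \<open>|\<xi>|\<^sup>-\<^sup>n\<close>, so \<open>|x|\<^sup>n K\<close> is square integrable and \<open>K\<close> is integrable. By Young's
  inequality the convolution is bounded on every \<open>L\<^sup>p\<close>, and injectivity of the Fourier transform on \<open>L\<^sup>2\<close>
  identifies it with \<open>T\<^sub>s\<close> on \<open>L\<^sup>2 \<inter> L\<^sup>p\<close>. Since \<open>K\<close> is bounded, \<open>u \<mapsto> \<delta> K * (\<phi> V(\<cdot>, u))\<close> contracts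
  the unit ball of the bounded continuous functions for small \<open>\<delta>\<close>; along the fixed point
  \<open>\<phi> V(\<cdot>, u)\<close> is continuous with compact support, hence in \<open>L\<^sup>2 \<inter> L\<^sup>p\<close>.
\<close>

section \<open>Gaussians on Euclidean space\<close>

text \<open>The growth exponents of the class balance exactly. Relative to 1 + |x|^2 the multiplier
  has order at most - \<beta> s / 4, and each derivative along an axis raises the order by \<beta> s
  / (4 n) - 1/2, so after n derivatives the order is - n/2 whatever the value of \<beta> s. That is
  enough for square integrability but not for integrability, which is why K is controlled through
  weighted L2 bounds. Three facts about the Fourier integral carry the proof: the L2 bound
  \<open>ft_contraction\<close>, inversion \<open>ft_inversion\<close> and injectivity
  \<open>ft_L2_injective\<close>. All rest on one identity, \<open>ft_smoothing\<close>: damping the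
  transform of f by a wide Gaussian amounts to averaging f against a narrow one. \<open>T_op\<close>
  is an indefinite choice, so the convolution serves twice: as witness that an admissible operator
  exists, and as the function that the chosen operator must reproduce on L2 \<inter> Lp, where its
  multiplier formula is prescribed. In the unit ball of the sup norm, V is only evaluated at |y|
  \<le> 1, and \<phi> restricts x to a compact set; there V is bounded and Lipschitz in y, whatever
  its growth at infinity.\<close>

lemma lborel_nn_integral_affine:
  fixes f :: "'a::euclidean_space \<Rightarrow> ennreal"
  assumes "c \<noteq> 0" and [measurable]: "f \<in> borel_measurable borel"
  shows "(\<integral>\<^sup>+x. f x \<partial>lborel) = ennreal (\<bar>c\<bar> ^ DIM('a)) * (\<integral>\<^sup>+x. f (t + c *\<^sub>R x) \<partial>lborel)"
  by (subst lborel_affine[OF assms(1), of t])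
     (simp add: nn_integral_density nn_integral_distr nn_integral_cmult)

lemma lborel_integrable_affine:
  fixes f :: "'a::euclidean_space \<Rightarrow> 'b::{banach, second_countable_topology}"
  assumes f: "integrable lborel f" and "c \<noteq> 0"
  shows "integrable lborel (\<lambda>x. f (t + c *\<^sub>R x))"
proof -
  have [measurable]: "f \<in> borel_measurable borel" using f by auto
  have "(\<integral>\<^sup>+x. norm (f x) \<partial>lborel) = ennreal (\<bar>c\<bar> ^ DIM('a)) * (\<integral>\<^sup>+x. norm (f (t + c *\<^sub>R x)) \<partial>lborel)"
    by (rule lborel_nn_integral_affine[OF assms(2)]) simp
  then show ?thesis
    using f \<open>c \<noteq> 0\<close> unfolding integrable_iff_bounded
    by (auto simp: ennreal_mult_less_top)
qed

lemma lborel_integral_affine: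
  fixes f :: "'a::euclidean_space \<Rightarrow> 'b::{banach, second_countable_topology}"
  assumes "c \<noteq> 0" and [measurable]: "f \<in> borel_measurable borel"
  shows "(LBINT x. f x) = \<bar>c\<bar> ^ DIM('a) *\<^sub>R (LBINT x. f (t + c *\<^sub>R x))"
  by (subst lborel_affine[OF assms(1), of t])
     (simp add: integral_density integral_distr)

lemma lborel_integral_translate:
  fixes f :: "'a::euclidean_space \<Rightarrow> 'b::{banach, second_countable_topology}"
  assumes "f \<in> borel_measurable borel"
  shows "(LBINT x. f (t + x)) = (LBINT x. f x)"
  using lborel_integral_affine[OF _ assms, of 1 t] by simp

lemma lborel_integral_reflect:
  fixes f :: "'a::euclidean_space \<Rightarrow> 'b::{banach, second_countable_topology}"
  assumes "f \<in> borel_measurable borel"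
  shows "(LBINT x. f (t - x)) = (LBINT x. f x)"
  using lborel_integral_affine[OF _ assms, of "-1" t] by simp

text \<open>\<open>lborel\<close> is by \<open>lborel_eq\<close> the image of the product of
  one-dimensional measures under coordinates, so the claim is Fubini for products of one-variable
  functions.\<close>

lemma lborel_product:
  fixes f :: "'a::euclidean_space \<Rightarrow> real \<Rightarrow> 'b::{real_normed_field, banach, second_countable_topology}"
  assumes f: "\<And>b. b \<in> Basis \<Longrightarrow> integrable lborel (f b)"
  shows "integrable lborel (\<lambda>x. \<Prod>b\<in>Basis. f b (x \<bullet> b))" (is ?I)
    and "(LBINT x. (\<Prod>b\<in>Basis. f b (x \<bullet> b))) = (\<Prod>b\<in>Basis. LBINT t. f b t)" (is ?E)
proof -
  interpret product_sigma_finite "\<lambda>b::'a. lborel :: real measure" ..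
  have [measurable]: "\<And>b. b \<in> Basis \<Longrightarrow> f b \<in> borel_measurable borel"
    using f by auto
  have coord: "(\<Sum>b\<in>Basis. y b *\<^sub>R b) \<bullet> i = y i" if "i \<in> Basis" for y and i :: 'a
    using that by (simp add: inner_sum_left inner_Basis if_distrib cong: if_cong)
  have eq: "(\<Prod>b\<in>Basis. f b ((\<Sum>b\<in>Basis. y b *\<^sub>R b) \<bullet> b)) = (\<Prod>b\<in>Basis. f b (y b))" for y
    by (rule prod.cong) (simp_all add: coord)
  have "integrable (\<Pi>\<^sub>M b\<in>Basis. lborel) (\<lambda>y. \<Prod>b\<in>Basis. f b (y b))"
    by (rule product_integrable_prod) (use f in auto)
  then show ?I
    by (subst lborel_eq, subst integrable_distr_eq) (simp_all add: eq)
  have "(LBINT x. (\<Prod>b\<in>Basis. f b (x \<bullet> b))) = (\<integral>y. (\<Prod>b\<in>Basis. f b (y b)) \<partial>(\<Pi>\<^sub>M b\<in>Basis. lborel))"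
    by (subst lborel_eq, subst integral_distr) (simp_all add: eq)
  also have "\<dots> = (\<Prod>b\<in>Basis. LBINT t. f b t)"
    by (rule product_integral_prod) (use f in auto)
  finally show ?E .
qed

lemma cis_measurable [measurable]: "cis \<in> borel_measurable borel"
  unfolding cis_conv_exp[abs_def] by measurable

lemma cnj_measurable [measurable]: "cnj \<in> borel_measurable borel"
  by (intro borel_measurable_continuous_onI continuous_intros)

lemma norm_sq_Basis: "(norm x)\<^sup>2 = (\<Sum>b\<in>Basis. (x \<bullet> b)\<^sup>2)" for x :: "'a::euclidean_space"
  by (subst power2_norm_eq_inner, subst euclidean_inner) (simp add: power2_eq_square)

text \<open>This is the characteristic function of the standard normal distribution at - t, with the
  density's normalising constant moved to the other side.\<close>

lemma gaussian_1D:
  shows "integrable lborel (\<lambda>x. cis (- (x * t)) * of_real (exp (- x\<^sup>2 / 2)))"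
    and "(LBINT x. cis (- (x * t)) * of_real (exp (- x\<^sup>2 / 2))) = of_real (sqrt (2 * pi) * exp (- t\<^sup>2 / 2))"
proof -
  have i: "integrable lborel std_normal_density"
    by (simp add: integrable_normal_density)
  have e: "exp (- x\<^sup>2 / 2) = sqrt (2 * pi) * std_normal_density x" for x
    by (simp add: std_normal_density_def)
  have "integrable lborel (\<lambda>x. std_normal_density x *\<^sub>R cis (- (x * t)))"
    by (rule Bochner_Integration.integrable_bound[OF i]) (auto intro!: AE_I2)
  from integrable_mult_right[OF this, of "of_real (sqrt (2 * pi))"]
  show "integrable lborel (\<lambda>x. cis (- (x * t)) * of_real (exp (- x\<^sup>2 / 2)))"
    unfolding e by (simp add: scaleR_conv_of_real mult_ac)
  have "(LBINT x. std_normal_density x *\<^sub>R cis (- (x * t))) = char std_normal_distribution (- t)"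
    unfolding char_def
    by (subst integral_density) (auto simp: cis_conv_exp mult_ac)
  also have "\<dots> = of_real (exp (- t\<^sup>2 / 2))"
    by (simp add: char_std_normal_distribution)
  finally have *: "(LBINT x. std_normal_density x *\<^sub>R cis (- (x * t))) = of_real (exp (- t\<^sup>2 / 2))" .
  have "(LBINT x. cis (- (x * t)) * of_real (exp (- x\<^sup>2 / 2))) =
      (LBINT x. of_real (sqrt (2 * pi)) * (std_normal_density x *\<^sub>R cis (- (x * t))))"
    unfolding e by (simp add: scaleR_conv_of_real mult_ac)
  also have "\<dots> = of_real (sqrt (2 * pi)) * (LBINT x. std_normal_density x *\<^sub>R cis (- (x * t)))"
    by (rule integral_mult_right_zero)
  finally show "(LBINT x. cis (- (x * t)) * of_real (exp (- x\<^sup>2 / 2))) = of_real (sqrt (2 * pi) * exp (- t\<^sup>2 / 2))"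
    unfolding * by simp
qed

lemma cis_sum: "finite A \<Longrightarrow> cis (\<Sum>a\<in>A. f a) = (\<Prod>a\<in>A. cis (f a))"
  by (induction rule: finite_induct) (auto simp: cis_mult[symmetric])

text \<open>Left unnormalised so that its values lie in (0, 1] and it can serve as a damping
  factor.\<close>

definition gauss :: "'a::euclidean_space \<Rightarrow> real" where
  "gauss x = exp (- (norm x)\<^sup>2 / 2)"

lemma gauss_prod: "gauss x = (\<Prod>b\<in>Basis. exp (- (x \<bullet> b)\<^sup>2 / 2))"
  unfolding gauss_def norm_sq_Basis by (simp add: exp_sum[symmetric] sum_negf sum_divide_distrib)

lemma gauss_measurable [measurable]: "gauss \<in> borel_measurable borel"
  unfolding gauss_def[abs_def] by measurable

lemma gauss_bounds: "0 < gauss x" "gauss x \<le> 1"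
  by (auto simp: gauss_def)

lemma gauss_integrable: "integrable lborel (gauss :: 'a::euclidean_space \<Rightarrow> real)"
proof -
  have "integrable lborel (\<lambda>x. exp (- x\<^sup>2 / 2) :: real)"
    using integrable_mult_right[OF integrable_normal_density[of 1 0], of "sqrt (2 * pi)"]
    by (simp add: std_normal_density_def)
  then show ?thesis
    unfolding gauss_prod[abs_def] by (intro lborel_product)
qed

lemma gauss_fourier:
  fixes \<xi> :: "'a::euclidean_space"
  shows "(LBINT x. cis (- (x \<bullet> \<xi>)) * of_real (gauss x)) = of_real (sqrt (2 * pi) ^ DIM('a) * gauss \<xi>)"
proof -
  have "cis (- (x \<bullet> \<xi>)) * of_real (gauss x) =
      (\<Prod>b\<in>Basis. cis (- ((x \<bullet> b) * (\<xi> \<bullet> b))) * of_real (exp (- (x \<bullet> b)\<^sup>2 / 2)))" for x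
    by (simp add: gauss_prod prod.distrib cis_sum[symmetric] sum_negf euclidean_inner[of x \<xi>])
  then have "(LBINT x. cis (- (x \<bullet> \<xi>)) * of_real (gauss x)) =
     (\<Prod>b\<in>Basis. LBINT x. cis (- (x * (\<xi> \<bullet> b))) * of_real (exp (- x\<^sup>2 / 2)))"
    using lborel_product(2)[of "\<lambda>b x. cis (- (x * (\<xi> \<bullet> b))) * of_real (exp (- x\<^sup>2 / 2))"] gaussian_1D(1)
    by simp
  also have "\<dots> = of_real (sqrt (2 * pi) ^ DIM('a) * gauss \<xi>)"
    unfolding gaussian_1D(2) by (simp add: gauss_prod prod.distrib)
  finally show ?thesis .
qed

lemma gauss_integral: "(LBINT x::'a::euclidean_space. gauss x) = sqrt (2 * pi) ^ DIM('a)"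
proof -
  have "complex_of_real (LBINT x::'a. gauss x) = of_real (sqrt (2 * pi) ^ DIM('a))"
    using gauss_fourier[of "0::'a"] by (simp add: gauss_def)
  then show ?thesis using of_real_eq_iff by blast
qed

lemma gauss_scaled_fourier:
  fixes \<xi> :: "'a::euclidean_space"
  assumes "r > 0"
  shows "(LBINT x. cis (- (x \<bullet> \<xi>)) * of_real (gauss (r *\<^sub>R x))) =
         of_real ((sqrt (2 * pi) / r) ^ DIM('a) * gauss (\<xi> /\<^sub>R r))"
proof -
  have "(LBINT x. cis (- (x \<bullet> (\<xi> /\<^sub>R r))) * of_real (gauss x)) =
     \<bar>r\<bar> ^ DIM('a) *\<^sub>R (LBINT x. cis (- ((0 + r *\<^sub>R x) \<bullet> (\<xi> /\<^sub>R r))) * of_real (gauss (0 + r *\<^sub>R x)))"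
    by (rule lborel_integral_affine) (use assms in auto)
  then show ?thesis
    using assms unfolding gauss_fourier
    by (simp add: scaleR_conv_of_real field_simps power_divide)
qed

lemma gauss_scaled_integrable:
  "r \<noteq> 0 \<Longrightarrow> integrable lborel (\<lambda>x::'a::euclidean_space. gauss (t + r *\<^sub>R x))"
  using lborel_integrable_affine[OF gauss_integrable, of r t] by simp

lemma integrable_inverse_1D: "integrable lborel (\<lambda>x::real. 1 / (1 + x\<^sup>2))"
  using integrable_inverse_1_plus_square
  by (simp add: inverse_eq_divide set_integrable_def)

lemma prod_le_norm:
  fixes x :: "'a::euclidean_space"
  shows "(\<Prod>b\<in>Basis. 1 + (x \<bullet> b)\<^sup>2) \<le> (1 + (norm x)\<^sup>2) ^ DIM('a)"
proof -
  have "(\<Prod>b\<in>Basis. 1 + (x \<bullet> b)\<^sup>2) \<le> (\<Prod>b\<in>(Basis :: 'a set). 1 + (norm x)\<^sup>2)"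
    by (intro prod_mono) (auto intro!: member_le_sum simp: norm_sq_Basis)
  then show ?thesis by simp
qed

text \<open>Dominated by the product over the coordinates of 1 / (1 + t^2). The exponent n that this
  produces is the one that the decay |\<xi>|^(-2n) of the multiplier provides.\<close>

lemma integrable_inverse_norm:
  "integrable lborel (\<lambda>x::'a::euclidean_space. 1 / (1 + (norm x)\<^sup>2) ^ DIM('a))"
proof (rule Bochner_Integration.integrable_bound)
  show "integrable lborel (\<lambda>x::'a. \<Prod>b\<in>Basis. 1 / (1 + (x \<bullet> b)\<^sup>2))"
    by (intro lborel_product integrable_inverse_1D)
  show "AE x::'a in lborel. norm (1 / (1 + (norm x)\<^sup>2) ^ DIM('a)) \<le> norm (\<Prod>b\<in>Basis. 1 / (1 + (x \<bullet> b)\<^sup>2))"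
  proof (rule AE_I2)
    fix x :: 'a
    have "1 / (1 + (norm x)\<^sup>2) ^ DIM('a) \<le> 1 / (\<Prod>b\<in>Basis. 1 + (x \<bullet> b)\<^sup>2)"
      by (intro divide_left_mono prod_le_norm mult_pos_pos prod_pos zero_less_power)
         (auto intro: add_pos_nonneg)
    then show "norm (1 / (1 + (norm x)\<^sup>2) ^ DIM('a)) \<le> norm (\<Prod>b\<in>Basis. 1 / (1 + (x \<bullet> b)\<^sup>2))"
      by (simp add: prod_dividef prod_nonneg)
  qed
qed simp

section \<open>The Fourier integral\<close>

text \<open>Without the unitary constant and over \<open>lborel\<close>, where Fubini is available;
  the constant returns in \<open>fourier_L2\<close>.\<close>

definition ft :: "('a::euclidean_space \<Rightarrow> complex) \<Rightarrow> 'a \<Rightarrow> complex" where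
  "ft f \<xi> = (LBINT x. cis (- (x \<bullet> \<xi>)) * f x)"

text \<open>The squared L2 norm, valued in \<open>ennreal\<close> so that bounds and limits can be
  stated before finiteness is known.\<close>

definition N2 :: "('a::euclidean_space \<Rightarrow> complex) \<Rightarrow> ennreal" where
  "N2 f = (\<integral>\<^sup>+x. ennreal ((norm (f x))\<^sup>2) \<partial>lborel)"

text \<open>Fatou's lemma in the form in which it is used: a uniform bound on the integrals survives
  an almost everywhere limit.\<close>

lemma nn_integral_le_limit:
  assumes [measurable]: "\<And>k. f k \<in> borel_measurable M"
    and lim: "AE x in M. (\<lambda>k. f k x) \<longlonglongrightarrow> (g x :: ennreal)"
    and le: "\<And>k. (\<integral>\<^sup>+x. f k x \<partial>M) \<le> B"
  shows "(\<integral>\<^sup>+x. g x \<partial>M) \<le> B"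
proof -
  have "(\<integral>\<^sup>+x. g x \<partial>M) = (\<integral>\<^sup>+x. liminf (\<lambda>k. f k x) \<partial>M)"
    by (rule nn_integral_cong_AE, use lim in eventually_elim) (simp add: lim_imp_Liminf)
  also have "\<dots> \<le> liminf (\<lambda>k. \<integral>\<^sup>+x. f k x \<partial>M)"
    by (rule nn_integral_liminf) simp
  also have "\<dots> \<le> B"
    using le by (intro Liminf_le) (auto intro: always_eventually)
  finally show ?thesis .
qed

lemma integrable_cis_mult [simp]:
  assumes "integrable lborel f" and [measurable]: "\<theta> \<in> borel_measurable borel"
  shows "integrable lborel (\<lambda>x. cis (\<theta> x) * f x)"
  by (rule Bochner_Integration.integrable_bound[OF assms(1)])
     (use assms(1) in \<open>auto simp: norm_mult\<close>)

lemma norm_ft_le: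
  assumes "integrable lborel f"
  shows "norm (ft f \<xi>) \<le> (LBINT x. norm (f x))"
  unfolding ft_def
  by (rule order.trans[OF integral_norm_bound]) (simp add: norm_mult)

lemma continuous_on_ft:
  assumes f: "integrable lborel f"
  shows "continuous_on S (ft f)"
proof (rule continuous_on_subset[OF _ subset_UNIV], rule continuous_on_sequentiallyI)
  fix u and a :: 'a
  assume u: "u \<longlonglongrightarrow> a"
  have [measurable]: "f \<in> borel_measurable borel" using f by auto
  show "(\<lambda>k. ft f (u k)) \<longlonglongrightarrow> ft f a"
    unfolding ft_def
  proof (rule integral_dominated_convergence[where w="\<lambda>x. norm (f x)"])
    show "AE x in lborel. (\<lambda>k. cis (- (x \<bullet> u k)) * f x) \<longlonglongrightarrow> cis (- (x \<bullet> a)) * f x"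
      by (intro AE_I2 tendsto_mult_right tendsto_cis tendsto_minus tendsto_inner u tendsto_const)
  qed (use f in \<open>auto simp: norm_mult\<close>)
qed

lemma ft_measurable: "integrable lborel f \<Longrightarrow> ft f \<in> borel_measurable borel"
  by (rule borel_measurable_continuous_onI[OF continuous_on_ft])

lemma integrable_pair_product:
  fixes f :: "'a::euclidean_space \<Rightarrow> complex" and g :: "'b::euclidean_space \<Rightarrow> complex"
  assumes f: "integrable lborel f" and g: "integrable lborel g"
  shows "integrable (lborel \<Otimes>\<^sub>M lborel) (\<lambda>(x, y). f x * g y)"
proof -
  have [measurable]: "f \<in> borel_measurable borel" "g \<in> borel_measurable borel" using f g by auto
  show ?thesis
    by (rule lborel_pair.Fubini_integrable) (use f g in \<open>auto simp: norm_mult\<close>)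
qed

text \<open>Fubini, since the kernel is symmetric in x and \<xi> and has modulus 1.\<close>

lemma ft_mult_formula:
  assumes f: "integrable lborel f" and g: "integrable lborel g"
  shows "(LBINT \<xi>. ft f \<xi> * g \<xi>) = (LBINT x. f x * ft g x)"
proof -
  have [measurable]: "f \<in> borel_measurable borel" "g \<in> borel_measurable borel" using f g by auto
  have i: "integrable (lborel \<Otimes>\<^sub>M lborel) (\<lambda>(x, \<xi>). cis (- (x \<bullet> \<xi>)) * f x * g \<xi>)"
    by (rule Bochner_Integration.integrable_bound[OF integrable_pair_product[OF f g]])
       (auto simp: norm_mult split_beta')
  have "(LBINT \<xi>. ft f \<xi> * g \<xi>) = (LBINT \<xi>. LBINT x. cis (- (x \<bullet> \<xi>)) * f x * g \<xi>)"
    by (simp add: ft_def)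
  also have "\<dots> = (LBINT x. LBINT \<xi>. cis (- (x \<bullet> \<xi>)) * f x * g \<xi>)"
    by (rule lborel_pair.Fubini_integral[OF i])
  also have "\<dots> = (LBINT x. f x * ft g x)"
  proof (rule Bochner_Integration.integral_cong[OF refl])
    fix x :: 'a
    have "(LBINT \<xi>. cis (- (x \<bullet> \<xi>)) * f x * g \<xi>) = (LBINT \<xi>. f x * (cis (- (\<xi> \<bullet> x)) * g \<xi>))"
      by (simp add: mult_ac inner_commute)
    then show "(LBINT \<xi>. cis (- (x \<bullet> \<xi>)) * f x * g \<xi>) = f x * ft g x"
      by (simp add: ft_def)
  qed
  finally show ?thesis .
qed

text \<open>The Fourier integral of the Gaussian \<open>gauss (r *\<^sub>R x)\<close>. It has width
  r and total mass (2 pi)^n for every r, so it is an approximate identity up to the constant of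
  Fourier inversion.\<close>

definition heat :: "real \<Rightarrow> 'a::euclidean_space \<Rightarrow> real" where
  "heat r x = (sqrt (2 * pi) / r) ^ DIM('a) * gauss (x /\<^sub>R r)"

lemma heat_measurable [measurable]: "heat r \<in> borel_measurable borel"
  unfolding heat_def[abs_def] by measurable

lemma heat_nonneg: "r > 0 \<Longrightarrow> 0 \<le> heat r x"
  unfolding heat_def using gauss_bounds(1)[of "x /\<^sub>R r"] by simp

lemma heat_le: "r > 0 \<Longrightarrow> heat r (x :: 'a::euclidean_space) \<le> (sqrt (2 * pi) / r) ^ DIM('a)"
  unfolding heat_def using gauss_bounds(2)[of "x /\<^sub>R r"] by (simp add: mult_left_le)

lemma heat_minus_commute: "heat r (x - y) = heat r (y - x)"
  by (simp add: heat_def gauss_def norm_minus_commute[of x y])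

lemma heat_integrable:
  "r > 0 \<Longrightarrow> integrable lborel (\<lambda>y::'a::euclidean_space. heat r (y - x))"
  unfolding heat_def using gauss_scaled_integrable[of "inverse r" "- (x /\<^sub>R r)"]
  by (simp add: scaleR_diff_right)

lemma integrable_mult_heat:
  fixes f :: "'a::euclidean_space \<Rightarrow> complex"
  assumes r: "r > 0" and f: "integrable lborel f"
  shows "integrable lborel (\<lambda>y. f y * of_real (heat r (y - x)))"
proof (rule Bochner_Integration.integrable_bound)
  show "integrable lborel (\<lambda>y. (sqrt (2 * pi) / r) ^ DIM('a) * norm (f y))"
    using f by (intro integrable_mult_right integrable_norm)
  show "AE y in lborel. norm (f y * of_real (heat r (y - x))) \<le> norm ((sqrt (2 * pi) / r) ^ DIM('a) * norm (f y))"
  proof (rule AE_I2)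
    fix y
    show "norm (f y * of_real (heat r (y - x))) \<le> norm ((sqrt (2 * pi) / r) ^ DIM('a) * norm (f y))"
      using mult_left_mono[OF heat_le[OF r, of "y - x"], of "norm (f y)"] heat_nonneg[OF r, of "y - x"] r
      by (simp add: norm_mult abs_mult mult.commute)
  qed
qed (use f in auto)

text \<open>Moves the parameter r from the weight into the argument of f. The weight is then a fixed
  integrable function, as dominated convergence for r tending to 0 requires.\<close>

lemma heat_substitute:
  fixes f :: "'a::euclidean_space \<Rightarrow> complex"
  assumes "r > 0" and [measurable]: "f \<in> borel_measurable borel"
  shows "(LBINT y. f y * of_real (heat r (y - x))) =
    of_real (sqrt (2 * pi) ^ DIM('a)) * (LBINT z. f (x + r *\<^sub>R z) * of_real (gauss z))"
proof -
  have "(LBINT y. f y * of_real (heat r (y - x))) =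
    \<bar>r\<bar> ^ DIM('a) *\<^sub>R (LBINT z. f (x + r *\<^sub>R z) * of_real (heat r (x + r *\<^sub>R z - x)))"
    by (rule lborel_integral_affine) (use assms in auto)
  also have "\<dots> = \<bar>r\<bar> ^ DIM('a) *\<^sub>R (LBINT z. of_real ((sqrt (2 * pi) / r) ^ DIM('a)) * (f (x + r *\<^sub>R z) * of_real (gauss z)))"
    using assms by (simp add: heat_def mult_ac)
  also have "\<dots> = of_real (sqrt (2 * pi) ^ DIM('a)) * (LBINT z. f (x + r *\<^sub>R z) * of_real (gauss z))"
    using assms by (simp add: scaleR_conv_of_real power_divide)
  finally show ?thesis .
qed

lemma sqrt_2pi_power: "sqrt (2 * pi) ^ n * sqrt (2 * pi) ^ n = (2 * pi) ^ n"
  by (metis power_mult_distrib real_sqrt_mult_self abs_of_pos pi_gt_zero zero_less_mult_iff zero_less_numeral)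

lemma heat_integral:
  fixes x :: "'a::euclidean_space"
  assumes "r > 0"
  shows "(LBINT y. heat r (y - x)) = (2 * pi) ^ DIM('a)"
proof -
  have "complex_of_real (LBINT y. heat r (y - x)) = of_real (sqrt (2 * pi) ^ DIM('a)) * of_real (sqrt (2 * pi) ^ DIM('a))"
    using heat_substitute[OF assms, of "\<lambda>_. 1" x] unfolding gauss_integral[where 'a='a, symmetric] by simp
  also have "\<dots> = of_real ((2 * pi) ^ DIM('a))"
    unfolding of_real_mult[symmetric] sqrt_2pi_power ..
  finally show ?thesis by (simp only: of_real_eq_iff)
qed

lemma heat_nn_integral:
  fixes x :: "'a::euclidean_space" assumes "r > 0"
  shows "(\<integral>\<^sup>+y. ennreal (heat r (y - x)) \<partial>lborel) = ennreal ((2 * pi) ^ DIM('a))"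
  using heat_integral[OF assms, of x]
  by (subst nn_integral_eq_integral) (auto simp: heat_nonneg assms heat_integrable)

lemma ft_gauss_modulated:
  assumes "r > 0"
  shows "ft (\<lambda>\<xi>. cis (\<xi> \<bullet> x) * of_real (gauss (r *\<^sub>R \<xi>))) y = of_real (heat r (y - x))"
proof -
  have "ft (\<lambda>\<xi>. cis (\<xi> \<bullet> x) * of_real (gauss (r *\<^sub>R \<xi>))) y =
    (LBINT \<xi>. cis (- (\<xi> \<bullet> (y - x))) * of_real (gauss (r *\<^sub>R \<xi>)))"
    unfolding ft_def by (simp add: mult.assoc[symmetric] cis_mult inner_diff_right)
  then show ?thesis using gauss_scaled_fourier[OF assms, of "y - x"] by (simp add: heat_def)
qed

lemma gauss_modulated_integrable:
  "r > 0 \<Longrightarrow> integrable lborel (\<lambda>\<xi>::'a::euclidean_space. cis (\<xi> \<bullet> x) * complex_of_real (gauss (r *\<^sub>R \<xi>)))"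
  using gauss_scaled_integrable[of r 0] by (intro integrable_cis_mult) auto

text \<open>The multiplication formula applied to a modulated Gaussian, whose transform is the heat
  kernel centred at x. The left-hand side is a damped inversion integral, so it makes sense without
  integrability of \<open>ft f\<close>.\<close>

lemma ft_smoothing:
  assumes "r > 0" and f: "integrable lborel f"
  shows "(LBINT \<xi>. ft f \<xi> * (cis (\<xi> \<bullet> x) * of_real (gauss (r *\<^sub>R \<xi>)))) =
         (LBINT y. f y * of_real (heat r (y - x)))"
  using ft_mult_formula[OF f gauss_modulated_integrable[OF assms(1)], of x]
  by (simp add: ft_gauss_modulated[OF assms(1)])

lemma ennreal_half_mult: "ennreal (1/2) * (z + z) = z"
proof -
  have "ennreal (1/2) * (z + z) = (ennreal (1/2) * 2) * z" by (simp add: mult_2[symmetric] mult.assoc del: ennreal_half)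
  also have "ennreal (1/2) * 2 = ennreal (1/2 * 2)" by (subst ennreal_mult) auto
  finally show ?thesis by simp
qed

text \<open>The damping makes the conjugate transform integrable, so the multiplication formula
  turns the left-hand side into a double integral of f(x) and conjugate f(y) against the heat
  kernel. Then a Schur test applies: the kernel is symmetric with mass (2 pi)^n in each
  variable.\<close>

lemma ft_contraction_damped:
  fixes f :: "'a::euclidean_space \<Rightarrow> complex"
  assumes r: "r > 0" and f: "integrable lborel f"
  shows "(\<integral>\<^sup>+\<xi>. ennreal ((norm (ft f \<xi>))\<^sup>2 * gauss (r *\<^sub>R \<xi>)) \<partial>lborel) \<le> ennreal ((2 * pi) ^ DIM('a)) * N2 f"
proof -
  have [measurable]: "f \<in> borel_measurable borel" using f by auto
  note [measurable] = ft_measurable[OF f]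
  define J where "J x y = ennreal ((norm (f x))\<^sup>2 * heat r (y - x))" for x y
  \<comment> \<open>Chosen so that \<open>ft f \<xi> * g \<xi>\<close> is the damped square; the
    transform of g is the conjugate of a heat average of f, by \<open>ft_smoothing\<close>.\<close>
  define g where "g \<xi> = cnj (ft f \<xi>) * of_real (gauss (r *\<^sub>R \<xi>))" for \<xi>
  have [measurable]: "g \<in> borel_measurable borel" unfolding g_def[abs_def] by measurable
  have g: "integrable lborel g"
    by (rule Bochner_Integration.integrable_bound[where f="\<lambda>\<xi>. (LBINT x. norm (f x)) * gauss (r *\<^sub>R \<xi>)"])
       (use gauss_scaled_integrable[of r 0] r gauss_bounds(1) norm_ft_le[OF f] in
         \<open>auto simp: g_def norm_mult abs_mult intro!: mult_mono\<close>)
  have ftg: "ft g x = cnj (LBINT y. f y * of_real (heat r (y - x)))" for x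
  proof -
    have "cnj (ft g x) = (LBINT \<xi>. cnj (cis (- (\<xi> \<bullet> x)) * g \<xi>))"
      unfolding ft_def by (rule Bochner_Integration.integral_cnj[symmetric])
    also have "\<dots> = (LBINT \<xi>. ft f \<xi> * (cis (\<xi> \<bullet> x) * of_real (gauss (r *\<^sub>R \<xi>))))"
      by (simp add: g_def cis_cnj mult_ac)
    finally show ?thesis
      unfolding ft_smoothing[OF r f] by (metis complex_cnj_cnj)
  qed
  have eq: "complex_of_real ((norm (ft f \<xi>))\<^sup>2 * gauss (r *\<^sub>R \<xi>)) = ft f \<xi> * g \<xi>" for \<xi>
    unfolding g_def by (simp add: complex_norm_square mult.assoc del: of_real_power)
  have i: "integrable lborel (\<lambda>\<xi>. ft f \<xi> * g \<xi>)"
    by (rule Bochner_Integration.integrable_bound[where f="\<lambda>\<xi>. (LBINT x. norm (f x)) * norm (g \<xi>)"])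
       (use g norm_ft_le[OF f] in \<open>auto simp: norm_mult abs_mult intro!: mult_mono\<close>)
  then have i': "integrable lborel (\<lambda>\<xi>. (norm (ft f \<xi>))\<^sup>2 * gauss (r *\<^sub>R \<xi>))"
    unfolding eq[symmetric] complex_of_real_integrable_eq .
  have "(\<integral>\<^sup>+\<xi>. ennreal ((norm (ft f \<xi>))\<^sup>2 * gauss (r *\<^sub>R \<xi>)) \<partial>lborel)
      = ennreal (LBINT \<xi>. (norm (ft f \<xi>))\<^sup>2 * gauss (r *\<^sub>R \<xi>))"
    by (rule nn_integral_eq_integral[OF i']) (auto simp: gauss_bounds less_imp_le)
  also have "\<dots> \<le> ennreal (norm (LBINT \<xi>. ft f \<xi> * g \<xi>))"
    unfolding eq[symmetric] integral_complex_of_real norm_of_real by (intro ennreal_leI abs_ge_self)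
  also have "(LBINT \<xi>. ft f \<xi> * g \<xi>) = (LBINT x. f x * ft g x)"
    by (rule ft_mult_formula[OF f g])
  also have "ennreal (norm (LBINT x. f x * ft g x)) \<le> (\<integral>\<^sup>+x. ennreal (norm (f x * ft g x)) \<partial>lborel)"
  proof (rule integral_norm_bound_ennreal)
    show "integrable lborel (\<lambda>x. f x * ft g x)"
      by (rule Bochner_Integration.integrable_bound[where f="\<lambda>\<xi>. (LBINT x. norm (g x)) * norm (f \<xi>)"])
       (use f norm_ft_le[OF g] ft_measurable[OF g] in \<open>auto simp: norm_mult abs_mult mult.commute intro!: mult_mono\<close>)
  qed
  \<comment> \<open>Schur test: |f(x)| |f(y)| is at most half the sum of the squares, and by
    symmetry of the kernel both halves have the same integral.\<close>
  also have "\<dots> \<le> (\<integral>\<^sup>+x. \<integral>\<^sup>+y. ennreal (1/2) * (J x y + J y x) \<partial>lborel \<partial>lborel)"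
  proof (rule nn_integral_mono)
    fix x :: 'a
    from integral_norm_bound_ennreal[OF integrable_mult_heat[OF r f]]
    have "ennreal (norm (ft g x)) \<le> (\<integral>\<^sup>+y. ennreal (norm (f y) * heat r (y - x)) \<partial>lborel)"
      by (simp add: ftg norm_mult heat_nonneg[OF r])
    from mult_left_mono[OF this, of "ennreal (norm (f x))"]
    have "ennreal (norm (f x * ft g x)) \<le> (\<integral>\<^sup>+y. ennreal (norm (f x)) * ennreal (norm (f y) * heat r (y - x)) \<partial>lborel)"
      by (simp add: norm_mult ennreal_mult nn_integral_cmult)
    also have "\<dots> \<le> (\<integral>\<^sup>+y. ennreal (1/2) * (J x y + J y x) \<partial>lborel)"
    proof (rule nn_integral_mono)
      fix y
      have "norm (f x) * norm (f y) \<le> 1/2 * ((norm (f x))\<^sup>2 + (norm (f y))\<^sup>2)"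
        using sum_squares_bound[of "norm (f x)" "norm (f y)"] by simp
      from mult_right_mono[OF this heat_nonneg[OF r]]
      show "ennreal (norm (f x)) * ennreal (norm (f y) * heat r (y - x)) \<le> ennreal (1/2) * (J x y + J y x)"
        using heat_nonneg[OF r, of "y - x"] unfolding J_def heat_minus_commute[of r x y]
        by (simp add: ennreal_mult[symmetric] ennreal_plus[symmetric] ring_distribs mult.assoc del: ennreal_plus ennreal_half)
    qed
    finally show "ennreal (norm (f x * ft g x)) \<le> (\<integral>\<^sup>+y. ennreal (1/2) * (J x y + J y x) \<partial>lborel)" .
  qed
  also have "\<dots> = ennreal (1/2) * ((\<integral>\<^sup>+x. \<integral>\<^sup>+y. J x y \<partial>lborel \<partial>lborel) + (\<integral>\<^sup>+x. \<integral>\<^sup>+y. J y x \<partial>lborel \<partial>lborel))"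
    unfolding J_def by (simp add: nn_integral_cmult nn_integral_add del: ennreal_half)
  also have "(\<integral>\<^sup>+x. \<integral>\<^sup>+y. J y x \<partial>lborel \<partial>lborel) = (\<integral>\<^sup>+x. \<integral>\<^sup>+y. J x y \<partial>lborel \<partial>lborel)"
    unfolding J_def by (rule lborel_pair.Fubini') measurable
  also have "(\<integral>\<^sup>+x. \<integral>\<^sup>+y. J x y \<partial>lborel \<partial>lborel) = ennreal ((2 * pi) ^ DIM('a)) * N2 f"
    unfolding J_def N2_def
    by (simp add: ennreal_mult heat_nonneg[OF r] nn_integral_cmult heat_nn_integral[OF r] nn_integral_multc mult.commute)
  finally show ?thesis by (simp only: ennreal_half_mult)
qed

text \<open>Fatou's lemma removes the damping, since \<open>gauss (r *\<^sub>R \<xi>)\<close> tends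
  to 1 as r tends to 0.\<close>

lemma ft_contraction:
  fixes f :: "'a::euclidean_space \<Rightarrow> complex"
  assumes f: "integrable lborel f"
  shows "N2 (ft f) \<le> ennreal ((2 * pi) ^ DIM('a)) * N2 f"
  unfolding N2_def[of "ft f"]
proof (rule nn_integral_le_limit)
  fix k :: nat
  show "(\<integral>\<^sup>+\<xi>. ennreal ((norm (ft f \<xi>))\<^sup>2 * gauss ((1 / real (Suc k)) *\<^sub>R \<xi>)) \<partial>lborel) \<le> ennreal ((2 * pi) ^ DIM('a)) * N2 f"
    by (rule ft_contraction_damped[OF _ f]) simp
  show "(\<lambda>\<xi>. ennreal ((norm (ft f \<xi>))\<^sup>2 * gauss ((1 / real (Suc k)) *\<^sub>R \<xi>))) \<in> borel_measurable lborel"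
    using ft_measurable[OF f] by measurable
next
  show "AE \<xi> in lborel. (\<lambda>k. ennreal ((norm (ft f \<xi>))\<^sup>2 * gauss ((1 / real (Suc k)) *\<^sub>R \<xi>))) \<longlonglongrightarrow> ennreal ((norm (ft f \<xi>))\<^sup>2)"
  proof (rule AE_I2, rule tendsto_ennrealI)
    fix \<xi> :: 'a
    have "(\<lambda>k. (norm (ft f \<xi>))\<^sup>2 * exp (- (norm ((1 / real (Suc k)) *\<^sub>R \<xi>))\<^sup>2 / 2)) \<longlonglongrightarrow> (norm (ft f \<xi>))\<^sup>2 * exp (- (norm (0 *\<^sub>R \<xi>))\<^sup>2 / 2)"
      by (intro tendsto_intros lim_1_over_n[THEN LIMSEQ_Suc]) simp
    then show "(\<lambda>k. (norm (ft f \<xi>))\<^sup>2 * gauss ((1 / real (Suc k)) *\<^sub>R \<xi>)) \<longlonglongrightarrow> (norm (ft f \<xi>))\<^sup>2"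
      by (simp add: gauss_def)
  qed
qed

text \<open>Both sides of \<open>ft_smoothing\<close> converge as r tends to 0: the left by
  integrability of \<open>ft f\<close>, the right because f is bounded and continuous. Continuity is
  what gives the formula at every x and not just almost everywhere.\<close>

lemma ft_inversion:
  fixes f :: "'a::euclidean_space \<Rightarrow> complex"
  assumes f: "integrable lborel f" and ff: "integrable lborel (ft f)"
    and cont: "continuous_on UNIV f" and bdd: "\<And>x. norm (f x) \<le> B"
  shows "(LBINT \<xi>. ft f \<xi> * cis (\<xi> \<bullet> x)) = of_real ((2 * pi) ^ DIM('a)) * f x"
proof -
  let ?c = "complex_of_real (sqrt (2 * pi) ^ DIM('a))"
  have [measurable]: "f \<in> borel_measurable borel" using f by auto
  note [measurable] = ft_measurable[OF f]
  define e where "e k = 1 / real (Suc k)" for k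
  have e: "e k > 0" for k by (simp add: e_def)
  have e0: "e \<longlonglongrightarrow> 0" unfolding e_def by (rule lim_1_over_n[THEN LIMSEQ_Suc])
  have f_lim: "(\<lambda>k. f (x + e k *\<^sub>R z)) \<longlonglongrightarrow> f x" for z
    using continuous_on_tendsto_compose[OF cont, of "\<lambda>k. x + e k *\<^sub>R z" x]
      tendsto_add[OF tendsto_const tendsto_scaleR[OF e0 tendsto_const], of x z] by auto
  have B: "B \<ge> 0" using bdd[of 0] norm_ge_zero[of "f 0"] by linarith
  have A: "(\<lambda>k. LBINT \<xi>. ft f \<xi> * (cis (\<xi> \<bullet> x) * of_real (gauss (e k *\<^sub>R \<xi>)))) \<longlonglongrightarrow> (LBINT \<xi>. ft f \<xi> * cis (\<xi> \<bullet> x))"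
  proof (rule integral_dominated_convergence[where w="\<lambda>\<xi>. norm (ft f \<xi>)"])
    show "AE \<xi> in lborel. (\<lambda>k. ft f \<xi> * (cis (\<xi> \<bullet> x) * of_real (gauss (e k *\<^sub>R \<xi>)))) \<longlonglongrightarrow> ft f \<xi> * cis (\<xi> \<bullet> x)"
    proof (rule AE_I2)
      fix \<xi> :: 'a
      have "(\<lambda>k. ft f \<xi> * (cis (\<xi> \<bullet> x) * of_real (exp (- (norm (e k *\<^sub>R \<xi>))\<^sup>2 / 2)))) \<longlonglongrightarrow> ft f \<xi> * (cis (\<xi> \<bullet> x) * of_real (exp (- (norm (0 *\<^sub>R \<xi>))\<^sup>2 / 2)))"
        by (intro tendsto_intros e0) simp
      then show "(\<lambda>k. ft f \<xi> * (cis (\<xi> \<bullet> x) * of_real (gauss (e k *\<^sub>R \<xi>)))) \<longlonglongrightarrow> ft f \<xi> * cis (\<xi> \<bullet> x)"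
        by (simp add: gauss_def)
    qed
  qed (use ff in \<open>auto intro!: AE_I2 simp: norm_mult abs_of_pos[OF gauss_bounds(1)] mult_left_le gauss_bounds(2)\<close>)
  have "(\<lambda>k. LBINT z. f (x + e k *\<^sub>R z) * of_real (gauss z)) \<longlonglongrightarrow> (LBINT z::'a. f x * of_real (gauss z))"
  proof (rule integral_dominated_convergence[where w="\<lambda>z::'a. B * gauss z"])
    show "AE z in lborel. (\<lambda>k. f (x + e k *\<^sub>R z) * of_real (gauss z)) \<longlonglongrightarrow> f x * of_real (gauss z)"
      by (intro AE_I2 tendsto_mult f_lim tendsto_const)
    show "\<And>k. AE z in lborel. norm (f (x + e k *\<^sub>R z) * of_real (gauss z)) \<le> B * gauss z"
      by (intro AE_I2) (simp add: norm_mult abs_of_pos[OF gauss_bounds(1)] mult_right_mono less_imp_le[OF gauss_bounds(1)] bdd)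
  qed (use gauss_integrable in auto)
  then have B: "(\<lambda>k. ?c * (LBINT z. f (x + e k *\<^sub>R z) * of_real (gauss z)))
     \<longlonglongrightarrow> ?c * (LBINT z::'a. f x * of_real (gauss z))"
    by (intro tendsto_mult tendsto_const)
  have eq: "(LBINT \<xi>. ft f \<xi> * (cis (\<xi> \<bullet> x) * of_real (gauss (e k *\<^sub>R \<xi>)))) =
     ?c * (LBINT z. f (x + e k *\<^sub>R z) * of_real (gauss z))" for k
    using ft_smoothing[OF e f] heat_substitute[OF e, of f] by simp
  have "(LBINT \<xi>. ft f \<xi> * cis (\<xi> \<bullet> x)) = ?c * (LBINT z::'a. f x * of_real (gauss z))"
    by (rule LIMSEQ_unique[OF A[unfolded eq] B])
  \<comment> \<open>One factor comes from \<open>heat_substitute\<close>, the other from the total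
    mass of \<open>gauss\<close>.\<close>
  also have "\<dots> = of_real (sqrt (2 * pi) ^ DIM('a) * sqrt (2 * pi) ^ DIM('a)) * f x"
    using gauss_integral[where 'a='a] by simp
  also have "sqrt (2 * pi) ^ DIM('a) * sqrt (2 * pi) ^ DIM('a) = (2 * pi) ^ DIM('a)"
    by (rule sqrt_2pi_power)
  finally show ?thesis .
qed

section \<open>Injectivity on square integrable functions\<close>

abbreviation L2_lim :: "(nat \<Rightarrow> 'a::euclidean_space \<Rightarrow> complex) \<Rightarrow> ('a \<Rightarrow> complex) \<Rightarrow> bool" where
  "L2_lim F f \<equiv> (\<lambda>k. N2 (\<lambda>x. F k x - f x)) \<longlonglongrightarrow> 0"

lemma norm_add_sq_le: "(norm (x + y))\<^sup>2 \<le> 2 * (norm x)\<^sup>2 + 2 * (norm y)\<^sup>2" for x y :: "'a::real_normed_vector"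
proof -
  have "(norm (x + y))\<^sup>2 \<le> (norm x + norm y)\<^sup>2"
    by (intro power_mono norm_triangle_ineq norm_ge_zero)
  also have "\<dots> \<le> 2 * (norm x)\<^sup>2 + 2 * (norm y)\<^sup>2"
    using sum_squares_bound[of "norm x" "norm y"] by (simp add: power2_sum)
  finally show ?thesis .
qed

text \<open>The factor 2 replaces the triangle inequality, because \<open>N2\<close> is a squared
  norm; for convergence statements this loss is harmless.\<close>

lemma N2_add_le:
  assumes [measurable]: "f \<in> borel_measurable borel" "g \<in> borel_measurable borel"
  shows "N2 (\<lambda>x. f x + g x) \<le> 2 * N2 f + 2 * N2 g"
proof -
  have "N2 (\<lambda>x. f x + g x) \<le> (\<integral>\<^sup>+x. 2 * ennreal ((norm (f x))\<^sup>2) + 2 * ennreal ((norm (g x))\<^sup>2) \<partial>lborel)"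
    unfolding N2_def
  proof (rule nn_integral_mono)
    fix x
    have "ennreal ((norm (f x + g x))\<^sup>2) \<le> ennreal (2 * (norm (f x))\<^sup>2 + 2 * (norm (g x))\<^sup>2)"
      by (intro ennreal_leI norm_add_sq_le)
    then show "ennreal ((norm (f x + g x))\<^sup>2) \<le> 2 * ennreal ((norm (f x))\<^sup>2) + 2 * ennreal ((norm (g x))\<^sup>2)"
      by (simp add: ennreal_mult)
  qed
  also have "\<dots> = 2 * N2 f + 2 * N2 g"
    unfolding N2_def by (simp add: nn_integral_add nn_integral_cmult)
  finally show ?thesis .
qed

lemma N2_minus_commute: "N2 (\<lambda>x. f x - g x) = N2 (\<lambda>x. g x - f x)"
  unfolding N2_def by (simp add: norm_minus_commute)

lemma N2_triangle:
  assumes [measurable]: "f \<in> borel_measurable borel" "g \<in> borel_measurable borel" "h \<in> borel_measurable borel"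
  shows "N2 (\<lambda>x. f x - h x) \<le> 2 * N2 (\<lambda>x. f x - g x) + 2 * N2 (\<lambda>x. g x - h x)"
  using N2_add_le[of "\<lambda>x. f x - g x" "\<lambda>x. g x - h x"] by simp

lemma norm_sq_integral_mult_le:
  assumes [measurable]: "u \<in> borel_measurable borel" "v \<in> borel_measurable borel"
  shows "ennreal ((norm (LBINT x. u x * v x))\<^sup>2) \<le> N2 u * N2 v"
proof (cases "integrable lborel (\<lambda>x. u x * v x)")
  case True
  have "ennreal ((norm (LBINT x. u x * v x))\<^sup>2) = (ennreal (norm (LBINT x. u x * v x)))\<^sup>2"
    by (simp add: ennreal_power)
  also have "\<dots> \<le> (\<integral>\<^sup>+x. ennreal (norm (u x)) * ennreal (norm (v x)) \<partial>lborel)\<^sup>2"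
    using integral_norm_bound_ennreal[OF True]
    by (intro power_mono) (simp_all add: norm_mult ennreal_mult)
  also have "\<dots> \<le> N2 u * N2 v"
    unfolding N2_def using Cauchy_Schwarz_nn_integral[of "\<lambda>x. ennreal (norm (u x))" lborel "\<lambda>x. ennreal (norm (v x))"]
    by (simp add: ennreal_power)
  finally show ?thesis .
\<comment> \<open>If the product is not integrable, its Bochner integral is 0 by convention.\<close>
qed (simp add: not_integrable_integral_eq)

lemma ennreal_tendsto_0_le:
  fixes f g :: "nat \<Rightarrow> ennreal"
  assumes "\<And>k. f k \<le> g k" "g \<longlonglongrightarrow> 0"
  shows "f \<longlonglongrightarrow> 0"
  by (rule tendsto_sandwich[of "\<lambda>_. 0" f sequentially g 0]) (use assms in auto)

lemma tendsto_integral_mult_N2: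
  assumes [measurable]: "\<And>k. u k \<in> borel_measurable borel" "v \<in> borel_measurable borel"
    and u: "(\<lambda>k. N2 (u k)) \<longlonglongrightarrow> 0" and v: "N2 v < \<infinity>"
  shows "(\<lambda>k. LBINT x. u k x * v x) \<longlonglongrightarrow> 0"
proof -
  have "(\<lambda>k. N2 v * N2 (u k)) \<longlonglongrightarrow> N2 v * 0"
    using u v by (intro ennreal_tendsto_cmult) auto
  then have lim: "(\<lambda>k. N2 v * N2 (u k)) \<longlonglongrightarrow> 0" by simp
  have "ennreal ((norm (LBINT x. u k x * v x))\<^sup>2) \<le> N2 v * N2 (u k)" for k
    using norm_sq_integral_mult_le[of "u k" v] by (simp add: mult.commute)
  from ennreal_tendsto_0_le[OF this lim]
  have "(\<lambda>k. ennreal ((norm (LBINT x. u k x * v x))\<^sup>2)) \<longlonglongrightarrow> 0" .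
  then have "(\<lambda>k. (norm (LBINT x. u k x * v x))\<^sup>2) \<longlonglongrightarrow> 0"
    by (rule ennreal_tendsto_0_iff[THEN iffD1, rotated]) simp
  then have "(\<lambda>k. sqrt ((norm (LBINT x. u k x * v x))\<^sup>2)) \<longlonglongrightarrow> sqrt 0"
    by (rule tendsto_real_sqrt)
  then show ?thesis by (simp add: tendsto_norm_zero_iff)
qed

lemma heat_N2:
  assumes "r > 0"
  shows "N2 (\<lambda>y::'a::euclidean_space. of_real (heat r (y - x))) \<le> ennreal ((sqrt (2 * pi) / r) ^ DIM('a)) * ennreal ((2 * pi) ^ DIM('a))"
proof -
  let ?c = "(sqrt (2 * pi) / r) ^ DIM('a)"
  have "N2 (\<lambda>y::'a. of_real (heat r (y - x))) \<le> (\<integral>\<^sup>+y. ennreal ?c * ennreal (heat r (y - x)) \<partial>lborel)"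
    unfolding N2_def
  proof (rule nn_integral_mono)
    fix y :: 'a
    have "heat r (y - x) * heat r (y - x) \<le> ?c * heat r (y - x)"
      by (intro mult_right_mono heat_le heat_nonneg assms)
    then show "ennreal ((cmod (complex_of_real (heat r (y - x))))\<^sup>2) \<le> ennreal ?c * ennreal (heat r (y - x))"
      using heat_nonneg[OF assms, of "y - x"] assms by (simp add: power2_eq_square ennreal_mult[symmetric] ennreal_leI)
  qed
  also have "\<dots> = ennreal ?c * ennreal ((2 * pi) ^ DIM('a))"
    by (simp add: nn_integral_cmult heat_nn_integral[OF assms])
  finally show ?thesis .
qed

lemma heat_N2_finite: "r > 0 \<Longrightarrow> N2 (\<lambda>y::'a::euclidean_space. of_real (heat r (y - x))) < \<infinity>"
  by (rule order.strict_trans1[OF heat_N2]) (auto simp: ennreal_mult_less_top)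

lemma gauss_modulated_N2:
  assumes "r > 0"
  shows "N2 (\<lambda>\<xi>::'a::euclidean_space. cis (\<xi> \<bullet> x) * of_real (gauss (r *\<^sub>R \<xi>))) < \<infinity>"
proof -
  have "N2 (\<lambda>\<xi>::'a. cis (\<xi> \<bullet> x) * of_real (gauss (r *\<^sub>R \<xi>))) \<le> (\<integral>\<^sup>+\<xi>. ennreal (gauss (r *\<^sub>R (\<xi> :: 'a))) \<partial>lborel)"
    unfolding N2_def
  proof (intro nn_integral_mono ennreal_leI)
    fix \<xi> :: 'a
    show "(cmod (cis (\<xi> \<bullet> x) * complex_of_real (gauss (r *\<^sub>R \<xi>))))\<^sup>2 \<le> gauss (r *\<^sub>R \<xi>)"
      using gauss_bounds[of "r *\<^sub>R \<xi>"] by (simp add: norm_mult power2_eq_square mult_left_le)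
  qed
  also have "\<dots> < \<infinity>"
    using gauss_scaled_integrable[of r "0::'a"] assms less_imp_le[OF gauss_bounds(1)]
    by (subst nn_integral_eq_integral) auto
  finally show ?thesis .
qed

lemma nn_integral_mult_le_N2:
  assumes [measurable]: "u \<in> borel_measurable borel" "v \<in> borel_measurable borel"
  shows "(\<integral>\<^sup>+x. ennreal (norm (u x * v x)) \<partial>lborel) \<le> N2 u + N2 v"
proof -
  have "(\<integral>\<^sup>+x. ennreal (norm (u x * v x)) \<partial>lborel) \<le> (\<integral>\<^sup>+x. ennreal ((norm (u x))\<^sup>2) + ennreal ((norm (v x))\<^sup>2) \<partial>lborel)"
  proof (rule nn_integral_mono)
    fix x
    have "norm (u x * v x) \<le> (norm (u x))\<^sup>2 + (norm (v x))\<^sup>2"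
      using sum_squares_bound[of "norm (u x)" "norm (v x)"] mult_nonneg_nonneg[OF norm_ge_zero norm_ge_zero, of "u x" "v x"]
      unfolding norm_mult by linarith
    then show "ennreal (norm (u x * v x)) \<le> ennreal ((norm (u x))\<^sup>2) + ennreal ((norm (v x))\<^sup>2)"
      by (simp add: ennreal_plus[symmetric] ennreal_leI del: ennreal_plus)
  qed
  then show ?thesis unfolding N2_def by (simp add: nn_integral_add)
qed

lemma integrable_mult_N2:
  assumes [measurable]: "u \<in> borel_measurable borel" "v \<in> borel_measurable borel"
    and "N2 u < \<infinity>" "N2 v < \<infinity>"
  shows "integrable lborel (\<lambda>x. u x * v x)"
  using order.strict_trans1[OF nn_integral_mult_le_N2[of u v]] assms
  by (intro integrableI_bounded) auto

text \<open>By \<open>ft_smoothing\<close> a heat average of \<open>D k\<close> is the pairing of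
  \<open>ft (D k)\<close> with a fixed L2 function, so it tends to 0; it also tends to the heat
  average of d, since the heat kernel is itself in L2.\<close>

lemma heat_average_eq_0:
  assumes D: "\<And>k. integrable lborel (D k)" "L2_lim D d"
    and ftD: "(\<lambda>k. N2 (ft (D k))) \<longlonglongrightarrow> 0"
    and [measurable]: "d \<in> borel_measurable borel" and d: "N2 d < \<infinity>" and r: "r > 0"
  shows "(LBINT y. d y * of_real (heat r (y - x))) = 0"
proof -
  have [measurable]: "D k \<in> borel_measurable borel" for k using D(1)[of k] by auto
  note [measurable] = ft_measurable[OF D(1)]
  let ?W = "\<lambda>y. complex_of_real (heat r (y - x))"
  have "(\<lambda>k. LBINT y. D k y * ?W y) \<longlonglongrightarrow> 0"
    unfolding ft_smoothing[OF r D(1), symmetric]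
    by (rule tendsto_integral_mult_N2[OF _ _ ftD gauss_modulated_N2[OF r]]) auto
  moreover have "(\<lambda>k. LBINT y. (D k y - d y) * ?W y) \<longlonglongrightarrow> 0"
    by (rule tendsto_integral_mult_N2[OF _ _ D(2) heat_N2_finite[OF r]]) auto
  moreover have "(LBINT y. (D k y - d y) * ?W y) = (LBINT y. D k y * ?W y) - (LBINT y. d y * ?W y)" for k
  proof -
    have 1: "integrable lborel (\<lambda>y. d y * ?W y)"
      by (intro integrable_mult_N2 d heat_N2_finite r) auto
    have 2: "integrable lborel (\<lambda>y. D k y * ?W y)"
      by (rule integrable_mult_heat[OF r D(1)])
    show ?thesis
      using Bochner_Integration.integral_diff[OF 2 1] by (simp add: left_diff_distrib)
  qed
  ultimately have "(\<lambda>k. LBINT y. D k y * ?W y) \<longlonglongrightarrow> 0" "(\<lambda>k. (LBINT y. D k y * ?W y) - (LBINT y. d y * ?W y)) \<longlonglongrightarrow> 0"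
    by simp_all
  from tendsto_diff[OF this] have "(\<lambda>k::nat. LBINT y. d y * ?W y) \<longlonglongrightarrow> 0" by simp
  then show ?thesis by (simp add: LIMSEQ_const_iff)
qed

lemma integrable_N2_gauss:
  assumes [measurable]: "d \<in> borel_measurable borel" and d: "N2 d < \<infinity>" and "r > 0"
  shows "integrable lborel (\<lambda>y. norm (d y) * gauss (r *\<^sub>R y))"
proof -
  have "integrable lborel (\<lambda>y. d y * (cis (y \<bullet> 0) * of_real (gauss (r *\<^sub>R y))))"
    by (intro integrable_mult_N2 d gauss_modulated_N2 assms) auto
  then have "integrable lborel (\<lambda>y. norm (d y * (cis (y \<bullet> 0) * of_real (gauss (r *\<^sub>R y)))))"
    by (rule integrable_norm)
  then show ?thesis by (simp add: norm_mult abs_of_pos[OF gauss_bounds(1)])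
qed

text \<open>If y + e z stays in a ball, then a large y forces a large z. Half of the Gaussian decay
  in z is therefore traded for decay in y, uniformly in e, which yields a dominating function in
  \<open>box_integral_eq_0\<close>.\<close>

lemma gauss_box_bound:
  assumes "norm (y + e *\<^sub>R z) \<le> R" "0 < e" "e \<le> 1"
  shows "gauss z \<le> exp (R\<^sup>2 / 4) * gauss ((1/2) *\<^sub>R y) * gauss ((1 / sqrt 2) *\<^sub>R z)"
proof -
  have "norm y = norm ((y + e *\<^sub>R z) + (- (e *\<^sub>R z)))" by simp
  also have "(\<dots>)\<^sup>2 \<le> 2 * (norm (y + e *\<^sub>R z))\<^sup>2 + 2 * (norm (- (e *\<^sub>R z)))\<^sup>2"
    by (rule norm_add_sq_le)
  also have "(norm (y + e *\<^sub>R z))\<^sup>2 \<le> R\<^sup>2"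
    by (intro power_mono assms) simp
  also have "(norm (- (e *\<^sub>R z)))\<^sup>2 \<le> (norm z)\<^sup>2"
    using assms by (intro power_mono) (auto simp: mult_left_le_one_le)
  finally have "(norm y)\<^sup>2 \<le> 2 * R\<^sup>2 + 2 * (norm z)\<^sup>2" by simp
  then show ?thesis
    by (simp add: gauss_def exp_add[symmetric] power_mult_distrib power_divide real_sqrt_pow2)
qed

text \<open>The averaging is moved by Fubini from d to the indicator of the box. The averaged
  indicators pair to 0 with d and converge to a multiple of the indicator away from the frontier of
  the box.\<close>

lemma box_integral_eq_0:
  assumes [measurable]: "d \<in> borel_measurable borel" and d: "N2 d < \<infinity>"
    and heat0: "\<And>r x. r > 0 \<Longrightarrow> (LBINT y. d y * of_real (heat r (y - x))) = 0"
  shows "(LBINT y. d y * indicator (cbox a b) y) = 0"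
proof -
  let ?B = "indicator (cbox a b) :: 'a \<Rightarrow> complex"
  let ?c = "complex_of_real (sqrt (2 * pi) ^ DIM('a))"
  define e where "e k = 1 / real (Suc k)" for k
  have e: "e k > 0" "e k \<le> 1" for k by (auto simp: e_def)
  have e0: "e \<longlonglongrightarrow> 0" unfolding e_def by (rule lim_1_over_n[THEN LIMSEQ_Suc])
  obtain R where R: "\<And>x. x \<in> cbox a b \<Longrightarrow> norm x \<le> R"
    using bounded_cbox[of a b] unfolding bounded_iff by blast
  define G where "G = (LBINT z::'a. gauss ((1 / sqrt 2) *\<^sub>R z))"
  define \<Phi> where "\<Phi> k y = (LBINT z. ?B (y + e k *\<^sub>R z) * of_real (gauss z))" for k and y :: 'a
  have [measurable]: "\<Phi> k \<in> borel_measurable borel" for k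
    unfolding \<Phi>_def[abs_def] by measurable
  have zero: "(LBINT y. d y * \<Phi> k y) = 0" for k
  proof -
    let ?h = "\<lambda>x y. heat (e k) (y - x)"
    \<comment> \<open>The inner integral is bounded by \<open>N2 d\<close> plus the squared norm of
      the heat kernel, independently of x, and the indicator restricts x to a set of finite
      measure.\<close>
    have i: "integrable (lborel \<Otimes>\<^sub>M lborel) (\<lambda>(x, y). ?B x * (d y * of_real (?h x y)))"
    proof (rule integrableI_bounded)
      let ?b = "N2 d + ennreal ((sqrt (2 * pi) / e k) ^ DIM('a)) * ennreal ((2 * pi) ^ DIM('a))"
      have "(\<integral>\<^sup>+p. ennreal (norm (case p of (x, y) \<Rightarrow> ?B x * (d y * of_real (?h x y)))) \<partial>(lborel \<Otimes>\<^sub>M lborel))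
        = (\<integral>\<^sup>+x. \<integral>\<^sup>+y. ennreal (norm (?B x * (d y * of_real (?h x y)))) \<partial>lborel \<partial>lborel)"
        by (subst lborel.nn_integral_fst[symmetric]) auto
      also have "\<dots> = (\<integral>\<^sup>+x. indicator (cbox a b) x * (\<integral>\<^sup>+y. ennreal (norm (d y * of_real (?h x y))) \<partial>lborel) \<partial>lborel)"
        by (intro nn_integral_cong) (auto split: split_indicator)
      also have "\<dots> \<le> (\<integral>\<^sup>+x. indicator (cbox a b) x * ?b \<partial>lborel)"
        by (intro nn_integral_mono mult_left_mono order.trans[OF nn_integral_mult_le_N2] add_left_mono heat_N2 e) auto
      also have "\<dots> < \<infinity>"
        using d by (simp add: nn_integral_multc emeasure_lborel_cbox_finite[unfolded infinity_ennreal_def] ennreal_mult_less_top)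
      finally show "(\<integral>\<^sup>+p. ennreal (norm (case p of (x, y) \<Rightarrow> ?B x * (d y * of_real (?h x y)))) \<partial>(lborel \<Otimes>\<^sub>M lborel)) < \<infinity>" .
    qed simp
    have "?c * (LBINT y. d y * \<Phi> k y) = (LBINT y. ?c * (d y * \<Phi> k y))"
      by (rule integral_mult_right_zero[symmetric])
    also have "\<dots> = (LBINT y. d y * (LBINT x. ?B x * of_real (heat (e k) (x - y))))"
      by (simp add: heat_substitute[OF e(1), of ?B] \<Phi>_def mult.left_commute)
    also have "\<dots> = (LBINT y. LBINT x. ?B x * (d y * of_real (?h x y)))"
      by (subst heat_minus_commute, subst integral_mult_right_zero[symmetric]) (simp add: mult_ac)
    also have "\<dots> = (LBINT x. LBINT y. ?B x * (d y * of_real (?h x y)))"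
      by (rule lborel_pair.Fubini_integral[OF i])
    also have "\<dots> = 0" by (simp add: heat0[OF e(1)])
    finally show ?thesis by simp
  qed
  \<comment> \<open>Off the frontier the indicator is continuous, and the frontier of a convex set
    is a null set.\<close>
  have front: "AE y in lborel. y \<notin> frontier (cbox a b)"
  proof -
    have "frontier (cbox a b) \<in> null_sets lebesgue"
      using negligible_convex_frontier[OF convex_box(1)] by (simp add: negligible_iff_null_sets)
    from AE_not_in[OF this] show ?thesis by (simp add: AE_completion_iff)
  qed
  let ?w = "exp (R\<^sup>2 / 4)" and ?g = "\<lambda>y::'a. gauss ((1/2) *\<^sub>R y)" and ?h = "\<lambda>z::'a. gauss ((1 / sqrt 2) *\<^sub>R z)"
  have "(\<lambda>k. LBINT y. d y * \<Phi> k y) \<longlonglongrightarrow> (LBINT y. d y * (?c * ?B y))"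
  proof (rule integral_dominated_convergence[where w="\<lambda>y. (?w * G) * (norm (d y) * ?g y)"])
    show "integrable lborel (\<lambda>y. (?w * G) * (norm (d y) * ?g y))"
      by (intro integrable_mult_right integrable_N2_gauss d) auto
    show "AE y in lborel. (\<lambda>k. d y * \<Phi> k y) \<longlonglongrightarrow> d y * (?c * ?B y)"
      using front
    proof eventually_elim
      fix y :: 'a assume y: "y \<notin> frontier (cbox a b)"
      have "(\<lambda>k. \<Phi> k y) \<longlonglongrightarrow> (LBINT z::'a. ?B y * of_real (gauss z))"
        unfolding \<Phi>_def
      proof (rule integral_dominated_convergence[where w="gauss"])
        show "AE z in lborel. (\<lambda>k. ?B (y + e k *\<^sub>R z) * of_real (gauss z)) \<longlonglongrightarrow> ?B y * of_real (gauss z)"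
        proof (intro AE_I2 tendsto_mult tendsto_const)
          fix z :: 'a
          have l: "(\<lambda>k. y + e k *\<^sub>R z) \<longlonglongrightarrow> y"
            using tendsto_add[OF tendsto_const tendsto_scaleR[OF e0 tendsto_const], of y z] by simp
          have "isCont (indicator (cbox a b) :: 'a \<Rightarrow> real) y" using y by (simp add: isCont_indicator)
          then have "isCont (\<lambda>y. complex_of_real (indicator (cbox a b) y)) y"
            by (intro continuous_of_real)
          then have "isCont ?B y" by (simp add: of_real_indicator)
          from isCont_tendsto_compose[OF this l]
          show "(\<lambda>k. ?B (y + e k *\<^sub>R z)) \<longlonglongrightarrow> ?B y" .
        qed
        show "\<And>k. AE z in lborel. norm (?B (y + e k *\<^sub>R z) * of_real (gauss z)) \<le> gauss z"
          by (intro AE_I2) (auto simp: norm_mult gauss_bounds less_imp_le split: split_indicator)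
      qed (auto simp: gauss_integrable)
      also have "(LBINT z::'a. ?B y * of_real (gauss z)) = ?c * ?B y"
        using gauss_integral[where 'a='a] by simp
      finally show "(\<lambda>k. d y * \<Phi> k y) \<longlonglongrightarrow> d y * (?c * ?B y)"
        by (intro tendsto_mult tendsto_const)
    qed
    fix k
    show "AE y in lborel. norm (d y * \<Phi> k y) \<le> (?w * G) * (norm (d y) * ?g y)"
    proof (rule AE_I2)
      fix y
      have "norm (\<Phi> k y) \<le> (LBINT z::'a. ?w * ?g y * ?h z)"
        unfolding \<Phi>_def
      proof (rule order.trans[OF integral_norm_bound], rule integral_mono)
        show "integrable lborel (\<lambda>z::'a. ?w * ?g y * ?h z)"
          using gauss_scaled_integrable[of "1 / sqrt 2" "0::'a"] by (intro integrable_mult_right) auto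
        show "integrable lborel (\<lambda>z. norm (?B (y + e k *\<^sub>R z) * of_real (gauss z)))"
          by (rule integrable_norm, rule Bochner_Integration.integrable_bound[OF gauss_integrable])
             (auto simp: norm_mult split: split_indicator)
        show "norm (?B (y + e k *\<^sub>R z) * of_real (gauss z)) \<le> ?w * ?g y * ?h z" for z
        proof (cases "y + e k *\<^sub>R z \<in> cbox a b")
          case True
          then show ?thesis using gauss_box_bound[OF R[OF True] e] by (simp add: abs_of_pos[OF gauss_bounds(1)])
        qed (simp add: less_imp_le[OF gauss_bounds(1)])
      qed
      also have "\<dots> = ?w * G * ?g y" by (simp add: G_def)
      finally have "norm (d y) * norm (\<Phi> k y) \<le> norm (d y) * (?w * G * ?g y)"
        by (intro mult_left_mono) auto
      then show "norm (d y * \<Phi> k y) \<le> (?w * G) * (norm (d y) * ?g y)"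
        by (simp add: norm_mult mult_ac)
    qed
  qed measurable
  then have "(LBINT y. d y * (?c * ?B y)) = 0"
    unfolding zero by (simp add: LIMSEQ_const_iff)
  also have "(LBINT y. d y * (?c * ?B y)) = ?c * (LBINT y. d y * ?B y)"
    by (subst integral_mult_right_zero[symmetric]) (simp add: mult_ac)
  finally show ?thesis by simp
qed

lemma N2_indicator_finite:
  assumes "bounded S" "S \<in> sets borel"
  shows "N2 (indicator S) < \<infinity>"
proof -
  have "N2 (indicator S) = (\<integral>\<^sup>+x. indicator S x \<partial>lborel)"
    unfolding N2_def by (intro nn_integral_cong) (auto split: split_indicator)
  also have "\<dots> < \<infinity>"
    using emeasure_bounded_finite[OF assms(1)] assms(2) by simp
  finally show ?thesis .
qed

lemma AE_eq_0_if_box_integrals_eq_0: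
  assumes [measurable]: "d \<in> borel_measurable borel" and d: "N2 d < \<infinity>"
    and zero: "\<And>a b. (LBINT y. d y * indicator (cbox a b) y) = 0"
  shows "AE x in lborel. d x = 0"
proof -
  have I: "set_integrable lborel (cbox a b) d" for a b
  proof -
    have "integrable lborel (\<lambda>x. d x * indicator (cbox a b) x)"
      by (intro integrable_mult_N2 d N2_indicator_finite) auto
    then show ?thesis
      unfolding set_integrable_def by (rule back_subst[of "integrable lborel"]) (auto split: split_indicator)
  qed
  have int0: "integral (cbox a b) d = 0" for a b
  proof -
    have "integral (cbox a b) d = (LINT y:cbox a b|lborel. d y)"
      using set_borel_integral_eq_integral(2)[OF I] by simp
    also have "\<dots> = (LBINT y. d y * indicator (cbox a b) y)"
      unfolding set_lebesgue_integral_def by (intro Bochner_Integration.integral_cong) (auto split: split_indicator)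
    finally show ?thesis using zero by simp
  qed
  \<comment> \<open>Lebesgue differentiation over cubes\<close>
  obtain N where N: "negligible N"
    and lim: "\<And>x e. \<lbrakk>x \<notin> N; 0 < e\<rbrakk> \<Longrightarrow> \<exists>\<delta>>0. \<forall>h. 0 < h \<and> h < \<delta> \<longrightarrow>
        norm (integral (cbox x (x + h *\<^sub>R One)) d /\<^sub>R h ^ DIM('a) - d x) < e"
    using integrable_ccontinuous_explicit[of d] set_borel_integral_eq_integral(1)[OF I] by blast
  have "d x = 0" if x: "x \<notin> N" for x
  proof (rule ccontr)
    assume "d x \<noteq> 0"
    then obtain \<delta> where "\<delta> > 0" and \<delta>: "\<forall>h. 0 < h \<and> h < \<delta> \<longrightarrow>
        norm (integral (cbox x (x + h *\<^sub>R One)) d /\<^sub>R h ^ DIM('a) - d x) < norm (d x)"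
      using lim[OF x, of "norm (d x)"] by auto
    then show False using \<delta>[rule_format, of "\<delta> / 2"] by (simp add: int0)
  qed
  then have "AE x in lebesgue. d x = 0"
    using N by (intro AE_I'[of N]) (auto simp: negligible_iff_null_sets)
  then show ?thesis by (simp add: AE_completion_iff)
qed

text \<open>\<open>D\<close> represents an L2 function d and the third premise says that the
  transform of d vanishes. Its Gaussian averages vanish, hence its integrals over boxes, hence d
  itself.\<close>

lemma ft_L2_injective:
  assumes "\<And>k. integrable lborel (D k)" "L2_lim D d"
    and "(\<lambda>k. N2 (ft (D k))) \<longlonglongrightarrow> 0"
    and "d \<in> borel_measurable borel" and "N2 d < \<infinity>"
  shows "AE x in lborel. d x = 0"
  by (intro AE_eq_0_if_box_integrals_eq_0 box_integral_eq_0 heat_average_eq_0[OF assms] assms)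

section \<open>Convolution\<close>

text \<open>Riesz-Fischer for a rapidly converging sequence. The rate 8^(-i) leaves room for a
  weight 4^k: the weighted squares are still summable in the mean, so almost everywhere consecutive
  differences are O(2^(-k)).\<close>

lemma L2_complete:
  fixes G :: "nat \<Rightarrow> 'a::euclidean_space \<Rightarrow> complex"
  assumes [measurable]: "\<And>k. G k \<in> borel_measurable borel"
    and fast: "\<And>i j. i \<le> j \<Longrightarrow> N2 (\<lambda>x. G i x - G j x) \<le> ennreal (c / 8 ^ i)"
    and "c \<ge> 0"
  obtains g where "g \<in> borel_measurable borel" "\<And>i. N2 (\<lambda>x. G i x - g x) \<le> ennreal (c / 8 ^ i)"
proof -
  \<comment> \<open>Where the sequence diverges this value is arbitrary; the set of such points is
    null.\<close>
  define g where "g x = lim (\<lambda>k. G k x)" for x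
  have [measurable]: "g \<in> borel_measurable borel"
    unfolding g_def[abs_def] by measurable
  have "(\<integral>\<^sup>+x. (\<Sum>k. ennreal (4 ^ k * (norm (G k x - G (Suc k) x))\<^sup>2)) \<partial>lborel)
      = (\<Sum>k. \<integral>\<^sup>+x. ennreal (4 ^ k * (norm (G k x - G (Suc k) x))\<^sup>2) \<partial>lborel)"
    by (rule nn_integral_suminf) simp
  also have "\<dots> \<le> (\<Sum>k. ennreal (c * (1/2) ^ k))"
  proof (rule suminf_le)
    fix k
    have "(\<integral>\<^sup>+x. ennreal (4 ^ k * (norm (G k x - G (Suc k) x))\<^sup>2) \<partial>lborel) = ennreal (4 ^ k) * N2 (\<lambda>x. G k x - G (Suc k) x)"
      unfolding N2_def by (simp add: ennreal_mult nn_integral_cmult)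
    also have "\<dots> \<le> ennreal (4 ^ k) * ennreal (c / 8 ^ k)"
      using fast[of k "Suc k"] by (intro mult_left_mono) auto
    also have "\<dots> = ennreal (4 ^ k * (c / 8 ^ k))" using \<open>c \<ge> 0\<close> by (intro ennreal_mult[symmetric]) auto
    also have "4 ^ k * (c / 8 ^ k) = c * (1/2) ^ k"
    proof -
      have "(4::real) ^ k / 8 ^ k = (1/2) ^ k" by (simp flip: power_divide)
      then show ?thesis by (metis mult.commute times_divide_eq_left times_divide_eq_right)
    qed
    finally show "(\<integral>\<^sup>+x. ennreal (4 ^ k * (norm (G k x - G (Suc k) x))\<^sup>2) \<partial>lborel) \<le> ennreal (c * (1/2) ^ k)" .
  qed auto
  also have "\<dots> < \<infinity>"
    by (subst suminf_ennreal2) (use \<open>c \<ge> 0\<close> in \<open>auto intro!: summable_mult summable_geometric\<close>)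
  finally have fin: "(\<integral>\<^sup>+x. (\<Sum>k. ennreal (4 ^ k * (norm (G k x - G (Suc k) x))\<^sup>2)) \<partial>lborel) \<noteq> \<infinity>"
    by simp
  have "AE x in lborel. (\<Sum>k. ennreal (4 ^ k * (norm (G k x - G (Suc k) x))\<^sup>2)) \<noteq> \<infinity>"
    by (rule nn_integral_PInf_AE[OF _ fin]) simp
  then have lim: "AE x in lborel. (\<lambda>k. G k x) \<longlonglongrightarrow> g x"
  proof eventually_elim
    fix x
    assume top: "(\<Sum>k. ennreal (4 ^ k * (norm (G k x - G (Suc k) x))\<^sup>2)) \<noteq> \<infinity>"
    then have "summable (\<lambda>k. 4 ^ k * (norm (G k x - G (Suc k) x))\<^sup>2)"
      by (intro summable_suminf_not_top) auto
    then have "Bseq (\<lambda>k. 4 ^ k * (norm (G k x - G (Suc k) x))\<^sup>2)"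
      by (intro convergent_imp_Bseq) (auto simp: convergent_def dest: summable_LIMSEQ_zero)
    then obtain S where S: "S > 0" "\<And>k. 4 ^ k * (norm (G k x - G (Suc k) x))\<^sup>2 \<le> S"
      by (auto simp: Bseq_def)
    have le: "norm (G k x - G (Suc k) x) \<le> sqrt S * (1/2) ^ k" for k
    proof (rule power2_le_imp_le)
      have "((2::real) ^ k)\<^sup>2 = 4 ^ k"
        by (simp add: power2_eq_square flip: power_mult_distrib)
      then have "(4::real) ^ k * (sqrt S * (1/2) ^ k)\<^sup>2 = S"
        using S(1) by (simp add: power_mult_distrib power_divide)
      then have "4 ^ k * (norm (G k x - G (Suc k) x))\<^sup>2 \<le> 4 ^ k * (sqrt S * (1/2) ^ k)\<^sup>2"
        using S(2)[of k] by simp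
      then show "(norm (G k x - G (Suc k) x))\<^sup>2 \<le> (sqrt S * (1/2) ^ k)\<^sup>2"
        by simp
    qed (use S in auto)
    have "summable (\<lambda>k. sqrt S * (1/2) ^ k)"
      by (intro summable_mult summable_geometric) simp
    then have "summable (\<lambda>k. G k x - G (Suc k) x)"
      by (rule summable_comparison_test'[where N=0]) (rule le)
    then have "(\<lambda>n. \<Sum>k<n. G k x - G (Suc k) x) \<longlonglongrightarrow> (\<Sum>k. G k x - G (Suc k) x)"
      by (rule summable_LIMSEQ)
    then have "(\<lambda>n. G 0 x - G n x) \<longlonglongrightarrow> (\<Sum>k. G k x - G (Suc k) x)"
      unfolding sum_lessThan_telescope'[of "\<lambda>k. G k x"] .
    from tendsto_diff[OF tendsto_const[of "G 0 x"] this]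
    have "(\<lambda>n. G n x) \<longlonglongrightarrow> G 0 x - (\<Sum>k. G k x - G (Suc k) x)" by simp
    then have "convergent (\<lambda>n. G n x)" by (auto simp: convergent_def)
    then show "(\<lambda>k. G k x) \<longlonglongrightarrow> g x"
      unfolding g_def by (simp add: convergent_LIMSEQ_iff)
  qed
  have "N2 (\<lambda>x. G i x - g x) \<le> ennreal (c / 8 ^ i)" for i
    unfolding N2_def
  proof (rule nn_integral_le_limit)
    show "AE x in lborel. (\<lambda>k. ennreal ((norm (G i x - G (i + k) x))\<^sup>2)) \<longlonglongrightarrow> ennreal ((norm (G i x - g x))\<^sup>2)"
      using lim
    proof eventually_elim
      fix x assume "(\<lambda>k. G k x) \<longlonglongrightarrow> g x"
      then have "(\<lambda>k. G (i + k) x) \<longlonglongrightarrow> g x"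
        using LIMSEQ_ignore_initial_segment[of "\<lambda>k. G k x" "g x" i] by (simp add: add.commute)
      then show "(\<lambda>k. ennreal ((norm (G i x - G (i + k) x))\<^sup>2)) \<longlonglongrightarrow> ennreal ((norm (G i x - g x))\<^sup>2)"
        by (intro tendsto_ennrealI tendsto_intros)
    qed
    show "(\<integral>\<^sup>+x. ennreal ((norm (G i x - G (i + k) x))\<^sup>2) \<partial>lborel) \<le> ennreal (c / 8 ^ i)" for k
      using fast[of i "i + k"] by (simp add: N2_def)
  qed simp
  then show ?thesis using that[of g] by simp
qed

lemma L2_truncation:
  assumes [measurable]: "f \<in> borel_measurable borel" and f: "N2 f < \<infinity>"
  defines "F \<equiv> \<lambda>k x. f x * indicator (cball 0 (real k)) x"
  shows "integrable lborel (F k)" and "N2 (F k) < \<infinity>" and "L2_lim F f"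
proof -
  have [measurable]: "cball 0 (real k) \<in> sets (borel :: 'a measure)" for k by simp
  have [measurable]: "F k \<in> borel_measurable borel" for k unfolding F_def by measurable
  show "integrable lborel (F k)"
    unfolding F_def by (intro integrable_mult_N2 f N2_indicator_finite) auto
  have "N2 (F k) \<le> N2 f"
    unfolding N2_def F_def by (intro nn_integral_mono) (auto split: split_indicator)
  then show "N2 (F k) < \<infinity>" using f by simp
  have "(\<lambda>k. \<integral>\<^sup>+x. ennreal ((norm (F k x - f x))\<^sup>2) \<partial>lborel) \<longlonglongrightarrow> (\<integral>\<^sup>+x. 0 \<partial>(lborel :: 'a measure))"
  proof (rule nn_integral_dominated_convergence[where w="\<lambda>x. ennreal ((norm (f x))\<^sup>2)"])
    show "AE x in lborel. (\<lambda>k. ennreal ((norm (F k x - f x))\<^sup>2)) \<longlonglongrightarrow> 0"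
    proof (rule AE_I2)
      fix x :: 'a
      obtain m where "norm x \<le> real m" using real_arch_simple by blast
      then have "ennreal ((norm (F k x - f x))\<^sup>2) = 0" if "k \<ge> m" for k
        using that unfolding F_def by (auto simp: indicator_def)
      then show "(\<lambda>k. ennreal ((norm (F k x - f x))\<^sup>2)) \<longlonglongrightarrow> 0"
        by (intro tendsto_eventually) (auto simp: eventually_sequentially)
    qed
  qed (use f in \<open>auto simp: F_def N2_def split: split_indicator\<close>)
  then show "L2_lim F f" by (simp add: N2_def)
qed

text \<open>Truncations to balls are integrable and approximate f. Passing to approximants within
  8^(-k) makes their transforms, by \<open>ft_contraction\<close>, converge fast enough for
  \<open>L2_complete\<close>.\<close>

lemma L2_fourier_exists:
  assumes [measurable]: "f \<in> borel_measurable borel" and f: "N2 f < \<infinity>"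
  obtains F g where "\<And>k::nat. integrable lborel (F k)" "\<And>k. N2 (F k) < \<infinity>"
    "L2_lim F f"
    "g \<in> borel_measurable borel" "(\<lambda>k. N2 (\<lambda>x. ft (F k) x - g x)) \<longlonglongrightarrow> 0"
proof -
  obtain F0 where F0: "\<And>k::nat. integrable lborel (F0 k)" "\<And>k. N2 (F0 k) < \<infinity>" "L2_lim F0 f"
    by (rule that[OF L2_truncation[OF assms]])
  have "\<exists>m. N2 (\<lambda>x. F0 m x - f x) < ennreal (1 / 8 ^ k)" for k
    using order_tendstoD(2)[OF F0(3), of "ennreal (1 / 8 ^ k)"]
    by (auto simp: eventually_sequentially)
  then obtain r where r: "\<And>k. N2 (\<lambda>x. F0 (r k) x - f x) < ennreal (1 / 8 ^ k)" by metis
  define F where "F k = F0 (r k)" for k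
  have F: "integrable lborel (F k)" "N2 (F k) < \<infinity>" for k unfolding F_def by (rule F0)+
  have [measurable]: "F k \<in> borel_measurable borel" for k using F(1)[of k] by auto
  note [measurable] = ft_measurable[OF F(1)]
  let ?P = "(2 * pi) ^ DIM('a)"
  \<comment> \<open>The factor 4 is 2 + 2: one 2 for each of the two distances to f in the weak
    triangle inequality.\<close>
  have diff: "N2 (\<lambda>x. ft (F i) x - ft (F j) x) \<le> ennreal ((4 * ?P) / 8 ^ i)" if "i \<le> j" for i j
  proof -
    have "ft (F i) x - ft (F j) x = ft (\<lambda>x. F i x - F j x) x" for x
      unfolding ft_def right_diff_distrib by (rule Bochner_Integration.integral_diff[symmetric]) (use F in auto)
    then have "N2 (\<lambda>x. ft (F i) x - ft (F j) x) \<le> ennreal ?P * N2 (\<lambda>x. F i x - F j x)"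
      using ft_contraction[of "\<lambda>x. F i x - F j x"] F by simp
    also have "\<dots> \<le> ennreal ?P * (2 * N2 (\<lambda>x. F i x - f x) + 2 * N2 (\<lambda>x. f x - F j x))"
      by (intro mult_left_mono N2_triangle) auto
    also have "\<dots> \<le> ennreal ?P * (2 * ennreal (1 / 8 ^ i) + 2 * ennreal (1 / 8 ^ i))"
    proof (intro mult_left_mono add_mono)
      show "N2 (\<lambda>x. F i x - f x) \<le> ennreal (1 / 8 ^ i)"
        unfolding F_def by (rule less_imp_le[OF r])
      have "N2 (\<lambda>x. f x - F j x) \<le> ennreal (1 / 8 ^ j)"
        unfolding F_def N2_minus_commute[of f] by (rule less_imp_le[OF r])
      also have "\<dots> \<le> ennreal (1 / 8 ^ i)"
        using that by (intro ennreal_leI divide_left_mono power_increasing) auto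
      finally show "N2 (\<lambda>x. f x - F j x) \<le> ennreal (1 / 8 ^ i)" .
    qed auto
    also have "2 * ennreal (1 / 8 ^ i) + 2 * ennreal (1 / 8 ^ i) = ennreal (4 * (1 / 8 ^ i))"
      by (subst ennreal_mult) (simp_all flip: distrib_right)
    also have "ennreal ?P * \<dots> = ennreal (?P * (4 * (1 / 8 ^ i)))"
      by (rule ennreal_mult[symmetric]) auto
    finally show ?thesis by (simp add: mult.commute)
  qed
  obtain g where g: "g \<in> borel_measurable borel" "\<And>i. N2 (\<lambda>x. ft (F i) x - g x) \<le> ennreal ((4 * ?P) / 8 ^ i)"
    using L2_complete[OF _ diff] by auto
  have geo: "(\<lambda>i. ennreal (c / 8 ^ i)) \<longlonglongrightarrow> 0" for c
  proof -
    have "(\<lambda>i. c * (1/8) ^ i) \<longlonglongrightarrow> c * 0"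
      by (intro tendsto_mult tendsto_const LIMSEQ_power_zero) simp
    then have "(\<lambda>i. ennreal (c / 8 ^ i)) \<longlonglongrightarrow> ennreal 0"
      by (intro tendsto_ennrealI) (simp add: power_divide)
    then show ?thesis by simp
  qed
  have "L2_lim F f"
    by (rule tendsto_sandwich[OF _ _ tendsto_const geo[of 1]])
       (auto simp: F_def intro!: always_eventually less_imp_le[OF r])
  moreover have "(\<lambda>k. N2 (\<lambda>x. ft (F k) x - g x)) \<longlonglongrightarrow> 0"
    by (rule tendsto_sandwich[OF _ _ tendsto_const geo])
       (auto intro!: always_eventually g(2))
  ultimately show ?thesis using that[of F g] F g(1) by blast
qed

section \<open>Convolution of integrable functions\<close>

definition conv :: "('a::euclidean_space \<Rightarrow> complex) \<Rightarrow> ('a \<Rightarrow> complex) \<Rightarrow> 'a \<Rightarrow> complex" where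
  "conv K f x = (LBINT y. K (x - y) * f y)"

lemma integrable_reflect:
  fixes K :: "'a::euclidean_space \<Rightarrow> 'b::{banach, second_countable_topology}"
  shows "integrable lborel K \<Longrightarrow> integrable lborel (\<lambda>y. K (x - y))"
  using lborel_integrable_affine[of K "-1" x] by simp

lemma integrable_conv_pair:
  fixes K f :: "'a::euclidean_space \<Rightarrow> complex"
  assumes K: "integrable lborel K" and f: "integrable lborel f"
  shows "integrable (lborel \<Otimes>\<^sub>M lborel) (\<lambda>(y, x). K (x - y) * f y)"
proof -
  have [measurable]: "f \<in> borel_measurable borel" "K \<in> borel_measurable borel" using f K by auto
  have s: "integrable lborel (\<lambda>x. K (x - y))" for y
    using lborel_integrable_affine[OF K, of 1 "- y"] by simp
  have "(LBINT x. norm (K (x - y))) = (LBINT x. norm (K x))" for y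
    using lborel_integral_translate[of "\<lambda>x. norm (K x)" "- y"] by simp
  then show ?thesis
    using f s by (intro lborel_pair.Fubini_integrable) (auto simp: norm_mult)
qed

lemma conv_integrable:
  assumes "integrable lborel K" "integrable lborel f"
  shows "integrable lborel (conv K f)"
  unfolding conv_def[abs_def]
  using lborel_pair.integrable_snd[OF integrable_conv_pair[OF assms]] by simp

lemma ft_conv:
  assumes K: "integrable lborel K" and f: "integrable lborel f"
  shows "ft (conv K f) \<xi> = ft K \<xi> * ft f \<xi>"
proof -
  have [measurable]: "f \<in> borel_measurable borel" "K \<in> borel_measurable borel" using f K by auto
  have i: "integrable (lborel \<Otimes>\<^sub>M lborel) (\<lambda>(y, x). cis (- (x \<bullet> \<xi>)) * (K (x - y) * f y))"
    by (rule Bochner_Integration.integrable_bound[OF integrable_conv_pair[OF assms]])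
       (auto simp: norm_mult split_beta')
  have "ft (conv K f) \<xi> = (LBINT x. LBINT y. cis (- (x \<bullet> \<xi>)) * (K (x - y) * f y))"
    by (simp add: ft_def conv_def)
  also have "\<dots> = (LBINT y. LBINT x. cis (- (x \<bullet> \<xi>)) * (K (x - y) * f y))"
    by (rule lborel_pair.Fubini_integral[OF i])
  also have "\<dots> = (LBINT y. ft K \<xi> * (cis (- (y \<bullet> \<xi>)) * f y))"
  proof (rule Bochner_Integration.integral_cong[OF refl])
    fix y :: 'a
    have phase: "cis (- ((y + x) \<bullet> \<xi>)) = cis (- (x \<bullet> \<xi>)) * cis (- (y \<bullet> \<xi>))" for x
      by (simp add: cis_mult inner_add_left minus_diff_commute)
    have "(LBINT x. cis (- (x \<bullet> \<xi>)) * (K (x - y) * f y)) =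
        (LBINT x. cis (- ((y + x) \<bullet> \<xi>)) * (K (y + x - y) * f y))"
      by (rule lborel_integral_translate[symmetric]) simp
    also have "\<dots> = (LBINT x. (cis (- (x \<bullet> \<xi>)) * K x) * (cis (- (y \<bullet> \<xi>)) * f y))"
      unfolding phase by (simp add: mult_ac)
    also have "\<dots> = ft K \<xi> * (cis (- (y \<bullet> \<xi>)) * f y)"
      unfolding ft_def by (rule integral_mult_left_zero)
    finally show "(LBINT x. cis (- (x \<bullet> \<xi>)) * (K (x - y) * f y)) = ft K \<xi> * (cis (- (y \<bullet> \<xi>)) * f y)" .
  qed
  also have "\<dots> = ft K \<xi> * ft f \<xi>"
    unfolding ft_def by (rule integral_mult_right_zero)
  finally show ?thesis .
qed

lemma conv_measurable:
  assumes [measurable]: "K \<in> borel_measurable borel" "f \<in> borel_measurable borel"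
  shows "conv K f \<in> borel_measurable borel"
  unfolding conv_def[abs_def] by measurable

section \<open>Young's inequality for a bounded integrable kernel\<close>

lemma le_add_powr:
  fixes t p c :: real
  assumes "1 \<le> p" "0 \<le> t" "0 < c"
  shows "t \<le> c + c powr (1 - p) * t powr p"
proof (cases "t \<le> c")
  case False
  have "t = t powr (1 - p) * t powr p" using False assms by (simp flip: powr_add)
  also have "\<dots> \<le> c powr (1 - p) * t powr p" using False assms by (intro mult_right_mono powr_mono2') auto
  finally show ?thesis using assms by linarith
qed (simp add: add_increasing2)

abbreviation Lp_int :: "real \<Rightarrow> ('a::euclidean_space \<Rightarrow> complex) \<Rightarrow> bool" where
  "Lp_int p f \<equiv> integrable lborel (\<lambda>x. norm (f x) powr p)"

abbreviation Lp_pow :: "real \<Rightarrow> ('a::euclidean_space \<Rightarrow> complex) \<Rightarrow> real" where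
  "Lp_pow p f \<equiv> LBINT x. norm (f x) powr p"

abbreviation Lp_bound :: "real \<Rightarrow> (('a::euclidean_space \<Rightarrow> complex) \<Rightarrow> 'a \<Rightarrow> complex) \<Rightarrow> real \<Rightarrow> bool" where
  "Lp_bound p T C \<equiv> \<forall>f. f \<in> borel_measurable borel \<longrightarrow> Lp_int p f \<longrightarrow>
     Lp_int p (T f) \<and> Lp_pow p (T f) \<le> C * Lp_pow p f"

text \<open>Boundedness of K in addition to integrability makes the convolution integral with any Lp
  function converge at every point, so that linearity and pointwise estimates hold without
  exceptional sets.\<close>

locale conv_kernel =
  fixes K :: "'a::euclidean_space \<Rightarrow> complex" and B :: real
  assumes K: "integrable lborel K" and B: "\<And>x. norm (K x) \<le> B"
begin

lemma K_measurable [measurable]: "K \<in> borel_measurable borel"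
  using K by auto

lemma integrable_conv_kernel:
  assumes p: "1 \<le> p" and [measurable]: "f \<in> borel_measurable borel" and f: "Lp_int p f"
  shows "integrable lborel (\<lambda>y. norm (K (x - y)) * norm (f y) powr p)"
    and "integrable lborel (\<lambda>y. K (x - y) * f y)"
proof -
  show J: "integrable lborel (\<lambda>y. norm (K (x - y)) * norm (f y) powr p)"
    by (rule Bochner_Integration.integrable_bound[OF integrable_mult_right[OF f, of B]])
       (auto simp: abs_mult B intro!: mult_right_mono order.trans[OF B abs_ge_self])
  have "norm (K (x - y) * f y) \<le> norm (K (x - y)) + norm (K (x - y)) * norm (f y) powr p" for y
    using mult_left_mono[OF le_add_powr[OF p norm_ge_zero[of "f y"] zero_less_one], of "norm (K (x - y))"]
    by (simp add: norm_mult ring_distribs)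
  then show "integrable lborel (\<lambda>y. K (x - y) * f y)"
    by (intro Bochner_Integration.integrable_bound[OF Bochner_Integration.integrable_add[OF integrable_norm[OF integrable_reflect[OF K, of x]] J]])
       (auto intro!: AE_I2 order.trans[OF _ abs_ge_self])
qed

text \<open>
  With \<open>|f| \<le> c + c\<^sup>1\<^sup>-\<^sup>p |f|\<^sup>p\<close> and \<open>c\<close> proportional to the convolution itself, Young's inequality
  needs no Hoelder inequality, at the price of a non-optimal constant.
\<close>

lemma conv_powr_le:
  assumes p: "1 \<le> p" and [measurable]: "f \<in> borel_measurable borel" and f: "Lp_int p f"
  shows "norm (conv K f x) powr p \<le>
     2 * (2 * (1 + (LBINT y. norm (K y)))) powr (p - 1) * (LBINT y. norm (K (x - y)) * norm (f y) powr p)"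
proof -
  \<comment> \<open>The summand 1 keeps the denominator of c below positive even if K
    vanishes.\<close>
  define \<kappa> where "\<kappa> = 1 + (LBINT y. norm (K y))"
  have \<kappa>0: "(LBINT y. norm (K y)) \<ge> 0" by simp
  then have \<kappa>: "\<kappa> > 0" unfolding \<kappa>_def by linarith
  define I where "I = (LBINT y. norm (K (x - y) * f y))"
  define J where "J = (LBINT y. norm (K (x - y)) * norm (f y) powr p)"
  note ints = integrable_conv_kernel[OF assms, of x]
  have J0: "J \<ge> 0" unfolding J_def by simp
  have I0: "I \<ge> 0" unfolding I_def by simp
  have "norm (conv K f x) \<le> I"
    unfolding conv_def I_def by (rule integral_norm_bound)
  then have "norm (conv K f x) powr p \<le> I powr p" using p by (intro powr_mono2) auto
  also have "I powr p \<le> 2 * (2 * \<kappa>) powr (p - 1) * J"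
  proof (cases "I = 0")
    case False
    \<comment> \<open>With this level the contribution of the constant c is at most I / 2 and is
      absorbed by the left-hand side.\<close>
    define c where "c = I / (2 * \<kappa>)"
    have c: "c > 0" using False I0 \<kappa> by (simp add: c_def)
    have "I \<le> (LBINT y. c * norm (K (x - y)) + c powr (1 - p) * (norm (K (x - y)) * norm (f y) powr p))"
      unfolding I_def
    proof (rule integral_mono)
      show "integrable lborel (\<lambda>y. c * norm (K (x - y)) + c powr (1 - p) * (norm (K (x - y)) * norm (f y) powr p))"
        by (intro Bochner_Integration.integrable_add integrable_mult_right ints integrable_norm integrable_reflect K)
      show "norm (K (x - y) * f y) \<le> c * norm (K (x - y)) + c powr (1 - p) * (norm (K (x - y)) * norm (f y) powr p)" for y
        using mult_left_mono[OF le_add_powr[OF p norm_ge_zero[of "f y"] c], of "norm (K (x - y))"]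
        by (simp add: norm_mult algebra_simps)
    qed (intro integrable_norm ints)
    also have "\<dots> = c * (LBINT y. norm (K (x - y))) + c powr (1 - p) * J"
      unfolding J_def by (subst Bochner_Integration.integral_add)
        (auto intro!: integrable_mult_right ints integrable_norm integrable_reflect K)
    also have "(LBINT y. norm (K (x - y))) = (LBINT y. norm (K y))"
      by (rule lborel_integral_reflect) simp
    also have "c * (LBINT y. norm (K y)) \<le> c * \<kappa>"
      using c by (simp add: \<kappa>_def)
    also have "c * \<kappa> = I / 2" using \<kappa> by (simp add: c_def)
    finally have "I / 2 \<le> c powr (1 - p) * J" by simp
    then have "(c powr (p - 1)) * (I / 2) \<le> c powr (p - 1) * (c powr (1 - p) * J)"
      by (intro mult_left_mono) auto
    also have "\<dots> = J" using c by (simp add: mult.assoc[symmetric] powr_add[symmetric])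
    finally have *: "I * c powr (p - 1) \<le> 2 * J" by (simp add: mult.commute)
    have "I powr p = I powr (1 + (p - 1))" by simp
    also have "\<dots> = I * I powr (p - 1)" using I0 by (simp only: powr_add powr_one)
    also have "I powr (p - 1) = (2 * \<kappa>) powr (p - 1) * c powr (p - 1)"
      using \<kappa> c I0 by (simp add: c_def powr_mult[symmetric])
    also have "I * ((2 * \<kappa>) powr (p - 1) * c powr (p - 1)) = (2 * \<kappa>) powr (p - 1) * (I * c powr (p - 1))"
      by simp
    also have "\<dots> \<le> (2 * \<kappa>) powr (p - 1) * (2 * J)"
      using * by (intro mult_left_mono) auto
    finally show ?thesis by simp
  qed (use J0 in simp)
  finally show ?thesis unfolding \<kappa>_def J_def .
qed

lemma conv_Lp:
  assumes p: "1 \<le> p"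
  obtains C where "C \<ge> 0" "Lp_bound p (conv K) C"
proof -
  define c where "c = 2 * (2 * (1 + (LBINT y. norm (K y)))) powr (p - 1)"
  define C where "C = c * (LBINT y. norm (K y))"
  have c: "c \<ge> 0" by (simp add: c_def)
  have *: "Lp_int p (conv K f) \<and> Lp_pow p (conv K f) \<le> C * Lp_pow p f"
    if f_meas [measurable]: "f \<in> borel_measurable borel" and f: "Lp_int p f" for f
  proof -
    \<comment> \<open>J is the convolution of |K| with |f|^p; the complex-valued form makes
      \<open>conv_integrable\<close> and \<open>ft_conv\<close> applicable to it.\<close>
    let ?k = "\<lambda>x. complex_of_real (norm (K x))" and ?f = "\<lambda>y. complex_of_real (norm (f y) powr p)"
    have k: "integrable lborel ?k" using K by (simp add: complex_of_real_integrable_eq)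
    have ff: "integrable lborel ?f" using f by (simp add: complex_of_real_integrable_eq)
    define J where "J x = (LBINT y. norm (K (x - y)) * norm (f y) powr p)" for x
    have J: "conv ?k ?f x = complex_of_real (J x)" for x
      unfolding conv_def J_def by (simp flip: integral_complex_of_real)
    have Ji: "integrable lborel J"
      using conv_integrable[OF k ff] unfolding J complex_of_real_integrable_eq .
    \<comment> \<open>At frequency 0 the convolution theorem says that the integral of a convolution
      is the product of the integrals.\<close>
    have "complex_of_real (LBINT x. J x) = ft (conv ?k ?f) 0"
      unfolding ft_def J by simp
    also have "\<dots> = ft ?k 0 * ft ?f 0" by (rule ft_conv[OF k ff])
    also have "\<dots> = complex_of_real ((LBINT x. norm (K x)) * Lp_pow p f)"
      unfolding ft_def by simp
    finally have JI: "(LBINT x. J x) = (LBINT x. norm (K x)) * Lp_pow p f"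
      unfolding of_real_eq_iff .
    have le: "norm (conv K f x) powr p \<le> c * J x" for x
      unfolding c_def J_def by (rule conv_powr_le[OF p f_meas f])
    have [measurable]: "conv K f \<in> borel_measurable borel" by (rule conv_measurable) auto
    have I: "Lp_int p (conv K f)"
      by (rule Bochner_Integration.integrable_bound[OF integrable_mult_right[OF Ji, of c]])
         (auto intro!: AE_I2 order.trans[OF le abs_ge_self])
    moreover have "Lp_pow p (conv K f) \<le> (LBINT x. c * J x)"
      by (intro integral_mono I integrable_mult_right Ji le)
    ultimately show ?thesis by (simp add: JI C_def mult.assoc)
  qed
  have "C \<ge> 0" unfolding C_def using c by simp
  then show ?thesis using that * by blast
qed

end

section \<open>Integrability of the Fourier integral\<close>

abbreviation growth :: "real \<Rightarrow> ('a::euclidean_space \<Rightarrow> real) \<Rightarrow> bool" where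
  "growth \<mu> F \<equiv> \<exists>C. \<forall>x. \<bar>F x\<bar> \<le> C * (1 + (norm x)\<^sup>2) powr \<mu>"

abbreviation dir_deriv :: "'a::euclidean_space \<Rightarrow> ('a \<Rightarrow> real) \<Rightarrow> ('a \<Rightarrow> real) \<Rightarrow> bool" where
  "dir_deriv e F F' \<equiv> \<forall>x. ((\<lambda>t. F (x + t *\<^sub>R e)) has_real_derivative F' x) (at 0)"

text \<open>
  Symbols of order \<open>\<mu>\<close> with respect to \<open>1 + |x|\<^sup>2\<close>: each derivative along \<open>e\<close> may raise the order by
  \<open>\<eta>\<close>. For the class \<open>\<G>\<^sup>\<beta>\<^sub>s\<close> one has \<open>\<eta> = \<beta> s / (4 n) - 1/2 > 0\<close>, so derivatives decay less, not more.
\<close>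

primrec symb :: "'a::euclidean_space \<Rightarrow> real \<Rightarrow> nat \<Rightarrow> real \<Rightarrow> ('a \<Rightarrow> real) \<Rightarrow> bool" where
  "symb e \<eta> 0 \<mu> F \<longleftrightarrow> growth \<mu> F"
| "symb e \<eta> (Suc k) \<mu> F \<longleftrightarrow> growth \<mu> F \<and>
     (\<exists>F'. dir_deriv e F F' \<and> symb e \<eta> k (\<mu> + \<eta>) F')"

lemma symb_bound:
  assumes "symb e \<eta> k \<mu> F"
  obtains C where "C \<ge> 0" "\<And>x. \<bar>F x\<bar> \<le> C * (1 + (norm x)\<^sup>2) powr \<mu>"
proof -
  obtain C where C: "\<And>x. \<bar>F x\<bar> \<le> C * (1 + (norm x)\<^sup>2) powr \<mu>"
    using assms by (cases k) auto
  have "0 \<le> C" using order.trans[OF abs_ge_zero C[of 0]] by simp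
  then show ?thesis using that C by blast
qed

lemma symb_bound_mono:
  assumes "growth \<mu> F" "\<mu> \<le> \<nu>"
  shows "growth \<nu> F"
proof -
  obtain C where C: "\<And>x. \<bar>F x\<bar> \<le> C * (1 + (norm x)\<^sup>2) powr \<mu>" using assms by blast
  have "\<bar>F x\<bar> \<le> \<bar>C\<bar> * (1 + (norm x)\<^sup>2) powr \<nu>" for x
  proof -
    have "\<bar>F x\<bar> \<le> \<bar>C\<bar> * (1 + (norm x)\<^sup>2) powr \<mu>"
      using C[of x] mult_right_mono[OF abs_ge_self[of C], of "(1 + (norm x)\<^sup>2) powr \<mu>"] by simp
    also have "\<dots> \<le> \<bar>C\<bar> * (1 + (norm x)\<^sup>2) powr \<nu>"
      by (intro mult_left_mono powr_mono assms) auto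
    finally show ?thesis .
  qed
  then show ?thesis by blast
qed

lemma symb_mono: "symb e \<eta> k \<mu> F \<Longrightarrow> \<mu> \<le> \<nu> \<Longrightarrow> symb e \<eta> k \<nu> F"
proof (induction k arbitrary: \<mu> \<nu> F)
  case (Suc k)
  then obtain F' where "dir_deriv e F F'"
    and "symb e \<eta> k (\<mu> + \<eta>) F'" by auto
  moreover from this(2) have "symb e \<eta> k (\<nu> + \<eta>) F'"
    using Suc.IH[of "\<mu> + \<eta>" F' "\<nu> + \<eta>"] Suc.prems(2) by simp
  moreover have "growth \<nu> F"
    using symb_bound_mono[OF _ Suc.prems(2), of F] Suc.prems(1) unfolding symb.simps(2) by blast
  ultimately show ?case by auto
qed (simp add: symb_bound_mono)

lemma symb_Suc: "symb e \<eta> (Suc k) \<mu> F \<Longrightarrow> symb e \<eta> k \<mu> F"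
proof (induction k arbitrary: \<mu> F)
  case (Suc k)
  from Suc.prems obtain F' where "dir_deriv e F F'"
    "symb e \<eta> (Suc k) (\<mu> + \<eta>) F'"
    unfolding symb.simps(2)[of e \<eta> "Suc k"] by blast
  moreover have "growth \<mu> F" using Suc.prems by simp
  ultimately show ?case using Suc.IH unfolding symb.simps(2)[of e \<eta> k \<mu> F] by blast
qed simp

lemma symb_add: "symb e \<eta> k \<mu> F \<Longrightarrow> symb e \<eta> k \<mu> G \<Longrightarrow> symb e \<eta> k \<mu> (\<lambda>x. F x + G x)"
proof (induction k arbitrary: \<mu> F G)
  have bound: "growth \<mu> (\<lambda>x. F x + G x)"
    if sF: "symb e \<eta> k \<mu> F" and sG: "symb e \<eta> k \<mu> G" for k \<mu> F G
  proof -
    obtain C D where "\<And>x. \<bar>F x\<bar> \<le> C * (1 + (norm x)\<^sup>2) powr \<mu>" "\<And>x. \<bar>G x\<bar> \<le> D * (1 + (norm x)\<^sup>2) powr \<mu>"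
      using symb_bound[OF sF] symb_bound[OF sG] by metis
    then have "\<bar>F x + G x\<bar> \<le> (C + D) * (1 + (norm x)\<^sup>2) powr \<mu>" for x
      using order.trans[OF abs_triangle_ineq add_mono, of "F x" _ "G x"] by (simp add: ring_distribs)
    then show ?thesis by blast
  qed
  {
    case 0
    then show ?case using bound[of 0 \<mu> F G] by simp
  next
    case (Suc k)
    obtain F' G' where F: "\<And>x. ((\<lambda>t. F (x + t *\<^sub>R e)) has_real_derivative F' x) (at 0)" "symb e \<eta> k (\<mu> + \<eta>) F'"
      and G: "\<And>x. ((\<lambda>t. G (x + t *\<^sub>R e)) has_real_derivative G' x) (at 0)" "symb e \<eta> k (\<mu> + \<eta>) G'"
      using Suc.prems by auto
    have "dir_deriv e (\<lambda>x. F x + G x) (\<lambda>x. F' x + G' x)"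
      using F(1) G(1) by (auto intro!: DERIV_add)
    then show ?case
      using Suc.IH[OF F(2) G(2)] bound[OF Suc.prems] unfolding symb.simps(2) by (intro conjI exI[of _ "\<lambda>x. F' x + G' x"])
  }
qed

text \<open>Leibniz rule: each summand differentiates only one factor, so the order of the product
  rises by \<eta> once.\<close>

lemma symb_mult: "symb e \<eta> k \<mu> F \<Longrightarrow> symb e \<eta> k \<nu> G \<Longrightarrow> symb e \<eta> k (\<mu> + \<nu>) (\<lambda>x. F x * G x)"
proof (induction k arbitrary: \<mu> \<nu> F G)
  have bound: "growth (\<mu> + \<nu>) (\<lambda>x. F x * G x)"
    if sF: "symb e \<eta> k \<mu> F" and sG: "symb e \<eta> k \<nu> G" for k \<mu> \<nu> F G
  proof -
    obtain C D where "\<And>x. \<bar>F x\<bar> \<le> C * (1 + (norm x)\<^sup>2) powr \<mu>" "\<And>x. \<bar>G x\<bar> \<le> D * (1 + (norm x)\<^sup>2) powr \<nu>"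
      "C \<ge> 0" "D \<ge> 0"
      using symb_bound[OF sF] symb_bound[OF sG] by metis
    then have "\<bar>F x * G x\<bar> \<le> (C * D) * (1 + (norm x)\<^sup>2) powr (\<mu> + \<nu>)" for x
      using mult_mono[of "\<bar>F x\<bar>" "C * (1 + (norm x)\<^sup>2) powr \<mu>" "\<bar>G x\<bar>" "D * (1 + (norm x)\<^sup>2) powr \<nu>"]
      by (simp add: abs_mult powr_add mult_ac)
    then show ?thesis by blast
  qed
  {
    case 0
    then show ?case using bound[of 0 \<mu> F \<nu> G] by simp
  next
    case (Suc k)
    obtain F' G' where F: "\<And>x. ((\<lambda>t. F (x + t *\<^sub>R e)) has_real_derivative F' x) (at 0)" "symb e \<eta> k (\<mu> + \<eta>) F'"
      and G: "\<And>x. ((\<lambda>t. G (x + t *\<^sub>R e)) has_real_derivative G' x) (at 0)" "symb e \<eta> k (\<nu> + \<eta>) G'"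
      using Suc.prems by auto
    have "((\<lambda>t. F (x + t *\<^sub>R e) * G (x + t *\<^sub>R e)) has_real_derivative F' x * G x + F x * G' x) (at 0)" for x
      using DERIV_mult[OF F(1)[of x] G(1)[of x]] by (simp add: mult.commute)
    then have D: "dir_deriv e (\<lambda>x. F x * G x) (\<lambda>x. F' x * G x + F x * G' x)" ..
    have "symb e \<eta> k (\<mu> + \<nu> + \<eta>) (\<lambda>x. F' x * G x + F x * G' x)"
      using Suc.IH[OF F(2) symb_Suc[OF Suc.prems(2)]] Suc.IH[OF symb_Suc[OF Suc.prems(1)] G(2)]
      by (intro symb_add) (simp_all add: algebra_simps)
    with D show ?case
      using bound[OF Suc.prems] unfolding symb.simps(2) by (intro conjI exI[of _ "\<lambda>x. F' x * G x + F x * G' x"])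
  }
qed

text \<open>Zero has every order, whatever the sign of \<eta>; so the derivative of a constant fits
  into the chain.\<close>

lemma symb_zero: "symb e \<eta> k \<mu> (\<lambda>x. 0)"
proof (induction k arbitrary: \<mu>)
  case (Suc k)
  have "growth \<mu> (\<lambda>x::'a. 0)" by (rule exI[of _ 0]) simp
  then show ?case using Suc by (auto intro!: exI[of _ "\<lambda>_. 0"])
qed (auto intro!: exI[of _ 0])

lemma symb_const: "symb e \<eta> k 0 (\<lambda>x. c)"
proof -
  have b: "growth 0 (\<lambda>x::'a. c)"
    by (intro exI[of _ "\<bar>c\<bar>"]) (auto simp: add_nonneg_eq_0_iff)
  show ?thesis
  proof (cases k)
    case (Suc j)
    show ?thesis unfolding Suc symb.simps(2)
      using b symb_zero[of e \<eta> j] by (intro conjI exI[of _ "\<lambda>_. 0"]) auto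
  qed (use b in simp)
qed

text \<open>The derivative is 1, of order 0, and the bound on \<eta> lets it count as order 1/2 +
  \<eta>.\<close>

lemma symb_linear:
  assumes "norm e = 1" "\<eta> \<ge> - (1/2)"
  shows "symb e \<eta> k (1/2) (\<lambda>x. x \<bullet> e)"
proof -
  have b: "growth (1/2) (\<lambda>x. x \<bullet> e)"
  proof (intro exI[of _ 1] allI)
    fix x
    have "\<bar>x \<bullet> e\<bar> \<le> norm x" using Cauchy_Schwarz_ineq2[of x e] assms by simp
    also have "\<dots> \<le> sqrt (1 + (norm x)\<^sup>2)" by (simp add: real_le_rsqrt)
    finally show "\<bar>x \<bullet> e\<bar> \<le> 1 * (1 + (norm x)\<^sup>2) powr (1/2)" by (simp add: powr_half_sqrt)
  qed
  show ?thesis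
  proof (cases k)
    case (Suc j)
    have "((\<lambda>t. (x + t *\<^sub>R e) \<bullet> e) has_real_derivative 1) (at 0)" for x
    proof -
      have "e \<bullet> e = 1" using assms by (simp add: norm_eq_sqrt_inner)
      then show ?thesis by (auto simp: inner_add_left intro!: derivative_eq_intros)
    qed
    moreover have "symb e \<eta> j (1/2 + \<eta>) (\<lambda>x. 1)"
      using assms by (intro symb_mono[OF symb_const]) auto
    ultimately show ?thesis unfolding Suc symb.simps(2) using b by (intro conjI exI[of _ "\<lambda>_. 1"]) auto
  qed (use b in simp)
qed

section \<open>Iterated differences in place of derivatives\<close>

definition fdiff :: "'a::real_vector \<Rightarrow> ('a \<Rightarrow> 'b::ab_group_add) \<Rightarrow> 'a \<Rightarrow> 'b" where
  "fdiff v F x = F (x + v) - F x"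

lemma one_plus_norm_translate:
  assumes "norm v \<le> 1"
  shows "1 + (norm (x + v))\<^sup>2 \<le> 3 * (1 + (norm x)\<^sup>2)"
proof -
  have "(norm v)\<^sup>2 \<le> 1" using assms by (simp add: power_le_one)
  then show ?thesis using norm_add_sq_le[of x v] zero_le_power2[of "norm x"] unfolding distrib_left by linarith
qed

text \<open>A Peetre-type inequality: weights at points of distance at most 1 are comparable, for
  exponents of either sign.\<close>

lemma powr_norm_translate:
  assumes "norm v \<le> 1"
  shows "(1 + (norm (x + v))\<^sup>2) powr \<nu> \<le> 3 powr \<bar>\<nu>\<bar> * (1 + (norm x)\<^sup>2) powr \<nu>"
proof (cases "\<nu> \<ge> 0")
  case True
  have "(1 + (norm (x + v))\<^sup>2) powr \<nu> \<le> (3 * (1 + (norm x)\<^sup>2)) powr \<nu>"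
    using one_plus_norm_translate[OF assms] True by (intro powr_mono2) auto
  then show ?thesis using True powr_mult[of 3 "1 + (norm x)\<^sup>2" \<nu>] by simp
next
  case False
  have "1 + (norm x)\<^sup>2 \<le> 3 * (1 + (norm (x + v))\<^sup>2)"
    using one_plus_norm_translate[of "- v" "x + v"] assms by simp
  then have "(1 + (norm (x + v))\<^sup>2) powr \<nu> \<le> ((1 + (norm x)\<^sup>2) / 3) powr \<nu>"
    using False by (intro powr_mono2') (auto simp: add_pos_nonneg)
  also have "\<dots> = 3 powr \<bar>\<nu>\<bar> * (1 + (norm x)\<^sup>2) powr \<nu>"
    using False by (simp add: powr_divide powr_minus field_simps)
  finally show ?thesis .
qed

lemma fdiff_iter_derivative:
  assumes "\<And>x. ((\<lambda>t. F (x + t *\<^sub>R e)) has_real_derivative F' x) (at 0)"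
  shows "((\<lambda>t. (fdiff v ^^ k) F (x + t *\<^sub>R e)) has_real_derivative (fdiff v ^^ k) F' x) (at 0)"
proof (induction k arbitrary: x)
  case (Suc k)
  from DERIV_diff[OF Suc.IH[of "x + v"] Suc.IH[of x]]
  show ?case by (simp add: fdiff_def algebra_simps)
qed (simp add: assms)

text \<open>Each difference is exchanged for a factor h and a derivative by the mean value theorem.
  The constant must not depend on h, since h tends to 0 in \<open>ft_moment_finite\<close>.\<close>

lemma symb_fdiff:
  assumes e: "norm e = 1" and "symb e \<eta> k \<mu> F"
  shows "\<exists>C. \<forall>x h. 0 < h \<and> h \<le> 1 \<longrightarrow>
    \<bar>(fdiff (h *\<^sub>R e) ^^ k) F x\<bar> \<le> C * h ^ k * (1 + (norm x)\<^sup>2) powr (\<mu> + real k * \<eta>)"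
  using assms(2)
proof (induction k arbitrary: \<mu> F)
  case (Suc k)
  obtain F' where F': "\<And>x. ((\<lambda>t. F (x + t *\<^sub>R e)) has_real_derivative F' x) (at 0)" "symb e \<eta> k (\<mu> + \<eta>) F'"
    using Suc.prems by auto
  define \<nu> where "\<nu> = \<mu> + \<eta> + real k * \<eta>"
  obtain C0 where C0: "\<And>x h. 0 < h \<Longrightarrow> h \<le> 1 \<Longrightarrow> \<bar>(fdiff (h *\<^sub>R e) ^^ k) F' x\<bar> \<le> C0 * h ^ k * (1 + (norm x)\<^sup>2) powr \<nu>"
    using Suc.IH[OF F'(2)] unfolding \<nu>_def by blast
  define C where "C = \<bar>C0\<bar>"
  have C: "\<bar>(fdiff (h *\<^sub>R e) ^^ k) F' x\<bar> \<le> C * h ^ k * (1 + (norm x)\<^sup>2) powr \<nu>" if "0 < h" "h \<le> 1" for x h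
  proof -
    have "C0 * h ^ k * (1 + (norm x)\<^sup>2) powr \<nu> \<le> C * h ^ k * (1 + (norm x)\<^sup>2) powr \<nu>"
      using that by (intro mult_right_mono) (auto simp: C_def)
    then show ?thesis using C0[OF that, of x] by linarith
  qed
  have "\<bar>(fdiff (h *\<^sub>R e) ^^ Suc k) F x\<bar> \<le> (C * 3 powr \<bar>\<nu>\<bar>) * h ^ Suc k * (1 + (norm x)\<^sup>2) powr \<nu>"
    if h: "0 < h" "h \<le> 1" for x h
  proof -
    let ?G = "(fdiff (h *\<^sub>R e) ^^ k) F" and ?G' = "(fdiff (h *\<^sub>R e) ^^ k) F'"
    have D: "((\<lambda>t. ?G (x + t *\<^sub>R e)) has_real_derivative ?G' (x + t *\<^sub>R e)) (at t)" for t
    proof -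
      have "((\<lambda>s. ?G (x + (s + t) *\<^sub>R e)) has_real_derivative ?G' (x + t *\<^sub>R e)) (at 0)"
        using fdiff_iter_derivative[OF F'(1), where v="h *\<^sub>R e" and k=k and x="x + t *\<^sub>R e"]
        by (simp add: scaleR_add_left add_ac)
      then show ?thesis
        using DERIV_shift[of "\<lambda>t. ?G (x + t *\<^sub>R e)" _ 0 t] by simp
    qed
    \<comment> \<open>The mean value theorem acts on the k-fold difference of F, whose derivative is
      the k-fold difference of F'. The intermediate point is within distance 1 of x, so the weight
      there is comparable.\<close>
    obtain t where t: "0 < t" "t < h" "?G (x + h *\<^sub>R e) - ?G (x + 0 *\<^sub>R e) = (h - 0) * ?G' (x + t *\<^sub>R e)"
      using MVT2[OF h(1), of "\<lambda>t. ?G (x + t *\<^sub>R e)" "\<lambda>t. ?G' (x + t *\<^sub>R e)"] D by blast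
    have "\<bar>(fdiff (h *\<^sub>R e) ^^ Suc k) F x\<bar> = h * \<bar>?G' (x + t *\<^sub>R e)\<bar>"
      using t(3) h by (simp add: fdiff_def abs_mult)
    also have "\<dots> \<le> h * (C * h ^ k * (1 + (norm (x + t *\<^sub>R e))\<^sup>2) powr \<nu>)"
      using C[OF h] h by (intro mult_left_mono) auto
    also have "\<dots> \<le> h * (C * h ^ k * (3 powr \<bar>\<nu>\<bar> * (1 + (norm x)\<^sup>2) powr \<nu>))"
      using t h e by (intro mult_left_mono powr_norm_translate) (auto simp: C_def)
    finally show ?thesis by (simp add: mult_ac)
  qed
  moreover have "\<mu> + real (Suc k) * \<eta> = \<nu>" by (simp add: \<nu>_def algebra_simps)
  ultimately show ?case by auto
qed simp

lemma ft_fdiff: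
  assumes "integrable lborel F"
  shows "ft (fdiff v F) \<xi> = (cis (v \<bullet> \<xi>) - 1) * ft F \<xi>" and "integrable lborel (fdiff v F)"
proof -
  have i: "integrable lborel (\<lambda>x. F (x + v))"
    using lborel_integrable_affine[OF assms, of 1 v] by (simp add: add.commute)
  then show "integrable lborel (fdiff v F)"
    unfolding fdiff_def[abs_def] using assms by simp
  have [measurable]: "F \<in> borel_measurable borel" using assms by auto
  have "ft (\<lambda>x. F (x + v)) \<xi> = cis (v \<bullet> \<xi>) * (LBINT x. cis (- ((v + x) \<bullet> \<xi>)) * F (v + x))"
    unfolding ft_def integral_mult_right_zero[symmetric]
    by (intro Bochner_Integration.integral_cong refl)
       (simp add: mult.assoc[symmetric] cis_mult inner_add_left add.commute)
  also have "(LBINT x. cis (- ((v + x) \<bullet> \<xi>)) * F (v + x)) = ft F \<xi>"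
    unfolding ft_def by (rule lborel_integral_translate) simp
  finally have *: "ft (\<lambda>x. F (x + v)) \<xi> = cis (v \<bullet> \<xi>) * ft F \<xi>" .
  have "ft (fdiff v F) \<xi> = ft (\<lambda>x. F (x + v)) \<xi> - ft F \<xi>"
    unfolding ft_def fdiff_def right_diff_distrib
    by (rule Bochner_Integration.integral_diff) (use i assms in auto)
  then show "ft (fdiff v F) \<xi> = (cis (v \<bullet> \<xi>) - 1) * ft F \<xi>"
    unfolding * by (simp add: algebra_simps)
qed

lemma ft_fdiff_iter:
  assumes "integrable lborel F"
  shows "integrable lborel ((fdiff v ^^ k) F)" "ft ((fdiff v ^^ k) F) \<xi> = (cis (v \<bullet> \<xi>) - 1) ^ k * ft F \<xi>"
proof (induction k)
  case (Suc k)
  case 1 show ?case using ft_fdiff(2)[OF Suc(1)] by simp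
  case 2 show ?case using ft_fdiff(1)[OF Suc(1)] Suc(2) by simp
qed (use assms in simp_all)

lemma cis_difference_quotient:
  "(\<lambda>k. (cis (t / real (Suc k)) - 1) * of_nat (Suc k)) \<longlonglongrightarrow> \<i> * of_real t"
proof -
  have "((\<lambda>z. exp (\<i> * of_real t * z)) has_field_derivative \<i> * of_real t) (at 0)"
    by (auto intro!: derivative_eq_intros)
  then have "((\<lambda>z. (exp (\<i> * of_real t * z) - 1) / z) \<longlongrightarrow> \<i> * of_real t) (at 0)"
    by (simp add: DERIV_def)
  moreover have "filterlim (\<lambda>k. complex_of_real (1 / real (Suc k))) (at 0) sequentially"
    using tendsto_of_real[OF lim_1_over_n[THEN LIMSEQ_Suc], where 'a=complex] by (simp add: filterlim_at del: of_nat_Suc)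
  ultimately have "(\<lambda>k. (exp (\<i> * of_real t * complex_of_real (1 / real (Suc k))) - 1) / complex_of_real (1 / real (Suc k))) \<longlonglongrightarrow> \<i> * of_real t"
    by (rule filterlim_compose)
  then show ?thesis by (simp add: cis_conv_exp)
qed

text \<open>
  The derivatives of order \<open>n\<close> of the multiplier need not be integrable, so their Fourier
  integrals are not available. Difference quotients of the multiplier are integrable, and the
  limit is taken on the Fourier side by Fatou's lemma.
\<close>

lemma ft_moment_finite:
  assumes F: "integrable lborel F"
    and D: "\<And>k. N2 ((fdiff ((1 / real (Suc k)) *\<^sub>R b) ^^ n) F) \<le> ennreal (C * (1 / real (Suc k)) ^ (2 * n))"
  shows "(\<integral>\<^sup>+\<xi>. ennreal ((\<xi> \<bullet> b) ^ (2 * n) * (norm (ft F \<xi>))\<^sup>2) \<partial>lborel) < \<infinity>"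
proof -
  note [measurable] = ft_measurable[OF F]
  have "(\<integral>\<^sup>+\<xi>. ennreal ((\<xi> \<bullet> b) ^ (2 * n) * (norm (ft F \<xi>))\<^sup>2) \<partial>lborel) \<le> ennreal ((2 * pi) ^ DIM('a)) * ennreal C"
  proof (rule nn_integral_le_limit)
    let ?g = "\<lambda>k \<xi>. (norm ((cis ((b \<bullet> \<xi>) / real (Suc k)) - 1) * of_nat (Suc k))) ^ (2 * n) * (norm (ft F \<xi>))\<^sup>2"
    show "(\<lambda>\<xi>. ennreal (?g k \<xi>)) \<in> borel_measurable lborel" for k by measurable
    show "AE \<xi> in lborel. (\<lambda>k. ennreal (?g k \<xi>)) \<longlonglongrightarrow> ennreal ((\<xi> \<bullet> b) ^ (2 * n) * (norm (ft F \<xi>))\<^sup>2)"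
    proof (rule AE_I2, rule tendsto_ennrealI)
      fix \<xi>
      have "(\<lambda>k. ?g k \<xi>) \<longlonglongrightarrow> (norm (\<i> * of_real (b \<bullet> \<xi>))) ^ (2 * n) * (norm (ft F \<xi>))\<^sup>2"
        by (intro tendsto_mult tendsto_power tendsto_norm cis_difference_quotient tendsto_const)
      then show "(\<lambda>k. ?g k \<xi>) \<longlonglongrightarrow> (\<xi> \<bullet> b) ^ (2 * n) * (norm (ft F \<xi>))\<^sup>2"
        by (simp add: norm_mult power_even_abs inner_commute)
    qed
    show "(\<integral>\<^sup>+\<xi>. ennreal (?g k \<xi>) \<partial>lborel) \<le> ennreal ((2 * pi) ^ DIM('a)) * ennreal C" for k
    proof -
      let ?h = "1 / real (Suc k)"
      define G where "G = (fdiff (?h *\<^sub>R b) ^^ n) F"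
      have eq: "?g k \<xi> = real (Suc k) ^ (2 * n) * (norm (ft G \<xi>))\<^sup>2" for \<xi>
        by (simp add: G_def ft_fdiff_iter(2)[OF F] norm_mult norm_power power_mult_distrib power_mult[symmetric] mult_ac del: of_nat_Suc)
      have G: "integrable lborel G" unfolding G_def by (rule ft_fdiff_iter(1)[OF F])
      note [measurable] = ft_measurable[OF G]
      have "(\<integral>\<^sup>+\<xi>. ennreal (?g k \<xi>) \<partial>lborel) = ennreal (real (Suc k) ^ (2 * n)) * (\<integral>\<^sup>+\<xi>. ennreal ((norm (ft G \<xi>))\<^sup>2) \<partial>lborel)"
        unfolding eq by (subst ennreal_mult) (auto intro!: nn_integral_cmult)
      also have "\<dots> \<le> ennreal (real (Suc k) ^ (2 * n)) * (ennreal ((2 * pi) ^ DIM('a)) * N2 G)"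
        unfolding N2_def[symmetric] by (intro mult_left_mono ft_contraction G) auto
      also have "\<dots> \<le> ennreal (real (Suc k) ^ (2 * n)) * (ennreal ((2 * pi) ^ DIM('a)) * ennreal (C * ?h ^ (2 * n)))"
        unfolding G_def by (intro mult_left_mono D) auto
      also have "\<dots> = ennreal ((2 * pi) ^ DIM('a)) * (ennreal (real (Suc k) ^ (2 * n)) * ennreal (C * ?h ^ (2 * n)))"
        by (simp add: mult_ac)
      also have "ennreal (real (Suc k) ^ (2 * n)) * ennreal (C * ?h ^ (2 * n)) = ennreal (real (Suc k) ^ (2 * n) * (C * ?h ^ (2 * n)))"
        by (rule ennreal_mult'[symmetric]) simp
      also have "real (Suc k) ^ (2 * n) * (C * ?h ^ (2 * n)) = C"
        by (simp add: power_one_over)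
      finally show ?thesis .
    qed
  qed
  also have "\<dots> < \<infinity>" by (simp add: ennreal_mult_less_top)
  finally show ?thesis .
qed

text \<open>All terms are bounded by the maximum M of 1 and the t b, and M^n is itself one of the
  terms on the right.\<close>

lemma power_one_plus_sum_le:
  assumes "finite A" "\<And>b. b \<in> A \<Longrightarrow> 0 \<le> t b"
  shows "(1 + (\<Sum>b\<in>A. t b)) ^ n \<le> (1 + real (card A)) ^ n * (1 + (\<Sum>b\<in>A. t b ^ n))"
proof -
  define M where "M = Max (insert 1 (t ` A))"
  have M: "1 \<le> M" "\<And>b. b \<in> A \<Longrightarrow> t b \<le> M" using assms by (auto simp: M_def)
  have "(1 + (\<Sum>b\<in>A. t b)) \<le> M + real (card A) * M"
    using M by (intro add_mono sum_bounded_above) auto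
  then have "(1 + (\<Sum>b\<in>A. t b)) ^ n \<le> ((1 + real (card A)) * M) ^ n"
    using assms by (intro power_mono) (auto simp: algebra_simps intro!: add_nonneg_nonneg sum_nonneg)
  also have "\<dots> = (1 + real (card A)) ^ n * M ^ n" by (rule power_mult_distrib)
  also have "M ^ n \<le> 1 + (\<Sum>b\<in>A. t b ^ n)"
  proof -
    have "M \<in> insert 1 (t ` A)" unfolding M_def using assms(1) by (intro Max_in) auto
    then consider "M = 1" | b where "b \<in> A" "M = t b" by auto
    then show ?thesis
    proof cases
      case 1
      then show ?thesis using assms by (auto intro!: sum_nonneg)
    next
      case (2 b)
      then show ?thesis using assms member_le_sum[of b A "\<lambda>b. t b ^ n"] by auto
    qed
  qed
  finally show ?thesis by (simp add: mult_left_mono)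
qed

text \<open>Cauchy-Schwarz in additive form with weight w: the moments make w |ft F|^2 integrable,
  and 1 / w is dominated by (1 + |\<xi>|^2)^(-n).\<close>

lemma ft_integrable_if_moments:
  fixes F :: "'a::euclidean_space \<Rightarrow> complex"
  assumes F: "integrable lborel F" "N2 F < \<infinity>"
    and mom: "\<And>b. b \<in> Basis \<Longrightarrow> (\<integral>\<^sup>+\<xi>. ennreal ((\<xi> \<bullet> b) ^ (2 * DIM('a)) * (norm (ft F \<xi>))\<^sup>2) \<partial>lborel) < \<infinity>"
  shows "integrable lborel (ft F)"
proof (rule integrableI_bounded)
  note [measurable] = ft_measurable[OF F(1)]
  define w where "w \<xi> = 1 + (\<Sum>b\<in>Basis. (\<xi> \<bullet> b) ^ (2 * DIM('a)))" for \<xi> :: 'a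
  define c where "c = (1 + real DIM('a)) ^ DIM('a)"
  have w: "w \<xi> \<ge> 1" for \<xi> unfolding w_def by (auto intro!: sum_nonneg)
  have inv: "1 / w \<xi> \<le> c * (1 / (1 + (norm \<xi>)\<^sup>2) ^ DIM('a))" for \<xi>
  proof -
    have "(1 + (norm \<xi>)\<^sup>2) ^ DIM('a) \<le> c * w \<xi>"
      using power_one_plus_sum_le[of Basis "\<lambda>b. (\<xi> \<bullet> b)\<^sup>2" "DIM('a)"]
      unfolding norm_sq_Basis c_def w_def by (simp add: power_mult)
    moreover have "(1 + (norm \<xi>)\<^sup>2) ^ DIM('a) > 0" by (intro zero_less_power) (auto intro: add_pos_nonneg)
    ultimately show ?thesis using w[of \<xi>] by (simp add: field_simps)
  qed
  show "ft F \<in> borel_measurable lborel" by simp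
  have "(\<integral>\<^sup>+\<xi>. ennreal (norm (ft F \<xi>)) \<partial>lborel) \<le>
     (\<integral>\<^sup>+\<xi>. (ennreal ((norm (ft F \<xi>))\<^sup>2) + (\<Sum>b\<in>Basis. ennreal ((\<xi> \<bullet> b) ^ (2 * DIM('a)) * (norm (ft F \<xi>))\<^sup>2))) + ennreal (c * (1 / (1 + (norm \<xi>)\<^sup>2) ^ DIM('a))) \<partial>lborel)"
  proof (rule nn_integral_mono)
    fix \<xi> :: 'a
    let ?u = "norm (ft F \<xi>)"
    have "?u \<le> w \<xi> * ?u\<^sup>2 + 1 / w \<xi>" \<comment> \<open>AM-GM\<close>
    proof -
      have "2 * (w \<xi> * ?u) \<le> (w \<xi> * ?u)\<^sup>2 + 1"
        using sum_squares_bound[of "w \<xi> * ?u" 1] by simp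
      moreover have "0 \<le> w \<xi> * ?u" using w[of \<xi>] by simp
      ultimately have "w \<xi> * ?u \<le> (w \<xi> * ?u)\<^sup>2 + 1" by linarith
      then have "w \<xi> * ?u \<le> w \<xi> * (w \<xi> * ?u\<^sup>2 + 1 / w \<xi>)"
        using w[of \<xi>] by (simp add: power2_eq_square algebra_simps)
      then show ?thesis using w[of \<xi>] by (simp add: mult_le_cancel_left)
    qed
    also have "\<dots> \<le> ?u\<^sup>2 + (\<Sum>b\<in>Basis. (\<xi> \<bullet> b) ^ (2 * DIM('a)) * ?u\<^sup>2) + c * (1 / (1 + (norm \<xi>)\<^sup>2) ^ DIM('a))"
      using inv[of \<xi>] by (simp add: w_def ring_distribs sum_distrib_right)
    finally have "ennreal ?u \<le> ennreal (?u\<^sup>2 + (\<Sum>b\<in>Basis. (\<xi> \<bullet> b) ^ (2 * DIM('a)) * ?u\<^sup>2) + c * (1 / (1 + (norm \<xi>)\<^sup>2) ^ DIM('a)))"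
      by (rule ennreal_leI)
    also have "\<dots> = ennreal (?u\<^sup>2) + (\<Sum>b\<in>Basis. ennreal ((\<xi> \<bullet> b) ^ (2 * DIM('a)) * ?u\<^sup>2)) + ennreal (c * (1 / (1 + (norm \<xi>)\<^sup>2) ^ DIM('a)))"
      by (subst ennreal_plus, (auto simp: c_def intro!: add_nonneg_nonneg sum_nonneg)[2], subst ennreal_plus)
         (auto intro!: sum_nonneg simp: sum_ennreal)
    finally show "ennreal ?u \<le> (ennreal (?u\<^sup>2) + (\<Sum>b\<in>Basis. ennreal ((\<xi> \<bullet> b) ^ (2 * DIM('a)) * ?u\<^sup>2))) + ennreal (c * (1 / (1 + (norm \<xi>)\<^sup>2) ^ DIM('a)))" .
  qed
  also have "\<dots> = N2 (ft F) + (\<Sum>b\<in>Basis. \<integral>\<^sup>+\<xi>. ennreal ((\<xi> \<bullet> b) ^ (2 * DIM('a)) * (norm (ft F \<xi>))\<^sup>2) \<partial>lborel) + (\<integral>\<^sup>+\<xi>. ennreal (c * (1 / (1 + (norm (\<xi>::'a))\<^sup>2) ^ DIM('a))) \<partial>lborel)"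
    unfolding N2_def by (simp add: nn_integral_add nn_integral_sum del: sum_ennreal)
  also have "\<dots> < \<infinity>"
  proof -
    have "N2 (ft F) \<le> ennreal ((2 * pi) ^ DIM('a)) * N2 F"
      by (rule ft_contraction[OF F(1)])
    also have "\<dots> < \<infinity>" using F(2) by (simp add: ennreal_mult_less_top)
    finally have 1: "N2 (ft F) < \<infinity>" .
    have "integrable lborel (\<lambda>\<xi>::'a. c * (1 / (1 + (norm \<xi>)\<^sup>2) ^ DIM('a)))"
      by (intro integrable_mult_right integrable_inverse_norm)
    then have 2: "(\<integral>\<^sup>+\<xi>. ennreal (c * (1 / (1 + (norm (\<xi>::'a))\<^sup>2) ^ DIM('a))) \<partial>lborel) < \<infinity>"
      by (subst nn_integral_eq_integral) (auto simp: c_def)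
    show ?thesis using 1 2 mom by simp
  qed
  finally show "(\<integral>\<^sup>+\<xi>. ennreal (norm (ft F \<xi>)) \<partial>lborel) < \<infinity>" .
qed

section \<open>The multiplier\<close>

text \<open>On the real line a Frechet derivative is multiplication by its value at 1, so the
  direction 1 alone recovers the chain of ordinary derivatives, one-sided at an end point of
  S.\<close>

lemma Ck_on_derivatives:
  assumes "Ck_on k S f"
  shows "\<exists>A. A 0 = f \<and> (\<forall>i<k. \<forall>x\<in>S. (A i has_real_derivative A (Suc i) x) (at x within S)) \<and>
    (\<forall>i\<le>k. continuous_on S (A i))"
  using assms
proof (induction k arbitrary: f)
  case 0
  then show ?case by (intro exI[of _ "\<lambda>_. f"]) auto
next
  case (Suc k)
  then obtain f' where f': "\<forall>x\<in>S. (f has_derivative f' x) (at x within S)" "\<forall>v. Ck_on k S (\<lambda>x. f' x v)"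
    by auto
  have d: "(f has_real_derivative f' x 1) (at x within S)" if "x \<in> S" for x
  proof -
    have f'x: "(f has_derivative f' x) (at x within S)" using f'(1) that by blast
    then have lin: "linear (f' x)" by (rule has_derivative_linear)
    have "f' x v = f' x 1 * v" for v
      using linear_scale[OF lin, of v 1] by (simp add: mult.commute)
    then have "f' x = (*) (f' x 1)" by (rule ext)
    then show ?thesis using f'x by (simp add: has_field_derivative_def)
  qed
  obtain A where A: "A 0 = (\<lambda>x. f' x 1)"
    "\<forall>i<k. \<forall>x\<in>S. (A i has_real_derivative A (Suc i) x) (at x within S)"
    "\<forall>i\<le>k. continuous_on S (A i)"
    using Suc.IH[of "\<lambda>x. f' x 1"] f'(2) by blast
  define B where "B i = (case i of 0 \<Rightarrow> f | Suc j \<Rightarrow> A j)" for i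
  have "\<forall>i<Suc k. \<forall>x\<in>S. (B i has_real_derivative B (Suc i) x) (at x within S)"
    using d A by (auto simp: B_def split: nat.split)
  moreover have "continuous_on S f" using d by (rule DERIV_continuous_on)
  then have "\<forall>i\<le>Suc k. continuous_on S (B i)"
    using A(3) by (auto simp: B_def split: nat.split)
  moreover have "B 0 = f" by (simp add: B_def)
  ultimately show ?case by blast
qed

text \<open>The squared norm takes only nonnegative values, so a derivative within {0..} suffices
  for the chain rule even at x = 0.\<close>

lemma norm_sq_chain:
  assumes "(f has_real_derivative D) (at ((norm x)\<^sup>2) within {0..})"
  shows "((\<lambda>t. f ((norm (x + t *\<^sub>R e))\<^sup>2)) has_real_derivative D * (2 * (x \<bullet> e))) (at 0)"
proof -
  define g where "g t = (norm (x + t *\<^sub>R e))\<^sup>2" for t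
  have g: "(g has_real_derivative 2 * (x \<bullet> e)) (at 0)"
    unfolding g_def power2_norm_eq_inner
    by (auto simp: inner_add_left inner_add_right inner_commute intro!: derivative_eq_intros)
  have "(f has_real_derivative D) (at (g 0) within g ` UNIV)"
    by (rule DERIV_subset[of _ _ _ "{0..}"]) (use assms in \<open>auto simp: g_def\<close>)
  from DERIV_image_chain[OF this g] show ?thesis
    by (simp add: o_def g_def)
qed

text \<open>
  The functions \<open>A i\<close> play the role of the derivatives of \<open>a = A 0\<close>. There is no upper bound on
  \<open>A 0\<close> itself, because the class only restricts the growth of derivatives of positive order.
\<close>

locale radial_derivatives =
  fixes n :: nat and \<epsilon> \<gamma> c :: real and A :: "nat \<Rightarrow> real \<Rightarrow> real"
  assumes \<epsilon>: "\<epsilon> \<ge> 0"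
    and A: "\<And>i \<tau>. i < n \<Longrightarrow> 0 \<le> \<tau> \<Longrightarrow> (A i has_real_derivative A (Suc i) \<tau>) (at \<tau> within {0..})"
    and bound: "\<And>i. 1 \<le> i \<Longrightarrow> i \<le> n \<Longrightarrow> \<exists>C. \<forall>\<tau>\<ge>0. \<bar>A i \<tau>\<bar> \<le> C * (1 + \<tau>) powr (real i * \<epsilon> + \<gamma>)"
    and nonneg: "\<And>\<tau>. 0 \<le> \<tau> \<Longrightarrow> 0 \<le> A 0 \<tau>"
    and c: "c > 0" and lower: "\<And>\<tau>. 0 \<le> \<tau> \<Longrightarrow> c * (1 + \<tau>) powr \<gamma> \<le> 1 + A 0 \<tau>"
begin

text \<open>A derivative along e replaces \<open>A i\<close> by \<open>A (Suc i)\<close>, which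
  costs \<epsilon>, and brings out the linear factor 2 (x \<bullet> e), which costs 1/2; hence the
  value of \<eta>.\<close>

lemma symb_radial:
  assumes e: "norm e = 1" and eta: "\<eta> = \<epsilon> + 1/2"
  shows "1 \<le> i \<Longrightarrow> i + k \<le> n \<Longrightarrow> symb e \<eta> k (real i * \<epsilon> + \<gamma>) (\<lambda>x. A i ((norm x)\<^sup>2))"
proof (induction k arbitrary: i)
  have b: "growth (real i * \<epsilon> + \<gamma>) (\<lambda>x::'a. A i ((norm x)\<^sup>2))"
    if "1 \<le> i" "i \<le> n" for i
    using bound[OF that] by (metis zero_le_power2)
  {
    case 0
    then show ?case using b[of i] by simp
  next
    case (Suc k)
    have D: "((\<lambda>t. A i ((norm (x + t *\<^sub>R e))\<^sup>2)) has_real_derivative A (Suc i) ((norm x)\<^sup>2) * (2 * (x \<bullet> e))) (at 0)" for x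
      using norm_sq_chain[OF A[of i "(norm x)\<^sup>2"], of e] Suc.prems by simp
    have "symb e \<eta> k ((real (Suc i) * \<epsilon> + \<gamma>) + (0 + 1/2)) (\<lambda>x. A (Suc i) ((norm x)\<^sup>2) * (2 * (x \<bullet> e)))"
      using Suc.prems eta e \<epsilon> by (intro symb_mult Suc.IH symb_const symb_linear) auto
    also have "(real (Suc i) * \<epsilon> + \<gamma>) + (0 + 1/2) = real i * \<epsilon> + \<gamma> + \<eta>"
      using eta by (simp add: algebra_simps)
    finally show ?case
      using b[of i] D Suc.prems unfolding symb.simps(2) by (intro conjI exI[of _ "\<lambda>x. A (Suc i) ((norm x)\<^sup>2) * (2 * (x \<bullet> e))"]) auto
  }
qed

text \<open>For r \<le> 0 the lower bound on 1 + A 0 gives an upper bound on its power. One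
  derivative lowers r by 1, and the loss \<gamma> in this power cancels the \<gamma> in the growth
  of A 1, leaving r \<gamma> + \<eta>. The induction therefore has to run over all r \<le>
  0.\<close>

lemma symb_radial_powr:
  assumes e: "norm e = 1" and eta: "\<eta> = \<epsilon> + 1/2"
  shows "k \<le> n \<Longrightarrow> r \<le> 0 \<Longrightarrow> symb e \<eta> k (r * \<gamma>) (\<lambda>x. (1 + A 0 ((norm x)\<^sup>2)) powr r)"
proof (induction k arbitrary: r)
  have b: "growth (r * \<gamma>) (\<lambda>x::'a. (1 + A 0 ((norm x)\<^sup>2)) powr r)" if "r \<le> 0" for r
  proof (intro exI allI)
    fix x :: 'a
    have "(1 + A 0 ((norm x)\<^sup>2)) powr r \<le> (c * (1 + (norm x)\<^sup>2) powr \<gamma>) powr r"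
      using lower[of "(norm x)\<^sup>2"] that c by (intro powr_mono2') (auto simp: add_nonneg_eq_0_iff)
    also have "\<dots> = c powr r * (1 + (norm x)\<^sup>2) powr (r * \<gamma>)"
      using c by (simp add: powr_mult powr_powr mult.commute)
    finally show "\<bar>(1 + A 0 ((norm x)\<^sup>2)) powr r\<bar> \<le> c powr r * (1 + (norm x)\<^sup>2) powr (r * \<gamma>)" by simp
  qed
  {
    case 0
    then show ?case using b[of r] by simp
  next
    case (Suc k)
    define F' where "F' x = (r * (1 + A 0 ((norm x)\<^sup>2)) powr (r - 1)) * (A 1 ((norm x)\<^sup>2) * (2 * (x \<bullet> e)))" for x
    have D: "((\<lambda>t. (1 + A 0 ((norm (x + t *\<^sub>R e))\<^sup>2)) powr r) has_real_derivative F' x) (at 0)" for x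
    proof -
      have d: "((\<lambda>t. 1 + A 0 ((norm (x + t *\<^sub>R e))\<^sup>2)) has_real_derivative A 1 ((norm x)\<^sup>2) * (2 * (x \<bullet> e))) (at 0)"
        using DERIV_add[OF DERIV_const[of 1] norm_sq_chain[OF A[of 0 "(norm x)\<^sup>2"], of e]] Suc.prems by simp
      have "0 < 1 + A 0 ((norm x)\<^sup>2)" using nonneg[of "(norm x)\<^sup>2"] by simp
      then have "((\<lambda>z. z powr r) has_real_derivative r * (1 + A 0 ((norm x)\<^sup>2)) powr (r - 1)) (at ((\<lambda>t. 1 + A 0 ((norm (x + t *\<^sub>R e))\<^sup>2)) 0))"
        using has_real_derivative_powr[of "1 + A 0 ((norm x)\<^sup>2)" r] by simp
      from DERIV_chain2[OF this d] show ?thesis by (simp add: F'_def)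
    qed
    have "symb e \<eta> k ((0 + (r - 1) * \<gamma>) + ((real 1 * \<epsilon> + \<gamma>) + (0 + 1/2))) F'"
      unfolding F'_def using Suc.prems eta e \<epsilon>
      by (intro symb_mult Suc.IH symb_const symb_linear symb_radial[OF e eta]) auto
    also have "(0 + (r - 1) * \<gamma>) + ((real 1 * \<epsilon> + \<gamma>) + (0 + 1/2)) = r * \<gamma> + \<eta>"
      using eta by (simp add: algebra_simps)
    finally show ?case
      using b[of r] D Suc.prems unfolding symb.simps(2) by (intro conjI exI[of _ F']) auto
  }
qed

end

lemma class_G_derivatives:
  assumes a: "a \<in> class_G TYPE('n::finite) \<beta> s" and "\<beta> > 0" and s: "\<beta> * s \<ge> 4 * real CARD('n)"
  defines "\<epsilon> \<equiv> \<beta> * s / (4 * real CARD('n)) - 1"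
  obtains A c where "A 0 = a" "radial_derivatives CARD('n) \<epsilon> (\<beta> / 2) c A" "continuous_on {0..} a"
proof -
  have \<epsilon>: "\<epsilon> \<ge> 0" using s by (simp add: \<epsilon>_def field_simps)
  have Ck: "Ck_on CARD('n) {0..} a" and nn: "\<And>t. 0 \<le> a (t\<^sup>2)"
    using a by (auto simp: class_G_def)
  obtain R M where RM: "R > 0" "M > 0" "\<And>x::real^'n. norm x > R \<Longrightarrow> M * (1 + (norm x)\<^sup>2) powr (\<beta> / 2) \<le> a ((norm x)\<^sup>2)"
    using a by (auto simp: class_G_def)
  have G3: "\<forall>k::nat. k > 0 \<longrightarrow> (\<exists>N>0. \<exists>\<rho>\<ge>0. \<forall>x::real^'n. norm x > \<rho> \<longrightarrow>
        (\<forall>j<k. (deriv ^^ j) a field_differentiable at ((norm x)\<^sup>2)) \<and>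
        \<bar>(deriv ^^ k) a ((norm x)\<^sup>2)\<bar> \<le> N * (1 + (norm x)\<^sup>2) powr (real k * \<epsilon> + \<beta> / 2))"
    using a unfolding class_G_def mem_Collect_eq \<epsilon>_def by (elim conjE)
  obtain A where A: "A 0 = a"
    "\<And>i \<tau>. i < CARD('n) \<Longrightarrow> 0 \<le> \<tau> \<Longrightarrow> (A i has_real_derivative A (Suc i) \<tau>) (at \<tau> within {0..})"
    "\<And>i. i \<le> CARD('n) \<Longrightarrow> continuous_on {0..} (A i)"
    using Ck_on_derivatives[OF Ck] by auto
  have a_nonneg: "0 \<le> a \<tau>" if "0 \<le> \<tau>" for \<tau> using nn[of "sqrt \<tau>"] that by simp
  have ex: "\<exists>x::real^'n. norm x = sqrt \<tau>" if "0 \<le> \<tau>" for \<tau>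
    by (metis that real_sqrt_ge_zero vector_choose_size)
  \<comment> \<open>The class bounds two-sided derivatives, whereas A consists of derivatives within
    {0..}; they can only be identified at interior points.\<close>
  have deriv_eq: "(deriv ^^ i) a \<tau> = A i \<tau>" if "i \<le> CARD('n)" "0 < \<tau>" for i \<tau>
    using that
  proof (induction i arbitrary: \<tau>)
    case (Suc i)
    have "(A i has_real_derivative A (Suc i) \<tau>) (at \<tau> within {0<..})"
      by (rule DERIV_subset[OF A(2)]) (use Suc.prems in auto)
    then have "(A i has_real_derivative A (Suc i) \<tau>) (at \<tau>)"
      using Suc.prems by (simp add: at_within_open[of \<tau> "{0<..}"])
    then have "((deriv ^^ i) a has_real_derivative A (Suc i) \<tau>) (at \<tau>)"
      by (rule has_field_derivative_transform_within_open[of _ _ _ "{0<..}"]) (use Suc in auto)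
    then show ?case by (simp add: DERIV_imp_deriv)
  qed (simp add: A(1))
  have bound: "\<exists>C. \<forall>\<tau>\<ge>0. \<bar>A i \<tau>\<bar> \<le> C * (1 + \<tau>) powr (real i * \<epsilon> + \<beta> / 2)" if i: "1 \<le> i" "i \<le> CARD('n)" for i
  proof -
    obtain N \<rho> where N: "N > 0" "\<rho> \<ge> 0" "\<And>x::real^'n. norm x > \<rho> \<Longrightarrow>
        \<bar>(deriv ^^ i) a ((norm x)\<^sup>2)\<bar> \<le> N * (1 + (norm x)\<^sup>2) powr (real i * \<epsilon> + \<beta> / 2)"
      using G3[THEN spec, of i] i by auto
    have "compact (A i ` {0..\<rho>\<^sup>2})"
      by (intro compact_continuous_image continuous_on_subset[OF A(3)] i) auto
    then have "bounded (A i ` {0..\<rho>\<^sup>2})" by (rule compact_imp_bounded)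
    then obtain B where B': "\<forall>y \<in> A i ` {0..\<rho>\<^sup>2}. norm y \<le> B" unfolding bounded_iff by blast
    have B: "\<bar>A i \<tau>\<bar> \<le> B" if "0 \<le> \<tau>" "\<tau> \<le> \<rho>\<^sup>2" for \<tau>
      using B' that by auto
    \<comment> \<open>The exponent is nonnegative, so the weight absorbs the constant bound on the
      compact interval [0, \<rho>^2].\<close>
    have pw: "1 \<le> (1 + \<tau>) powr (real i * \<epsilon> + \<beta> / 2)" if "0 \<le> \<tau>" for \<tau>
      using that \<epsilon> \<open>\<beta> > 0\<close> by (intro ge_one_powr_ge_zero) auto
    have "\<bar>A i \<tau>\<bar> \<le> (N + \<bar>B\<bar>) * (1 + \<tau>) powr (real i * \<epsilon> + \<beta> / 2)" if \<tau>: "0 \<le> \<tau>" for \<tau>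
    proof (cases "\<tau> \<le> \<rho>\<^sup>2")
      case True
      have "\<bar>A i \<tau>\<bar> \<le> (N + \<bar>B\<bar>) * 1" using B[OF \<tau> True] N(1) by simp
      also have "\<dots> \<le> (N + \<bar>B\<bar>) * (1 + \<tau>) powr (real i * \<epsilon> + \<beta> / 2)"
        using N(1) by (intro mult_left_mono pw \<tau>) auto
      finally show ?thesis .
    next
      case False
      obtain x :: "real^'n" where x: "norm x = sqrt \<tau>" using ex[OF \<tau>] by blast
      have "\<rho> < sqrt \<tau>" using False N(2) by (intro real_less_rsqrt) auto
      moreover have "0 < \<tau>" using False by (metis less_eq_real_def not_le order.trans zero_le_power2)
      ultimately have "\<bar>A i \<tau>\<bar> \<le> N * (1 + \<tau>) powr (real i * \<epsilon> + \<beta> / 2)"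
        using N(3)[of x] x \<tau> deriv_eq[OF i(2), of \<tau>] by simp
      also have "\<dots> \<le> (N + \<bar>B\<bar>) * (1 + \<tau>) powr (real i * \<epsilon> + \<beta> / 2)"
        by (intro mult_right_mono) auto
      finally show ?thesis .
    qed
    then show ?thesis by blast
  qed
  \<comment> \<open>The first entry serves for \<tau> > R^2; the second makes the left-hand side of
    \<open>lower\<close> at most 1 for \<tau> \<le> R^2, where only nonnegativity of a is
    available.\<close>
  define c where "c = min M ((1 + R\<^sup>2) powr (- (\<beta> / 2)))"
  have R1: "1 + R\<^sup>2 > 0" by (simp add: add_pos_nonneg)
  have c: "c > 0" using RM(2) R1 by (simp add: c_def)
  have lower: "c * (1 + \<tau>) powr (\<beta> / 2) \<le> 1 + a \<tau>" if \<tau>: "0 \<le> \<tau>" for \<tau>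
  proof (cases "\<tau> \<le> R\<^sup>2")
    case True
    have "c * (1 + \<tau>) powr (\<beta> / 2) \<le> (1 + R\<^sup>2) powr (- (\<beta> / 2)) * (1 + R\<^sup>2) powr (\<beta> / 2)"
      using True \<tau> \<open>\<beta> > 0\<close> by (intro mult_mono powr_mono2) (auto simp: c_def)
    also have "\<dots> = 1" using R1 by (simp flip: powr_add)
    finally show ?thesis using a_nonneg[OF \<tau>] by simp
  next
    case False
    obtain x :: "real^'n" where x: "norm x = sqrt \<tau>" using ex[OF \<tau>] by blast
    have "R < sqrt \<tau>" using False RM(1) by (intro real_less_rsqrt) auto
    then have "M * (1 + \<tau>) powr (\<beta> / 2) \<le> a \<tau>" using RM(3)[of x] x \<tau> by simp
    moreover have "c * (1 + \<tau>) powr (\<beta> / 2) \<le> M * (1 + \<tau>) powr (\<beta> / 2)"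
      by (intro mult_right_mono) (auto simp: c_def)
    ultimately show ?thesis by simp
  qed
  have "radial_derivatives CARD('n) \<epsilon> (\<beta> / 2) c A"
    by unfold_locales (use \<epsilon> A bound a_nonneg c lower in auto)
  moreover have "continuous_on {0..} a" using A(3)[of 0] A(1) by simp
  ultimately show thesis using that[of A c] A(1) by blast
qed

section \<open>Estimates for the multiplier of a function in the class\<close>

lemma fdiff_of_real:
  "(fdiff v ^^ k) (\<lambda>x. complex_of_real (F x)) x = complex_of_real ((fdiff v ^^ k) F x)"
  by (induction k arbitrary: x) (auto simp: fdiff_def)

definition multiplier :: "(real \<Rightarrow> real) \<Rightarrow> real \<Rightarrow> 'a::real_normed_vector \<Rightarrow> complex" where
  "multiplier a s \<xi> = of_real ((1 + a ((norm \<xi>)\<^sup>2)) powr (- s / 2))"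

lemma class_G_multiplier:
  assumes s: "s > 0" "\<beta> > 0" "\<beta> * s \<ge> 4 * real CARD('n)" and a: "a \<in> class_G TYPE('n::finite) \<beta> s"
  shows "continuous_on UNIV (multiplier a s :: real^'n \<Rightarrow> complex)"
    and "norm (multiplier a s (\<xi> :: real^'n)) \<le> 1"
    and "integrable lborel (multiplier a s :: real^'n \<Rightarrow> complex)"
    and "N2 (multiplier a s :: real^'n \<Rightarrow> complex) < \<infinity>"
    and "integrable lborel (ft (multiplier a s) :: real^'n \<Rightarrow> complex)"
proof -
  let ?m = "multiplier a s :: real^'n \<Rightarrow> complex"
  let ?n = "CARD('n)"
  define \<epsilon> where "\<epsilon> = \<beta> * s / (4 * real ?n) - 1"
  obtain A c where A: "A 0 = a" and rad: "radial_derivatives ?n \<epsilon> (\<beta> / 2) c A"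
    and cont: "continuous_on {0..} a"
    using class_G_derivatives[OF a s(2,3)] unfolding \<epsilon>_def by metis
  have a_nonneg: "0 \<le> a \<tau>" if "0 \<le> \<tau>" for \<tau>
    using radial_derivatives.nonneg[OF rad that] by (simp add: A)
  define \<sigma> where "\<sigma> \<xi> = (1 + a ((norm \<xi>)\<^sup>2)) powr (- s / 2)" for \<xi> :: "real^'n"
  have m: "multiplier a s = (\<lambda>\<xi>. complex_of_real (\<sigma> \<xi>))"
    by (simp add: multiplier_def \<sigma>_def fun_eq_iff)
  have pos: "1 + a ((norm \<xi>)\<^sup>2) > 0" for \<xi> :: "real^'n"
    using a_nonneg[of "(norm \<xi>)\<^sup>2"] by simp
  have "continuous_on UNIV (\<lambda>\<xi>::real^'n. a ((norm \<xi>)\<^sup>2))"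
    by (rule continuous_on_compose2[OF cont]) (auto intro!: continuous_intros)
  then have \<sigma>_cont: "continuous_on UNIV \<sigma>"
    unfolding \<sigma>_def using pos by (intro continuous_on_powr continuous_intros) (auto simp: less_imp_neq[symmetric])
  then show mc: "continuous_on UNIV ?m"
    unfolding m by (intro continuous_intros)
  have \<sigma>1: "0 < \<sigma> \<xi>" "\<sigma> \<xi> \<le> 1" for \<xi>
  proof -
    show "0 < \<sigma> \<xi>" using pos[of \<xi>] by (simp add: \<sigma>_def)
    have "\<sigma> \<xi> \<le> 1 powr (- s / 2)"
      unfolding \<sigma>_def using a_nonneg[of "(norm \<xi>)\<^sup>2"] s(1) by (intro powr_mono2') auto
    then show "\<sigma> \<xi> \<le> 1" by simp
  qed
  then show "norm (multiplier a s \<xi>) \<le> 1" for \<xi> :: "real^'n" unfolding m by (simp add: abs_of_pos)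
  have [measurable]: "\<sigma> \<in> borel_measurable borel" by (rule borel_measurable_continuous_onI[OF \<sigma>_cont])
  let ?w = "\<lambda>\<xi>::real^'n. 1 / (1 + (norm \<xi>)\<^sup>2) ^ ?n"
  have w: "integrable lborel ?w" using integrable_inverse_norm[where 'a="real^'n"] by simp
  have w_powr: "(1 + (norm \<xi>)\<^sup>2) powr (- real ?n) = ?w \<xi>" for \<xi> :: "real^'n"
    by (simp add: powr_minus powr_realpow add_pos_nonneg divide_inverse)
  have symb: "symb e (\<epsilon> + 1/2) ?n (- s / 2 * (\<beta> / 2)) \<sigma>" if "norm e = 1" for e :: "real^'n"
    unfolding \<sigma>_def A[symmetric]
    by (rule radial_derivatives.symb_radial_powr[OF rad that]) (use s in auto)
  \<comment> \<open>The order-zero bound contained in \<open>symb\<close> does not involve the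
    direction; any axis serves to extract it.\<close>
  obtain e :: "real^'n" where e: "e \<in> Basis" using nonempty_Basis by blast
  have q: "- s / 2 * (\<beta> / 2) \<le> - real ?n" using s(3) by (simp add: mult.commute)
  obtain C where C: "\<And>x. \<bar>\<sigma> x\<bar> \<le> C * ?w x"
    using symb_bound[OF symb_mono[OF symb[of e] q]] e unfolding w_powr by auto
  have "integrable lborel \<sigma>"
  proof (rule Bochner_Integration.integrable_bound[OF integrable_mult_right[OF w, of C]])
    show "AE x in lborel. norm (\<sigma> x) \<le> norm (C * ?w x)"
      unfolding real_norm_def by (intro AE_I2 order.trans[OF C abs_ge_self])
  qed simp
  then show mi: "integrable lborel ?m"
    unfolding m complex_of_real_integrable_eq .
  have "N2 ?m \<le> (\<integral>\<^sup>+x. ennreal (\<sigma> x) \<partial>lborel)"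
    unfolding N2_def m
  proof (intro nn_integral_mono ennreal_leI)
    fix x
    show "(cmod (complex_of_real (\<sigma> x)))\<^sup>2 \<le> \<sigma> x"
      using \<sigma>1[of x] by (simp add: power2_eq_square mult_left_le)
  qed
  also have "\<dots> < \<infinity>"
    using \<open>integrable lborel \<sigma>\<close> \<sigma>1(1) by (subst nn_integral_eq_integral) (auto simp: less_imp_le)
  finally show mN: "N2 ?m < \<infinity>" .
  show "integrable lborel (ft ?m)"
  proof (rule ft_integrable_if_moments[OF mi mN])
    fix b :: "real^'n" assume "b \<in> Basis"
    then have nb: "norm b = 1" by simp
    \<comment> \<open>The terms containing \<beta> s cancel. The squared difference quotients are
      then dominated by (1 + |x|^2)^(-n), which is integrable.\<close>
    have ex: "- s / 2 * (\<beta> / 2) + real ?n * (\<epsilon> + 1/2) = - real ?n / 2"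
      by (simp add: \<epsilon>_def field_simps)
    obtain D where D: "\<And>x h. 0 < h \<Longrightarrow> h \<le> 1 \<Longrightarrow>
        \<bar>(fdiff (h *\<^sub>R b) ^^ ?n) \<sigma> x\<bar> \<le> D * h ^ ?n * (1 + (norm x)\<^sup>2) powr (- real ?n / 2)"
      using symb_fdiff[OF nb symb[OF nb]] unfolding ex by blast
    define I where "I = (LBINT x. ?w x)"
    have "N2 ((fdiff ((1 / real (Suc k)) *\<^sub>R b) ^^ DIM(real^'n)) (multiplier a s)) \<le> ennreal ((D\<^sup>2 * I) * (1 / real (Suc k)) ^ (2 * DIM(real^'n)))" for k
    proof -
      define h where "h = 1 / real (Suc k)"
      have h: "0 < h" "h \<le> 1" by (auto simp: h_def)
      have "N2 ((fdiff (h *\<^sub>R b) ^^ ?n) (multiplier a s)) \<le> (\<integral>\<^sup>+x. ennreal (D\<^sup>2 * h ^ (2 * ?n) * ?w x) \<partial>lborel)"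
        unfolding N2_def m fdiff_of_real
      proof (intro nn_integral_mono ennreal_leI)
        fix x
        have "\<bar>(fdiff (h *\<^sub>R b) ^^ ?n) \<sigma> x\<bar>\<^sup>2 \<le> (D * h ^ ?n * (1 + (norm x)\<^sup>2) powr (- real ?n / 2))\<^sup>2"
          by (intro power_mono D h) auto
        also have "\<dots> = D\<^sup>2 * h ^ (2 * ?n) * ((1 + (norm x)\<^sup>2) powr (- real ?n / 2))\<^sup>2"
          by (simp add: power_mult_distrib power_mult[symmetric] mult.commute)
        also have "((1 + (norm x)\<^sup>2) powr (- real ?n / 2))\<^sup>2 = (1 + (norm x)\<^sup>2) powr (- real ?n)"
          by (simp add: power2_eq_square powr_add[symmetric])
        finally show "(cmod (complex_of_real ((fdiff (h *\<^sub>R b) ^^ ?n) \<sigma> x)))\<^sup>2 \<le> D\<^sup>2 * h ^ (2 * ?n) * ?w x"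
          unfolding w_powr by simp
      qed
      also have "\<dots> = ennreal (LBINT x. D\<^sup>2 * h ^ (2 * ?n) * ?w x)"
        by (rule nn_integral_eq_integral[OF integrable_mult_right[OF w]]) (use h in auto)
      also have "(LBINT x. D\<^sup>2 * h ^ (2 * ?n) * ?w x) = D\<^sup>2 * h ^ (2 * ?n) * I"
        unfolding I_def by (rule integral_mult_right_zero)
      finally show ?thesis unfolding h_def[symmetric] by (simp add: mult_ac)
    qed
    from ft_moment_finite[OF mi this]
    show "(\<integral>\<^sup>+\<xi>. ennreal ((\<xi> \<bullet> b) ^ (2 * DIM(real^'n)) * (norm (ft (multiplier a s) \<xi>))\<^sup>2) \<partial>lborel) < \<infinity>" .
  qed
qed

section \<open>The Fourier transform of square integrable functions\<close>

text \<open>The definitions speak of Lebesgue measurable functions, while the Fubini arguments run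
  on products of \<open>lborel\<close>; an almost everywhere equal Borel function connects
  them.\<close>

lemma lebesgue_borel_version:
  fixes f :: "'a::euclidean_space \<Rightarrow> complex"
  assumes f: "f \<in> borel_measurable lebesgue"
  obtains f' where "f' \<in> borel_measurable borel" "AE x in lebesgue. f x = f' x"
proof -
  have "(\<lambda>x. Re (f x)) \<in> borel_measurable lebesgue" "(\<lambda>x. Im (f x)) \<in> borel_measurable lebesgue"
    using f by measurable
  from this[THEN completion_ex_borel_measurable_real]
  obtain r i where [measurable]: "r \<in> borel_measurable borel" "i \<in> borel_measurable borel"
    and ae: "AE x in lborel. Re (f x) = r x" "AE x in lborel. Im (f x) = i x"
    by auto
  have "AE x in lborel. f x = Complex (r x) (i x)"
    using ae by eventually_elim (simp add: complex_eq_iff)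
  then have "AE x in lebesgue. f x = Complex (r x) (i x)" by (rule AE_completion)
  moreover have "(\<lambda>x. Complex (r x) (i x)) \<in> borel_measurable borel"
    unfolding Complex_eq by measurable
  ultimately show ?thesis using that by blast
qed

lemma integral_lebesgue_borel_version:
  fixes f f' :: "'a::euclidean_space \<Rightarrow> 'b::{banach, second_countable_topology}"
  assumes "f \<in> borel_measurable lebesgue" "f' \<in> borel_measurable borel" "AE x in lebesgue. f x = f' x"
  shows "integrable lebesgue f \<longleftrightarrow> integrable lborel f'" "(LINT x|lebesgue. f x) = (LBINT x. f' x)"
proof -
  have m: "f' \<in> borel_measurable lborel" using assms(2) by simp
  then have m': "f' \<in> borel_measurable lebesgue" by (rule measurable_completion)
  show "integrable lebesgue f \<longleftrightarrow> integrable lborel f'"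
    using integrable_cong_AE[OF assms(1) m' assms(3)] integrable_completion[OF m] by simp
  show "(LINT x|lebesgue. f x) = (LBINT x. f' x)"
    using integral_cong_AE[OF assms(1) m' assms(3)] integral_completion[OF m] by simp
qed

lemma borel_lebesgueI: "f \<in> borel_measurable borel \<Longrightarrow> f \<in> borel_measurable lebesgue"
  by (rule measurable_completion) simp

lemma Lp_borel_version:
  assumes f: "f \<in> borel_measurable lebesgue" and [measurable]: "f' \<in> borel_measurable borel"
    and ae: "AE x in lebesgue. f x = f' x"
  shows "f \<in> Lp p \<longleftrightarrow> Lp_int p f'"
    and "Lp_norm p f = Lp_pow p f' powr (1 / p)"
proof -
  have m: "(\<lambda>x. norm (f x) powr p) \<in> borel_measurable lebesgue" using f by measurable
  have ae': "AE x in lebesgue. norm (f x) powr p = norm (f' x) powr p"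
    using ae by eventually_elim simp
  note * = integral_lebesgue_borel_version[OF m _ ae']
  show "f \<in> Lp p \<longleftrightarrow> Lp_int p f'"
    using *(1) f by (simp add: Lp_def)
  show "Lp_norm p f = Lp_pow p f' powr (1 / p)"
    using *(2) by (simp add: Lp_norm_def)
qed

lemma Lp_borel:
  assumes "f \<in> borel_measurable borel"
  shows "f \<in> Lp p \<longleftrightarrow> Lp_int p f"
    and "Lp_norm p f = Lp_pow p f powr (1 / p)"
  by (rule Lp_borel_version[OF borel_lebesgueI[OF assms] assms], simp)+

lemma integrable_powr_2_iff:
  assumes [measurable]: "f \<in> borel_measurable borel"
  shows "Lp_int 2 f \<longleftrightarrow> N2 f < \<infinity>"
  unfolding integrable_iff_bounded N2_def by simp

lemma integrable_powr_1_iff: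
  assumes [measurable]: "f \<in> borel_measurable borel"
  shows "Lp_int 1 f \<longleftrightarrow> integrable lborel f"
  by (auto intro: integrable_norm integrable_norm_cancel)

lemma N2_eq_integral:
  assumes [measurable]: "f \<in> borel_measurable borel" and "N2 f < \<infinity>"
  shows "N2 f = ennreal (Lp_pow 2 f)"
proof -
  have "Lp_int 2 f"
    using integrable_powr_2_iff[OF assms(1)] assms(2) by blast
  from nn_integral_eq_integral[OF this] show ?thesis by (simp add: N2_def)
qed

lemma N2_eq_Lp_norm:
  assumes "f \<in> borel_measurable lebesgue" "f' \<in> borel_measurable borel" "AE x in lebesgue. f x = f' x"
    and "N2 f' < \<infinity>"
  shows "N2 f' = ennreal ((Lp_norm 2 f)\<^sup>2)"
proof -
  have "(Lp_norm 2 f)\<^sup>2 = (Lp_pow 2 f' powr (1 / 2))\<^sup>2"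
    by (simp only: Lp_borel_version(2)[OF assms(1-3)])
  also have "\<dots> = Lp_pow 2 f'"
    by (subst powr_half_sqrt) auto
  finally show ?thesis using N2_eq_integral[OF assms(2,4)] by simp
qed

lemma Lp_norm_2_tendsto_iff:
  assumes "\<And>k. f k \<in> borel_measurable lebesgue" "\<And>k. f' k \<in> borel_measurable borel" "\<And>k. AE x in lebesgue. f k x = f' k x"
    and "\<And>k. N2 (f' k) < \<infinity>"
  shows "(\<lambda>k. Lp_norm 2 (f k)) \<longlonglongrightarrow> 0 \<longleftrightarrow> (\<lambda>k. N2 (f' k)) \<longlonglongrightarrow> 0"
proof -
  have "(\<lambda>k. N2 (f' k)) \<longlonglongrightarrow> 0 \<longleftrightarrow> (\<lambda>k. (Lp_norm 2 (f k))\<^sup>2) \<longlonglongrightarrow> 0"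
    unfolding N2_eq_Lp_norm[OF assms] by (rule ennreal_tendsto_0_iff) simp
  also have "\<dots> \<longleftrightarrow> (\<lambda>k. Lp_norm 2 (f k)) \<longlonglongrightarrow> 0"
  proof
    assume "(\<lambda>k. (Lp_norm 2 (f k))\<^sup>2) \<longlonglongrightarrow> 0"
    then have "(\<lambda>k. sqrt ((Lp_norm 2 (f k))\<^sup>2)) \<longlonglongrightarrow> sqrt 0" by (rule tendsto_real_sqrt)
    then show "(\<lambda>k. Lp_norm 2 (f k)) \<longlonglongrightarrow> 0" by (simp add: Lp_norm_def)
  next
    assume "(\<lambda>k. Lp_norm 2 (f k)) \<longlonglongrightarrow> 0"
    from tendsto_power[OF this, of 2] show "(\<lambda>k. (Lp_norm 2 (f k))\<^sup>2) \<longlonglongrightarrow> 0" by simp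
  qed
  finally show ?thesis by simp
qed

lemma N2_cmult:
  assumes [measurable]: "f \<in> borel_measurable borel"
  shows "N2 (\<lambda>x. c * f x) = ennreal ((norm c)\<^sup>2) * N2 f"
  unfolding N2_def by (simp add: norm_mult power_mult_distrib ennreal_mult nn_integral_cmult)

lemma N2_cmult_tendsto:
  assumes "\<And>k. f k \<in> borel_measurable borel" "(\<lambda>k. N2 (f k)) \<longlonglongrightarrow> 0"
  shows "(\<lambda>k. N2 (\<lambda>x. c * f k x)) \<longlonglongrightarrow> 0"
  unfolding N2_cmult[OF assms(1)] using ennreal_tendsto_cmult[OF _ assms(2), of "ennreal ((norm c)\<^sup>2)"] by simp

lemma N2_diff_tendsto:
  assumes [measurable]: "\<And>k. u k \<in> borel_measurable borel" "\<And>k. v k \<in> borel_measurable borel"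
    and u: "(\<lambda>k. N2 (u k)) \<longlonglongrightarrow> 0" and v: "(\<lambda>k. N2 (v k)) \<longlonglongrightarrow> 0"
  shows "(\<lambda>k. N2 (\<lambda>x. u k x - v k x)) \<longlonglongrightarrow> 0"
proof (rule ennreal_tendsto_0_le)
  have "(\<lambda>k. 2 * N2 (u k) + 2 * N2 (v k)) \<longlonglongrightarrow> 2 * 0 + 2 * 0"
    by (intro tendsto_add ennreal_tendsto_cmult u v) auto
  then show "(\<lambda>k. 2 * N2 (u k) + 2 * N2 (v k)) \<longlonglongrightarrow> 0" by simp
  show "N2 (\<lambda>x. u k x - v k x) \<le> 2 * N2 (u k) + 2 * N2 (v k)" for k
    using N2_triangle[of "u k" "\<lambda>_. 0" "v k"] by (simp add: N2_def)
qed

lemma N2_cong_AE: "AE x in lborel. f x = g x \<Longrightarrow> N2 f = N2 g"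
  unfolding N2_def by (intro nn_integral_cong_AE) auto

lemma N2_diff_finite:
  assumes [measurable]: "f \<in> borel_measurable borel" "g \<in> borel_measurable borel"
    and "N2 f < \<infinity>" "N2 g < \<infinity>"
  shows "N2 (\<lambda>x. f x - g x) < \<infinity>"
proof -
  have "N2 (\<lambda>x. f x - g x) \<le> 2 * N2 f + 2 * N2 g"
    using N2_triangle[of f "\<lambda>_. 0" g] by (simp add: N2_def)
  also have "\<dots> < \<infinity>" using assms by (simp add: ennreal_mult_less_top)
  finally show ?thesis .
qed

lemma N2_ft_finite: "integrable lborel f \<Longrightarrow> N2 f < \<infinity> \<Longrightarrow> N2 (ft f) < \<infinity>"
  by (rule order.strict_trans1[OF ft_contraction]) (auto simp: ennreal_mult_less_top)

lemma Lp_norm_2_diff_tendsto_iff: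
  assumes F: "\<And>k. F k \<in> borel_measurable lebesgue" "\<And>k. F' k \<in> borel_measurable borel" "\<And>k. AE x in lebesgue. F k x = F' k x"
    and f: "f \<in> borel_measurable lebesgue" "f' \<in> borel_measurable borel" "AE x in lebesgue. f x = f' x"
    and N: "\<And>k. N2 (F' k) < \<infinity>" "N2 f' < \<infinity>"
  shows "(\<lambda>k. Lp_norm 2 (\<lambda>x. F k x - f x)) \<longlonglongrightarrow> 0 \<longleftrightarrow> L2_lim F' f'"
proof (rule Lp_norm_2_tendsto_iff)
  show "AE x in lebesgue. F k x - f x = F' k x - f' x" for k
    using F(3)[of k] f(3) by eventually_elim simp
  show "N2 (\<lambda>x. F' k x - f' x) < \<infinity>" for k by (intro N2_diff_finite F f N)
qed (use F f in auto)

section \<open>The L2 transform on Borel functions\<close>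

abbreviation fourier_const :: "'n::finite itself \<Rightarrow> complex" where
  "fourier_const _ \<equiv> of_real ((2 * pi) powr (- real CARD('n) / 2))"

text \<open>The counterpart of \<open>has_fourier_L2\<close> for Borel functions, phrased with
  \<open>ft\<close> and \<open>N2\<close>; \<open>fourier_L2I\<close> and \<open>fourier_L2D\<close>
  translate between the two.\<close>

definition fourier_L2 :: "(real^'n \<Rightarrow> complex) \<Rightarrow> (real^'n \<Rightarrow> complex) \<Rightarrow> bool" where
  "fourier_L2 f g \<longleftrightarrow> f \<in> borel_measurable borel \<and> g \<in> borel_measurable borel \<and> N2 f < \<infinity> \<and> N2 g < \<infinity> \<and>
    (\<exists>F::nat \<Rightarrow> real^'n \<Rightarrow> complex. (\<forall>k. integrable lborel (F k) \<and> N2 (F k) < \<infinity>) \<and>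
      L2_lim F f \<and>
      L2_lim (\<lambda>k \<xi>. fourier_const TYPE('n) * ft (F k) \<xi>) g)"

lemma fourier_borel_version:
  fixes f f' :: "real^'n \<Rightarrow> complex"
  assumes f: "f \<in> borel_measurable lebesgue" and [measurable]: "f' \<in> borel_measurable borel"
    and ae: "AE x in lebesgue. f x = f' x"
  shows "fourier f \<xi> = fourier_const TYPE('n) * ft f' \<xi>"
proof -
  have c: "(\<lambda>x. cis (- (x \<bullet> \<xi>))) \<in> borel_measurable lebesgue"
    by (rule borel_lebesgueI) simp
  have m: "(\<lambda>x. cis (- (x \<bullet> \<xi>)) * f x) \<in> borel_measurable lebesgue"
    using c f by (rule borel_measurable_times)
  have ae': "AE x in lebesgue. cis (- (x \<bullet> \<xi>)) * f x = cis (- (x \<bullet> \<xi>)) * f' x"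
    using ae by eventually_elim simp
  show ?thesis
    using integral_lebesgue_borel_version(2)[OF m _ ae'] by (simp add: fourier_def ft_def)
qed

lemma fourier_L2I:
  fixes f g f' g' :: "real^'n \<Rightarrow> complex"
  assumes "has_fourier_L2 f g"
    and f': "f' \<in> borel_measurable borel" "AE x in lebesgue. f x = f' x"
    and g': "g' \<in> borel_measurable borel" "AE x in lebesgue. g x = g' x"
  shows "fourier_L2 f' g'"
proof -
  note [measurable] = f'(1) g'(1)
  obtain F where f: "f \<in> Lp 2" and g: "g \<in> Lp 2" and F: "\<And>k::nat. F k \<in> Lp 1 \<inter> Lp 2" "\<And>k. fourier (F k) \<in> Lp 2"
    and lim: "(\<lambda>k. Lp_norm 2 (\<lambda>x. F k x - f x)) \<longlonglongrightarrow> 0" "(\<lambda>k. Lp_norm 2 (\<lambda>\<xi>. fourier (F k) \<xi> - g \<xi>)) \<longlonglongrightarrow> 0"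
    using assms(1) unfolding has_fourier_L2_def by blast
  have fm: "f \<in> borel_measurable lebesgue" "g \<in> borel_measurable lebesgue" "\<And>k. F k \<in> borel_measurable lebesgue"
    using f g F(1) by (auto simp: Lp_def)
  have "\<forall>k. \<exists>F'. F' \<in> borel_measurable borel \<and> (AE x in lebesgue. F k x = F' x)"
    using lebesgue_borel_version[OF fm(3)] by metis
  then obtain F' where F': "\<And>k. F' k \<in> borel_measurable borel" "\<And>k. AE x in lebesgue. F k x = F' k x" by metis
  note [measurable] = F'(1)
  have N: "N2 f' < \<infinity>" "N2 g' < \<infinity>" "\<And>k. N2 (F' k) < \<infinity>" and i: "\<And>k. integrable lborel (F' k)"
    using f g F(1) Lp_borel_version(1)[OF fm(1) f'] Lp_borel_version(1)[OF fm(2) g'] Lp_borel_version(1)[OF fm(3) F']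
    unfolding integrable_powr_2_iff[OF f'(1), symmetric] integrable_powr_2_iff[OF g'(1), symmetric] integrable_powr_2_iff[OF F'(1), symmetric]
      integrable_powr_1_iff[OF F'(1), symmetric] by blast+
  have ft_m [measurable]: "ft (F' k) \<in> borel_measurable borel" for k by (rule ft_measurable[OF i])
  have fou: "fourier (F k) = (\<lambda>\<xi>. fourier_const TYPE('n) * ft (F' k) \<xi>)" for k
    using fourier_borel_version[OF fm(3) F'] by (intro ext)
  have cm: "(\<lambda>\<xi>. fourier_const TYPE('n) * ft (F' k) \<xi>) \<in> borel_measurable borel" for k by measurable
  have "L2_lim F' f'"
    using Lp_norm_2_diff_tendsto_iff[where F=F and F'=F', OF fm(3) F' fm(1) f' N(3,1)] lim(1) by blast
  moreover have "L2_lim (\<lambda>k \<xi>. fourier_const TYPE('n) * ft (F' k) \<xi>) g'"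
    using lim(2) unfolding fou
    by (subst (asm) Lp_norm_2_diff_tendsto_iff[OF borel_lebesgueI[OF cm] cm _ fm(2) g' _ N(2)])
       (use N2_ft_finite[OF i N(3)] in \<open>auto simp: N2_cmult ennreal_mult_less_top\<close>)
  ultimately show ?thesis
    unfolding fourier_L2_def using f' g' N i by blast
qed

lemma fourier_L2D:
  fixes f f' g :: "real^'n \<Rightarrow> complex"
  assumes "fourier_L2 f' g" and f: "f \<in> borel_measurable lebesgue" "AE x in lebesgue. f x = f' x"
  shows "has_fourier_L2 f g"
proof -
  obtain F where f': "f' \<in> borel_measurable borel" and g: "g \<in> borel_measurable borel"
    and N: "N2 f' < \<infinity>" "N2 g < \<infinity>"
    and F: "\<And>k::nat. integrable lborel (F k)" "\<And>k. N2 (F k) < \<infinity>"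
    and lim: "L2_lim F f'"
      "L2_lim (\<lambda>k \<xi>. fourier_const TYPE('n) * ft (F k) \<xi>) g"
    using assms(1) unfolding fourier_L2_def by blast
  note [measurable] = f' g
  have F_m [measurable]: "F k \<in> borel_measurable borel" for k using F(1)[of k] by auto
  have ft_m [measurable]: "ft (F k) \<in> borel_measurable borel" for k by (rule ft_measurable[OF F(1)])
  have fou: "fourier (F k) = (\<lambda>\<xi>. fourier_const TYPE('n) * ft (F k) \<xi>)" for k
    using fourier_borel_version[OF borel_lebesgueI[OF F_m] F_m] by (intro ext) simp
  have Nf: "N2 (\<lambda>\<xi>. fourier_const TYPE('n) * ft (F k) \<xi>) < \<infinity>" for k
    using N2_ft_finite[OF F] by (auto simp: N2_cmult ennreal_mult_less_top)
  have cm: "(\<lambda>\<xi>. fourier_const TYPE('n) * ft (F k) \<xi>) \<in> borel_measurable borel" for k by measurable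
  have "f \<in> Lp 2"
    using Lp_borel_version(1)[OF f(1) f' f(2), of 2] N(1) integrable_powr_2_iff[OF f'] by blast
  moreover have "g \<in> Lp 2" using Lp_borel(1)[OF g, of 2] N(2) integrable_powr_2_iff[OF g] by blast
  moreover have "F k \<in> Lp 1 \<inter> Lp 2" for k
    using Lp_borel(1)[OF F_m] F integrable_powr_2_iff[OF F_m] integrable_powr_1_iff[OF F_m] by blast
  moreover have "fourier (F k) \<in> Lp 2" for k
    unfolding fou using Lp_borel(1)[OF cm[of k], where p=2] integrable_powr_2_iff[OF cm[of k]] Nf[of k] by blast
  moreover have "(\<lambda>k. Lp_norm 2 (\<lambda>x. F k x - f x)) \<longlonglongrightarrow> 0"
    using Lp_norm_2_diff_tendsto_iff[where F=F and F'=F, OF borel_lebesgueI[OF F_m] F_m _ f(1) f' f(2) F(2) N(1)] lim(1) by simp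
  moreover have "(\<lambda>k. Lp_norm 2 (\<lambda>\<xi>. fourier (F k) \<xi> - g \<xi>)) \<longlonglongrightarrow> 0"
    unfolding fou
    by (subst Lp_norm_2_diff_tendsto_iff[OF borel_lebesgueI[OF cm] cm _ borel_lebesgueI[OF g] g _ Nf N(2)])
       (use lim(2) in simp_all)
  ultimately show ?thesis unfolding has_fourier_L2_def by blast
qed

lemma fourier_L2_diff:
  fixes f g h l :: "real^'n \<Rightarrow> complex"
  assumes "fourier_L2 f g" "fourier_L2 h l"
  shows "fourier_L2 (\<lambda>x. f x - h x) (\<lambda>\<xi>. g \<xi> - l \<xi>)"
proof -
  define c where "c = fourier_const TYPE('n)"
  obtain F G where [measurable]: "f \<in> borel_measurable borel" "g \<in> borel_measurable borel" "h \<in> borel_measurable borel" "l \<in> borel_measurable borel"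
    and N: "N2 f < \<infinity>" "N2 h < \<infinity>" "N2 g < \<infinity>" "N2 l < \<infinity>"
    and F: "\<And>k::nat. integrable lborel (F k)" "\<And>k. N2 (F k) < \<infinity>" "L2_lim F f"
      "L2_lim (\<lambda>k \<xi>. c * ft (F k) \<xi>) g"
    and G: "\<And>k::nat. integrable lborel (G k)" "\<And>k. N2 (G k) < \<infinity>" "L2_lim G h"
      "L2_lim (\<lambda>k \<xi>. c * ft (G k) \<xi>) l"
    using assms unfolding fourier_L2_def c_def[symmetric] by blast
  have [measurable]: "F k \<in> borel_measurable borel" "G k \<in> borel_measurable borel" for k
    using F(1)[of k] G(1)[of k] by auto
  note [measurable] = ft_measurable[OF F(1)] ft_measurable[OF G(1)]
  have ftd: "ft (\<lambda>x. F k x - G k x) \<xi> = ft (F k) \<xi> - ft (G k) \<xi>" for k \<xi>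
    unfolding ft_def right_diff_distrib by (rule Bochner_Integration.integral_diff) (use F G in auto)
  have "(\<lambda>k. N2 (\<lambda>x. (F k x - f x) - (G k x - h x))) \<longlonglongrightarrow> 0"
    "(\<lambda>k. N2 (\<lambda>\<xi>. (c * ft (F k) \<xi> - g \<xi>) - (c * ft (G k) \<xi> - l \<xi>))) \<longlonglongrightarrow> 0"
    by (intro N2_diff_tendsto F G; measurable)+
  then have "(\<lambda>k. N2 (\<lambda>x. (F k x - G k x) - (f x - h x))) \<longlonglongrightarrow> 0"
    "(\<lambda>k. N2 (\<lambda>\<xi>. c * ft (\<lambda>x. F k x - G k x) \<xi> - (g \<xi> - l \<xi>))) \<longlonglongrightarrow> 0"
    by (simp_all add: ftd algebra_simps)
  then show ?thesis
    unfolding fourier_L2_def c_def[symmetric] using F(1) G(1)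
    by (intro conjI exI[of _ "\<lambda>k x. F k x - G k x"] allI N2_diff_finite N F(2) G(2)) auto
qed

text \<open>Applied to a difference, the first part says that the transform is well defined, by
  \<open>ft_contraction\<close>, and the second that it is injective, by
  \<open>ft_L2_injective\<close>.\<close>

lemma fourier_L2_eq_0:
  fixes f g :: "real^'n \<Rightarrow> complex"
  assumes "fourier_L2 f g"
  shows "AE x in lborel. f x = 0 \<Longrightarrow> AE \<xi> in lborel. g \<xi> = 0" (is "_ \<Longrightarrow> ?g")
    and "AE \<xi> in lborel. g \<xi> = 0 \<Longrightarrow> AE x in lborel. f x = 0" (is "_ \<Longrightarrow> ?f")
proof -
  define c where "c = fourier_const TYPE('n)"
  have c: "c \<noteq> 0" by (simp add: c_def)
  obtain F where [measurable]: "f \<in> borel_measurable borel" "g \<in> borel_measurable borel"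
    and N: "N2 f < \<infinity>"
    and F: "\<And>k::nat. integrable lborel (F k)" "L2_lim F f"
      "L2_lim (\<lambda>k \<xi>. c * ft (F k) \<xi>) g"
    using assms unfolding fourier_L2_def c_def[symmetric] by blast
  note [measurable] = ft_measurable[OF F(1)]
  {
    assume f0: "AE x in lborel. f x = 0"
    have "N2 (\<lambda>x. F k x - f x) = N2 (F k)" for k
      by (rule N2_cong_AE, use f0 in eventually_elim) simp
    then have F0: "(\<lambda>k. N2 (F k)) \<longlonglongrightarrow> 0" using F(2) by simp
    have "(\<lambda>k. N2 (ft (F k))) \<longlonglongrightarrow> 0"
      by (rule ennreal_tendsto_0_le[OF ft_contraction[OF F(1)]])
         (use ennreal_tendsto_cmult[OF _ F0, of "ennreal ((2 * pi) ^ DIM(real^'n))"] in simp)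
    then have "(\<lambda>k. N2 (\<lambda>\<xi>. c * ft (F k) \<xi>)) \<longlonglongrightarrow> 0"
      by (rule N2_cmult_tendsto[rotated]) measurable
    from N2_diff_tendsto[OF _ _ this F(3)] have "(\<lambda>k::nat. N2 g) \<longlonglongrightarrow> 0" by simp
    then have "N2 g = 0" by (simp add: LIMSEQ_const_iff)
    then have "AE \<xi> in lborel. ennreal ((norm (g \<xi>))\<^sup>2) = 0"
      unfolding N2_def by (subst (asm) nn_integral_0_iff_AE) auto
    then show ?g by eventually_elim simp
  next
    assume g0: "AE \<xi> in lborel. g \<xi> = 0"
    have "N2 (\<lambda>\<xi>. c * ft (F k) \<xi> - g \<xi>) = N2 (\<lambda>\<xi>. c * ft (F k) \<xi>)" for k
      by (rule N2_cong_AE, use g0 in eventually_elim) simp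
    then have "(\<lambda>k. N2 (\<lambda>\<xi>. c * ft (F k) \<xi>)) \<longlonglongrightarrow> 0" using F(3) by simp
    then have "(\<lambda>k. N2 (\<lambda>\<xi>. inverse c * (c * ft (F k) \<xi>))) \<longlonglongrightarrow> 0"
      by (rule N2_cmult_tendsto[rotated]) measurable
    moreover have "inverse c * (c * z) = z" for z
      using c by (metis mult.assoc mult_1 left_inverse)
    ultimately have "(\<lambda>k. N2 (ft (F k))) \<longlonglongrightarrow> 0" by (simp only:)
    then show ?f by (rule ft_L2_injective[OF F(1,2)]) (use N in simp_all)
  }
qed

section \<open>The operator as a convolution\<close>

text \<open>The kernel is the inverse Fourier integral of m. Since m is real and even, the kernel is
  real, so the fixed point can be sought among real functions, on which V is defined.\<close>

lemma ft_kernel_exists: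
  fixes m :: "'a::euclidean_space \<Rightarrow> real"
  assumes cont: "continuous_on UNIV m" and bdd: "\<And>\<xi>. \<bar>m \<xi>\<bar> \<le> B0" and even: "\<And>\<xi>. m (- \<xi>) = m \<xi>"
    and i: "integrable lborel (\<lambda>\<xi>. complex_of_real (m \<xi>))"
    and fi: "integrable lborel (ft (\<lambda>\<xi>. complex_of_real (m \<xi>)))"
  obtains k :: "'a \<Rightarrow> real" and B where
    "continuous_on UNIV k" "\<And>x. \<bar>k x\<bar> \<le> B"
    "integrable lborel (\<lambda>x. complex_of_real (k x))"
    "\<And>\<xi>. ft (\<lambda>x. complex_of_real (k x)) \<xi> = of_real (m \<xi>)"
proof -
  let ?m = "\<lambda>\<xi>. complex_of_real (m \<xi>)"
  \<comment> \<open>The reciprocal of the constant in \<open>ft_inversion\<close>.\<close>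
  define c where "c = 1 / (2 * pi) ^ DIM('a)"
  have c: "c > 0" by (simp add: c_def)
  define k where "k x = c * Re (ft ?m (- x))" for x
  have mm: "?m \<in> borel_measurable borel" using i by auto
  have fm: "ft ?m \<in> borel_measurable borel" by (rule ft_measurable[OF i])
  have "cnj (ft ?m x) = ft ?m x" for x
  proof -
    have "cnj (ft ?m x) = (LBINT \<xi>. cnj (cis (- (\<xi> \<bullet> x)) * ?m \<xi>))"
      unfolding ft_def by (rule Bochner_Integration.integral_cnj[symmetric])
    also have "\<dots> = (LBINT \<xi>. cis (- ((0 - \<xi>) \<bullet> x)) * ?m (0 - \<xi>))"
      by (simp add: cis_cnj even)
    also have "\<dots> = ft ?m x"
      unfolding ft_def by (rule lborel_integral_reflect) (use mm in measurable)
    finally show ?thesis .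
  qed
  then have real: "ft ?m x \<in> \<real>" for x by (simp add: Reals_cnj_iff)
  have k: "complex_of_real (k x) = of_real c * ft ?m (- x)" for x
    using real[of "- x"] by (simp add: k_def of_real_Re)
  have ki: "integrable lborel (\<lambda>x. complex_of_real (k x))"
    unfolding k using integrable_reflect[OF fi, of 0] by (intro integrable_mult_right) simp
  have fk: "ft (\<lambda>x. complex_of_real (k x)) \<xi> = of_real (m \<xi>)" for \<xi>
  proof -
    have "ft (\<lambda>x. complex_of_real (k x)) \<xi> = (LBINT x. of_real c * (cis (- (x \<bullet> \<xi>)) * ft ?m (- x)))"
      unfolding ft_def k by (simp add: ft_def mult.left_commute)
    also have "\<dots> = of_real c * (LBINT x. cis ((0 - x) \<bullet> \<xi>) * ft ?m (0 - x))"
      by (subst integral_mult_right_zero) simp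
    also have "(LBINT x. cis ((0 - x) \<bullet> \<xi>) * ft ?m (0 - x)) = (LBINT x. cis (x \<bullet> \<xi>) * ft ?m x)"
      by (rule lborel_integral_reflect) (use fm in measurable)
    also have "\<dots> = (LBINT x. ft ?m x * cis (x \<bullet> \<xi>))" by (simp add: mult.commute)
    also have "\<dots> = of_real ((2 * pi) ^ DIM('a)) * ?m \<xi>"
      by (rule ft_inversion[OF i fi, of B0]) (use cont bdd in \<open>auto intro!: continuous_intros\<close>)
    finally show ?thesis by (simp add: c_def)
  qed
  have kc: "continuous_on UNIV k"
    unfolding k_def by (intro continuous_intros continuous_on_compose2[OF continuous_on_ft[OF i, of UNIV]]) auto
  have "\<bar>k x\<bar> \<le> c * (LBINT \<xi>. norm (?m \<xi>))" for x
  proof -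
    have "\<bar>k x\<bar> = norm (complex_of_real (k x))" by simp
    also have "\<dots> = c * norm (ft ?m (- x))" unfolding k using c by (simp add: norm_mult)
    also have "\<dots> \<le> c * (LBINT \<xi>. norm (?m \<xi>))" using c by (intro mult_left_mono norm_ft_le i) auto
    finally show ?thesis .
  qed
  from that[OF kc this ki fk] show thesis .
qed

text \<open>
  \<open>conv\<close> integrates over \<open>lborel\<close> and may return the junk value \<open>0\<close> if \<open>f\<close> is not Borel
  measurable; the operator on \<open>L\<^sup>p\<close> must accept Lebesgue measurable functions.
\<close>

definition conv_lebesgue :: "('a::euclidean_space \<Rightarrow> complex) \<Rightarrow> ('a \<Rightarrow> complex) \<Rightarrow> 'a \<Rightarrow> complex" where
  "conv_lebesgue K f x = (LINT y|lebesgue. K (x - y) * f y)"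

lemma conv_lebesgue_eq:
  assumes K: "K \<in> borel_measurable borel" and f: "f \<in> borel_measurable lebesgue"
    and [measurable]: "f' \<in> borel_measurable borel" and ae: "AE x in lebesgue. f x = f' x"
  shows "conv_lebesgue K f = conv K f'"
proof
  fix x
  note [measurable] = K
  have "(\<lambda>y. K (x - y)) \<in> borel_measurable lebesgue" by (rule borel_lebesgueI) measurable
  then have m: "(\<lambda>y. K (x - y) * f y) \<in> borel_measurable lebesgue" using f by (rule borel_measurable_times)
  have ae': "AE y in lebesgue. K (x - y) * f y = K (x - y) * f' y"
    using ae by eventually_elim simp
  show "conv_lebesgue K f x = conv K f' x"
    unfolding conv_lebesgue_def conv_def by (rule integral_lebesgue_borel_version(2)[OF m _ ae']) measurable
qed

context conv_kernel
begin

lemma conv_N2: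
  obtains C where "\<And>f. f \<in> borel_measurable borel \<Longrightarrow> N2 f < \<infinity> \<Longrightarrow> N2 (conv K f) \<le> ennreal C * N2 f"
proof -
  obtain C where "C \<ge> 0" and C: "Lp_bound 2 (conv K) C"
    using conv_Lp[of 2] by auto
  have "N2 (conv K f) \<le> ennreal C * N2 f" if f: "f \<in> borel_measurable borel" "N2 f < \<infinity>" for f
  proof -
    have fi: "Lp_int 2 f" using f integrable_powr_2_iff by blast
    have cm: "conv K f \<in> borel_measurable borel" using f by (intro conv_measurable) auto
    then have "N2 (conv K f) < \<infinity>" using C[rule_format, OF f(1) fi] integrable_powr_2_iff by blast
    from N2_eq_integral[OF cm this] have "N2 (conv K f) \<le> ennreal (C * Lp_pow 2 f)"
      using C[rule_format, OF f(1) fi] by (auto intro!: ennreal_leI)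
    also have "\<dots> = ennreal C * N2 f"
      unfolding N2_eq_integral[OF f] using \<open>C \<ge> 0\<close> by (intro ennreal_mult) auto
    finally show ?thesis .
  qed
  then show ?thesis using that by blast
qed

lemma conv_linear:
  assumes "1 \<le> p" "f \<in> borel_measurable borel" "Lp_int p f"
    and "g \<in> borel_measurable borel" "Lp_int p g"
  shows "conv K (\<lambda>x. c * f x + d * g x) x = c * conv K f x + d * conv K g x"
proof -
  note i = integrable_conv_kernel(2)[OF assms(1-3), of x] integrable_conv_kernel(2)[OF assms(1,4-5), of x]
  have "conv K (\<lambda>x. c * f x + d * g x) x = (LBINT y. c * (K (x - y) * f y) + d * (K (x - y) * g y))"
    unfolding conv_def by (simp add: ring_distribs mult.left_commute)
  also have "\<dots> = (LBINT y. c * (K (x - y) * f y)) + (LBINT y. d * (K (x - y) * g y))"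
    by (intro Bochner_Integration.integral_add integrable_mult_right i)
  also have "\<dots> = c * conv K f x + d * conv K g x"
    unfolding conv_def integral_mult_right_zero ..
  finally show ?thesis .
qed

end

lemma conv_lebesgue_bounded_Lp_operator:
  fixes K :: "real^'n \<Rightarrow> complex"
  assumes "conv_kernel K B" and p: "1 \<le> p"
  shows "bounded_Lp_operator p (conv_lebesgue K)"
proof -
  interpret conv_kernel K B by fact
  obtain C where C0: "C \<ge> 0" and C: "Lp_bound p (conv K) C"
    using conv_Lp[OF p] by blast
  have fm: "f \<in> borel_measurable lebesgue" if "f \<in> Lp p" for f :: "real^'n \<Rightarrow> complex"
    using that by (simp add: Lp_def)
  have "\<exists>f'. f' \<in> borel_measurable borel \<and> (AE x in lebesgue. f x = f' x)" if "f \<in> Lp p" for f :: "real^'n \<Rightarrow> complex"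
    using lebesgue_borel_version[OF fm[OF that]] by blast
  \<comment> \<open>A choice of Borel versions; \<open>conv_lebesgue\<close> does not depend on it,
    because it only sees almost everywhere classes.\<close>
  then obtain v where v: "\<And>f :: real^'n \<Rightarrow> complex. f \<in> Lp p \<Longrightarrow> v f \<in> borel_measurable borel"
    "\<And>f. f \<in> Lp p \<Longrightarrow> AE x in lebesgue. f x = v f x"
    by metis
  have vi: "Lp_int p (v f)" if "f \<in> Lp p" for f
    using Lp_borel_version(1)[OF fm v, of f p] that by blast
  have vc: "conv_lebesgue K f = conv K (v f)" if "f \<in> Lp p" for f
    by (rule conv_lebesgue_eq[OF K_measurable fm v]) (rule that)+
  note cm = conv_measurable[OF K_measurable v(1)]
  show ?thesis unfolding bounded_Lp_operator_def
  proof (intro conjI ballI allI exI)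
    fix f :: "real^'n \<Rightarrow> complex" assume f: "f \<in> Lp p"
    show "conv_lebesgue K f \<in> Lp p"
      unfolding vc[OF f] using Lp_borel(1)[OF cm[OF f], of p] C v(1)[OF f] vi[OF f] by blast
    have "Lp_norm p (conv_lebesgue K f) = Lp_pow p (conv K (v f)) powr (1 / p)"
      unfolding vc[OF f] by (rule Lp_borel(2)[OF cm[OF f]])
    also have "\<dots> \<le> (C * Lp_pow p (v f)) powr (1 / p)"
      using C[rule_format, OF v(1)[OF f] vi[OF f]] p by (intro powr_mono2) auto
    \<comment> \<open>The constant C bounds p-th powers of norms, hence the root.\<close>
    also have "\<dots> = C powr (1 / p) * Lp_norm p f"
      unfolding Lp_borel_version(2)[OF fm v, OF f f f] using C0 by (intro powr_mult)
    finally show "Lp_norm p (conv_lebesgue K f) \<le> C powr (1 / p) * Lp_norm p f" .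
  next
    fix f g :: "real^'n \<Rightarrow> complex" and c d assume f: "f \<in> Lp p" and g: "g \<in> Lp p"
    note [measurable] = v(1)[OF f] v(1)[OF g] fm[OF f] fm[OF g]
    have "AE x in lebesgue. c * f x + d * g x = c * v f x + d * v g x"
      using v(2)[OF f] v(2)[OF g] by eventually_elim simp
    then have "conv_lebesgue K (\<lambda>x. c * f x + d * g x) = conv K (\<lambda>x. c * v f x + d * v g x)"
      by (intro conv_lebesgue_eq K_measurable) (simp_all add: fm[OF f] fm[OF g])
    then show "AE x in lebesgue. conv_lebesgue K (\<lambda>x. c * f x + d * g x) x = c * conv_lebesgue K f x + d * conv_lebesgue K g x"
      unfolding vc[OF f] vc[OF g] using conv_linear[OF p v(1)[OF f] vi[OF f] v(1)[OF g] vi[OF g]] by simp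
  qed
qed

text \<open>For integrable approximants F k of f this is the convolution theorem. The limit is
  controlled on the function side by the L2 bound of the convolution and on the Fourier side by |ft
  K| \<le> 1.\<close>

lemma conv_fourier_L2:
  fixes K f :: "real^'n \<Rightarrow> complex"
  assumes "conv_kernel K B"
    and m1: "\<And>\<xi>. norm (ft K \<xi>) \<le> 1"
    and f: "f \<in> borel_measurable borel" "N2 f < \<infinity>"
  obtains g where "fourier_L2 f g" "fourier_L2 (conv K f) (\<lambda>\<xi>. ft K \<xi> * g \<xi>)"
proof -
  interpret conv_kernel K B by fact
  define c where "c = fourier_const TYPE('n)"
  obtain C where C: "\<And>f. f \<in> borel_measurable borel \<Longrightarrow> N2 f < \<infinity> \<Longrightarrow> N2 (conv K f) \<le> ennreal C * N2 f"
    using conv_N2 by blast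
  have Cfin: "N2 (conv K f) < \<infinity>" if "f \<in> borel_measurable borel" "N2 f < \<infinity>" for f
    using order.strict_trans1[OF C[OF that]] that by (simp add: ennreal_mult_less_top)
  obtain F g0 where F: "\<And>k::nat. integrable lborel (F k)" "\<And>k. N2 (F k) < \<infinity>"
    "L2_lim F f"
    and g0: "g0 \<in> borel_measurable borel" "(\<lambda>k. N2 (\<lambda>x. ft (F k) x - g0 x)) \<longlonglongrightarrow> 0"
    using L2_fourier_exists[OF f] by blast
  have Fm: "F k \<in> borel_measurable borel" for k using F(1)[of k] by auto
  note [measurable] = f(1) g0(1) Fm ft_measurable[OF F(1)] ft_measurable[OF K]
  define g where "g \<xi> = c * g0 \<xi>" for \<xi>
  have [measurable]: "g \<in> borel_measurable borel" unfolding g_def[abs_def] by measurable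
  \<comment> \<open>A single k with \<open>ft (F k)\<close> at squared distance less than 1 from g0
    suffices.\<close>
  have g0fin: "N2 g0 < \<infinity>"
  proof -
    obtain k where k: "N2 (\<lambda>x. ft (F k) x - g0 x) < 1"
      using order_tendstoD(2)[OF g0(2), of 1] by (auto simp: eventually_sequentially)
    have k': "N2 (\<lambda>x. ft (F k) x - g0 x) < \<infinity>"
      using k by (rule order.strict_trans) simp
    have "N2 (\<lambda>x. ft (F k) x - (ft (F k) x - g0 x)) < \<infinity>"
      by (rule N2_diff_finite[OF _ _ N2_ft_finite[OF F(1,2)] k']) measurable
    then show ?thesis by simp
  qed
  then have gfin: "N2 g < \<infinity>"
    unfolding g_def by (simp add: N2_cmult ennreal_mult_less_top)
  have "(\<lambda>k. N2 (\<lambda>\<xi>. c * (ft (F k) \<xi> - g0 \<xi>))) \<longlonglongrightarrow> 0"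
    using g0(2) by (intro N2_cmult_tendsto) auto
  then have lim: "L2_lim (\<lambda>k \<xi>. c * ft (F k) \<xi>) g"
    by (simp add: g_def right_diff_distrib)
  have 1: "fourier_L2 f g"
    unfolding fourier_L2_def c_def[symmetric]
    by (intro conjI exI[of _ F] allI f F lim gfin) measurable
  have N2_mult: "N2 (\<lambda>\<xi>. ft K \<xi> * h \<xi>) \<le> N2 h" for h
    unfolding N2_def
  proof (intro nn_integral_mono ennreal_leI power_mono)
    fix \<xi> show "norm (ft K \<xi> * h \<xi>) \<le> norm (h \<xi>)"
      using mult_right_mono[OF m1[of \<xi>] norm_ge_zero[of "h \<xi>"]] by (simp add: norm_mult)
  qed simp
  have cm: "conv K h \<in> borel_measurable borel" if "h \<in> borel_measurable borel" for h
    using K_measurable that by (rule conv_measurable)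
  have lim1: "(\<lambda>k. N2 (\<lambda>x. conv K (F k) x - conv K f x)) \<longlonglongrightarrow> 0"
  proof (rule ennreal_tendsto_0_le)
    show "(\<lambda>k. ennreal C * N2 (\<lambda>x. F k x - f x)) \<longlonglongrightarrow> 0"
      using ennreal_tendsto_cmult[OF _ F(3), of "ennreal C"] by simp
    fix k
    have "conv K (F k) x - conv K f x = conv K (\<lambda>x. F k x - f x) x" for x
      using conv_linear[OF _ Fm _ f(1), of 2 k 1 "-1" x] F(2)[of k] f(2)
        integrable_powr_2_iff[OF Fm] integrable_powr_2_iff[OF f(1)] by simp
    then show "N2 (\<lambda>x. conv K (F k) x - conv K f x) \<le> ennreal C * N2 (\<lambda>x. F k x - f x)"
      using C[of "\<lambda>x. F k x - f x"] N2_diff_finite[OF Fm f(1) F(2) f(2)] by simp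
  qed
  have lim2: "(\<lambda>k. N2 (\<lambda>\<xi>. c * ft (conv K (F k)) \<xi> - ft K \<xi> * g \<xi>)) \<longlonglongrightarrow> 0"
  proof (rule ennreal_tendsto_0_le[OF _ lim])
    fix k
    have "c * ft (conv K (F k)) \<xi> - ft K \<xi> * g \<xi> = ft K \<xi> * (c * ft (F k) \<xi> - g \<xi>)" for \<xi>
      by (simp add: ft_conv[OF K F(1)] right_diff_distrib mult.left_commute)
    then show "N2 (\<lambda>\<xi>. c * ft (conv K (F k)) \<xi> - ft K \<xi> * g \<xi>) \<le> N2 (\<lambda>\<xi>. c * ft (F k) \<xi> - g \<xi>)"
      using N2_mult by simp
  qed
  have "N2 (\<lambda>\<xi>. ft K \<xi> * g \<xi>) < \<infinity>" using N2_mult[of g] gfin by (rule order.strict_trans1)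
  moreover have "integrable lborel (conv K (F k)) \<and> N2 (conv K (F k)) < \<infinity>" for k
    using conv_integrable[OF K F(1)] Cfin[OF Fm F(2)] by blast
  moreover have "(\<lambda>\<xi>. ft K \<xi> * g \<xi>) \<in> borel_measurable borel" by measurable
  ultimately have "fourier_L2 (conv K f) (\<lambda>\<xi>. ft K \<xi> * g \<xi>)"
    unfolding fourier_L2_def c_def[symmetric]
    by (intro conjI exI[of _ "\<lambda>k. conv K (F k)"] allI cm[OF f(1)] Cfin[OF f] lim1 lim2) simp_all
  with 1 show thesis by (rule that)
qed

text \<open>The convolution satisfies the property behind \<open>SOME\<close>, so the chosen
  operator satisfies it too. For f in L2 \<inter> Lp that property prescribes the transform of
  \<open>T_op a s p f\<close>, and injectivity identifies it with the convolution.\<close>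

lemma T_op_eq_conv:
  fixes K :: "real^'n \<Rightarrow> complex" and a :: "real \<Rightarrow> real"
  assumes "conv_kernel K B" and p: "1 \<le> p"
    and m1: "\<And>\<xi>::real^'n. norm (multiplier a s \<xi>) \<le> 1"
    and ftK: "\<And>\<xi>. ft K \<xi> = multiplier a s \<xi>"
    and f: "f \<in> borel_measurable borel" "f \<in> Lp 2" "f \<in> Lp p"
  shows "AE x in lebesgue. T_op a s p f x = conv K f x"
proof -
  interpret conv_kernel K B by fact
  have mm: "(multiplier a s :: real^'n \<Rightarrow> complex) \<in> borel_measurable borel"
    using ft_measurable[OF K] ftK by (simp cong: measurable_cong)
  have mult_eq: "(\<lambda>\<xi>. of_real ((1 + a ((norm \<xi>)\<^sup>2)) powr (- s / 2)) * g \<xi>) = (\<lambda>\<xi>. multiplier a s \<xi> * g \<xi>)" for g :: "real^'n \<Rightarrow> complex"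
    by (simp add: multiplier_def)
  have m1': "norm (ft K \<xi>) \<le> 1" for \<xi> using m1 ftK by simp
  have "extends_multiplier a s p (conv_lebesgue K)"
    unfolding extends_multiplier_def mult_eq
  proof (intro ballI)
    fix f :: "real^'n \<Rightarrow> complex" assume f: "f \<in> Lp 2 \<inter> Lp p"
    then have fm: "f \<in> borel_measurable lebesgue" by (simp add: Lp_def)
    obtain f' where f': "f' \<in> borel_measurable borel" "AE x in lebesgue. f x = f' x"
      using lebesgue_borel_version[OF fm] .
    have "N2 f' < \<infinity>"
      using Lp_borel_version(1)[OF fm f', of 2] f integrable_powr_2_iff[OF f'(1)] by blast
    then obtain g where g: "fourier_L2 f' g" "fourier_L2 (conv K f') (\<lambda>\<xi>. ft K \<xi> * g \<xi>)"
      using conv_fourier_L2[OF assms(1) m1' f'(1)] by blast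
    have "has_fourier_L2 f g" by (rule fourier_L2D[OF g(1) fm f'(2)])
    moreover have "has_fourier_L2 (conv_lebesgue K f) (\<lambda>\<xi>. multiplier a s \<xi> * g \<xi>)"
      unfolding conv_lebesgue_eq[OF K_measurable fm f'] ftK[symmetric]
      by (rule fourier_L2D[OF g(2)]) (auto intro!: borel_lebesgueI conv_measurable K_measurable f')
    ultimately show "\<exists>g. has_fourier_L2 f g \<and> has_fourier_L2 (conv_lebesgue K f) (\<lambda>\<xi>. multiplier a s \<xi> * g \<xi>)"
      by blast
  qed
  with conv_lebesgue_bounded_Lp_operator[OF assms(1) p]
  have ex: "bounded_Lp_operator p (conv_lebesgue K) \<and> extends_multiplier a s p (conv_lebesgue K)" ..
  have "extends_multiplier a s p (T_op a s p :: (real^'n \<Rightarrow> complex) \<Rightarrow> _)"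
    unfolding T_op_def
    by (rule someI[where P="\<lambda>T. bounded_Lp_operator p T \<and> extends_multiplier a s p T", OF ex, THEN conjunct2])
  then obtain g where g: "has_fourier_L2 f g" "has_fourier_L2 (T_op a s p f) (\<lambda>\<xi>. multiplier a s \<xi> * g \<xi>)"
    unfolding extends_multiplier_def mult_eq using f by blast
  have gm: "g \<in> borel_measurable lebesgue" and Tm: "T_op a s p f \<in> borel_measurable lebesgue"
    using g unfolding has_fourier_L2_def by (auto simp: Lp_def)
  obtain g' where g': "g' \<in> borel_measurable borel" "AE x in lebesgue. g x = g' x"
    using lebesgue_borel_version[OF gm] .
  obtain t where t: "t \<in> borel_measurable borel" "AE x in lebesgue. T_op a s p f x = t x"
    using lebesgue_borel_version[OF Tm] .
  have fg: "fourier_L2 f g'" by (rule fourier_L2I[OF g(1) f(1) _ g']) simp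
  have tg: "fourier_L2 t (\<lambda>\<xi>. multiplier a s \<xi> * g' \<xi>)"
  proof (rule fourier_L2I[OF g(2) t])
    show "(\<lambda>\<xi>. multiplier a s \<xi> * g' \<xi>) \<in> borel_measurable borel" using mm g'(1) by measurable
    show "AE \<xi> in lebesgue. multiplier a s \<xi> * g \<xi> = multiplier a s \<xi> * g' \<xi>"
      using g'(2) by eventually_elim simp
  qed
  have "N2 f < \<infinity>" using Lp_borel(1)[OF f(1), of 2] f(2) integrable_powr_2_iff[OF f(1)] by blast
  then obtain h where h: "fourier_L2 f h" "fourier_L2 (conv K f) (\<lambda>\<xi>. ft K \<xi> * h \<xi>)"
    using conv_fourier_L2[OF assms(1) m1' f(1)] by blast
  \<comment> \<open>The transforms of f supplied with the chosen operator and with the convolution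
    come from separate existential statements and must be matched first.\<close>
  have "AE \<xi> in lborel. g' \<xi> - h \<xi> = 0"
    by (rule fourier_L2_eq_0(1)[OF fourier_L2_diff[OF fg h(1)]]) simp
  then have "AE \<xi> in lborel. multiplier a s \<xi> * g' \<xi> - ft K \<xi> * h \<xi> = 0"
    by eventually_elim (simp add: ftK)
  then have "AE x in lborel. t x - conv K f x = 0" by (rule fourier_L2_eq_0(2)[OF fourier_L2_diff[OF tg h(2)]])
  then have "AE x in lborel. t x = conv K f x" by simp
  then have "AE x in lebesgue. t x = conv K f x" by (rule AE_completion)
  with t(2) show ?thesis by eventually_elim simp
qed

section \<open>The nonlinear equation\<close>

lemma bounded_compact_support_Lp:
  assumes g: "continuous_on UNIV g" and S: "compact S" "\<And>x. x \<notin> S \<Longrightarrow> g x = 0" and p: "p > 0"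
  shows "integrable lborel (\<lambda>x. norm (complex_of_real (g x)) powr p)" and "integrable lborel g"
proof -
  have [measurable]: "g \<in> borel_measurable borel" using g by (rule borel_measurable_continuous_onI)
  have "bounded (g ` S)" using compact_continuous_image[OF continuous_on_subset[OF g subset_UNIV] S(1)] by (rule compact_imp_bounded)
  then obtain M where M': "\<forall>y\<in>g ` S. norm y \<le> M" unfolding bounded_iff by blast
  have M: "\<bar>g x\<bar> \<le> \<bar>M\<bar> * indicator S x" for x
    using M' S(2)[of x] by (cases "x \<in> S") (auto intro: order.trans)
  have Sm [measurable]: "S \<in> sets borel" using S(1) by (rule borel_compact)
  have fin: "emeasure lborel S < \<infinity>" using emeasure_compact_finite[OF S(1)] by simp
  have ind: "integrable lborel (indicator S :: 'a \<Rightarrow> real)"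
    using fin by (simp add: integrable_indicator_iff)
  show "integrable lborel g"
    by (rule Bochner_Integration.integrable_bound[OF integrable_mult_right[OF ind, of "\<bar>M\<bar>"]])
       (use M in \<open>auto simp: abs_mult\<close>)
  have le: "\<bar>g x\<bar> powr p \<le> \<bar>M\<bar> powr p * indicator S x" for x
  proof (cases "x \<in> S")
    case True
    then show ?thesis using powr_mono2[of p "\<bar>g x\<bar>" "\<bar>M\<bar>"] M[of x] p by simp
  qed (use S(2) p in simp)
  show "integrable lborel (\<lambda>x. norm (complex_of_real (g x)) powr p)"
    by (rule Bochner_Integration.integrable_bound[OF integrable_mult_right[OF ind, of "\<bar>M\<bar> powr p"]])
       (use le in auto)
qed

definition rconv :: "('a::euclidean_space \<Rightarrow> real) \<Rightarrow> ('a \<Rightarrow> real) \<Rightarrow> 'a \<Rightarrow> real" where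
  "rconv k g x = (LBINT y. k (x - y) * g y)"

lemma conv_of_real:
  "conv (\<lambda>x. complex_of_real (k x)) (\<lambda>x. complex_of_real (g x)) x = complex_of_real (rconv k g x)"
  unfolding conv_def rconv_def by (simp flip: of_real_mult)

lemma rconv_integrable:
  fixes k g :: "'a::euclidean_space \<Rightarrow> real"
  assumes k: "k \<in> borel_measurable borel" "\<And>x. \<bar>k x\<bar> \<le> B" and g: "integrable lborel g"
  shows "integrable lborel (\<lambda>y. k (x - y) * g y)"
proof (rule Bochner_Integration.integrable_bound[OF integrable_mult_right[OF g, of B]])
  have [measurable]: "k \<in> borel_measurable borel" "g \<in> borel_measurable borel" using k g by auto
  show "(\<lambda>y. k (x - y) * g y) \<in> borel_measurable lborel" by measurable
  show "AE y in lborel. norm (k (x - y) * g y) \<le> norm (B * g y)"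
    using k(2) by (auto simp: abs_mult intro!: AE_I2 mult_right_mono order.trans[OF k(2) abs_ge_self])
qed

text \<open>An L1 function convolved with a bounded kernel is bounded; this estimate is what makes
  the sup norm usable for the fixed point.\<close>

lemma rconv_le:
  assumes k: "k \<in> borel_measurable borel" "\<And>x. \<bar>k x\<bar> \<le> B"
    and w: "integrable lborel w" "\<And>y. \<bar>g y\<bar> \<le> w y" and g: "g \<in> borel_measurable borel"
  shows "\<bar>rconv k g x\<bar> \<le> B * (LBINT y. w y)"
proof -
  have gi: "integrable lborel g"
    by (rule Bochner_Integration.integrable_bound[OF w(1)]) (use g w(2) in \<open>auto intro!: AE_I2 order.trans[OF w(2) abs_ge_self]\<close>)
  have B0: "B \<ge> 0" using k(2)[of 0] abs_ge_zero order.trans by blast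
  have "\<bar>rconv k g x\<bar> \<le> (LBINT y. norm (k (x - y) * g y))"
    unfolding rconv_def real_norm_def[symmetric] by (rule integral_norm_bound)
  also have "\<dots> \<le> (LBINT y. B * w y)"
  proof (rule integral_mono)
    show "integrable lborel (\<lambda>y. norm (k (x - y) * g y))"
      by (intro integrable_norm rconv_integrable[OF k gi])
    show "norm (k (x - y) * g y) \<le> B * w y" for y
      unfolding real_norm_def abs_mult by (intro mult_mono k w B0) auto
  qed (intro integrable_mult_right w)
  finally show ?thesis by simp
qed

lemma rconv_continuous:
  assumes k: "continuous_on UNIV k" "\<And>x. \<bar>k x\<bar> \<le> B" and g: "integrable lborel g"
  shows "continuous_on UNIV (rconv k g)"
proof (rule continuous_on_sequentiallyI)
  fix u and a :: 'a
  assume u: "u \<longlonglongrightarrow> a"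
  have km: "k \<in> borel_measurable borel" using k(1) by (rule borel_measurable_continuous_onI)
  show "(\<lambda>i. rconv k g (u i)) \<longlonglongrightarrow> rconv k g a"
    unfolding rconv_def
  proof (rule integral_dominated_convergence[where w="\<lambda>y. B * norm (g y)"])
    show "AE y in lborel. (\<lambda>i. k (u i - y) * g y) \<longlonglongrightarrow> k (a - y) * g y"
    proof (intro AE_I2 tendsto_mult tendsto_const)
      fix y
      have "(\<lambda>i. u i - y) \<longlonglongrightarrow> a - y" by (intro tendsto_diff u tendsto_const)
      then show "(\<lambda>i. k (u i - y)) \<longlonglongrightarrow> k (a - y)"
        using continuous_on_tendsto_compose[OF k(1)] by simp
    qed
    show "AE y in lborel. norm (k (u i - y) * g y) \<le> B * norm (g y)" for i
      unfolding norm_mult by (intro AE_I2 mult_right_mono) (auto simp: k)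
    show "integrable lborel (\<lambda>y. B * norm (g y))" using g by (intro integrable_mult_right integrable_norm)
    show "(\<lambda>y. k (a - y) * g y) \<in> borel_measurable lborel"
      by (rule borel_measurable_integrable[OF rconv_integrable[OF km k(2) g]])
    show "(\<lambda>y. k (u i - y) * g y) \<in> borel_measurable lborel" for i
      by (rule borel_measurable_integrable[OF rconv_integrable[OF km k(2) g]])
  qed
qed

text \<open>Banach's theorem in the closed unit ball of the bounded continuous functions. The same
  weight w bounds G and its Lipschitz constant in y, so one smallness condition on \<delta> gives
  both invariance of the ball and contraction by 1/2.\<close>

lemma convolution_fixed_point:
  assumes k: "continuous_on UNIV k" "\<And>x. \<bar>k x\<bar> \<le> B"
    and G: "continuous_on UNIV (\<lambda>(x, y). G x y)"
    and w: "integrable lborel w" "\<And>x y. \<bar>y\<bar> \<le> 1 \<Longrightarrow> \<bar>G x y\<bar> \<le> w x"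
      "\<And>x y z. \<bar>y\<bar> \<le> 1 \<Longrightarrow> \<bar>z\<bar> \<le> 1 \<Longrightarrow> \<bar>G x y - G x z\<bar> \<le> w x * \<bar>y - z\<bar>"
    and small: "\<delta> > 0" "\<delta> * (B * (LBINT x. w x)) \<le> 1 / 2"
  obtains u where "continuous_on UNIV u" "\<And>x. \<bar>u x\<bar> \<le> 1" "\<And>x. u x = rconv k (\<lambda>y. \<delta> * G y (u y)) x"
proof -
  define D where "D = B * (LBINT x. w x)"
  have km: "k \<in> borel_measurable borel" using k(1) by (rule borel_measurable_continuous_onI)
  define S where "S = cball (0 :: 'a \<Rightarrow>\<^sub>C real) 1"
  define \<Phi> where "\<Phi> u x = rconv k (\<lambda>y. \<delta> * G y (apply_bcontfun u y)) x" for u :: "'a \<Rightarrow>\<^sub>C real" and x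
  have u1: "\<bar>apply_bcontfun u y\<bar> \<le> 1" if "u \<in> S" for u y
    using that norm_bounded[of u y] by (simp add: S_def)
  have Gc: "continuous_on UNIV (\<lambda>y. G y (apply_bcontfun u y))" for u
    using continuous_on_compose2[OF G, of UNIV "\<lambda>y. (y, apply_bcontfun u y)"]
    by (simp add: continuous_on_Pair)
  have Gm [measurable]: "(\<lambda>y. G y (apply_bcontfun u y)) \<in> borel_measurable borel" for u
    by (rule borel_measurable_continuous_onI[OF Gc])
  have Gi: "integrable lborel (\<lambda>y. G y (apply_bcontfun u y))" if "u \<in> S" for u
    by (rule Bochner_Integration.integrable_bound[OF w(1)])
       (auto intro!: AE_I2 order.trans[OF w(2)[OF u1[OF that]] abs_ge_self])
  have \<Phi>_eq: "\<Phi> u x = \<delta> * rconv k (\<lambda>y. G y (apply_bcontfun u y)) x" for u x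
    unfolding \<Phi>_def rconv_def by (subst integral_mult_right_zero[symmetric]) (simp add: mult.left_commute)
  have \<Phi>_bd: "\<bar>\<Phi> u x\<bar> \<le> 1 / 2" if "u \<in> S" for u x
  proof -
    have "\<bar>\<Phi> u x\<bar> \<le> \<delta> * D"
      unfolding \<Phi>_eq abs_mult D_def using small(1) rconv_le[OF km k(2) w(1) w(2)[OF u1[OF that]] Gm]
      by (simp add: mult_left_mono)
    then show ?thesis using small(2) by (simp add: D_def)
  qed
  have \<Phi>_cont: "continuous_on UNIV (\<Phi> u)" if "u \<in> S" for u
    unfolding \<Phi>_eq[abs_def] by (intro continuous_on_mult_left rconv_continuous[OF k Gi[OF that]])
  have \<Phi>_bc: "\<Phi> u \<in> bcontfun" if "u \<in> S" for u
    by (rule bcontfun_normI[OF \<Phi>_cont[OF that], of "1/2"]) (use \<Phi>_bd[OF that] in simp)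
  \<comment> \<open>Meaningful on S, where \<Phi> u has been shown to be bounded and continuous;
    only such u occur below.\<close>
  define \<Psi> where "\<Psi> u = Bcontfun (\<Phi> u)" for u
  have \<Psi>: "apply_bcontfun (\<Psi> u) x = \<Phi> u x" if "u \<in> S" for u x
    unfolding \<Psi>_def by (simp add: Bcontfun_inverse \<Phi>_bc[OF that])
  have "\<exists>!u\<in>S. \<Psi> u = u"
  proof (rule Banach_fix[where c="1/2"])
    show "complete S" unfolding S_def by (simp add: complete_eq_closed)
    show "S \<noteq> {}" by (simp add: S_def)
    show "\<Psi> ` S \<subseteq> S"
    proof
      fix v assume "v \<in> \<Psi> ` S"
      then obtain u where u: "u \<in> S" "v = \<Psi> u" by blast
      have "norm v \<le> 1"
      proof (rule norm_bound)
        show "norm (apply_bcontfun v x) \<le> 1" for x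
          using \<Phi>_bd[OF u(1), of x] by (simp add: u \<Psi>)
      qed
      then show "v \<in> S" by (simp add: S_def)
    qed
    show "dist (\<Psi> u) (\<Psi> v) \<le> 1 / 2 * dist u v" if uv: "u \<in> S" "v \<in> S" for u v
    proof (rule dist_bound)
      fix x
      let ?d = "\<lambda>y. G y (apply_bcontfun u y) - G y (apply_bcontfun v y)"
      have le: "\<bar>?d y\<bar> \<le> dist u v * w y" for y
      proof -
        have "\<bar>?d y\<bar> \<le> w y * \<bar>apply_bcontfun u y - apply_bcontfun v y\<bar>"
          using uv by (intro w(3) u1) auto
        also have "\<dots> \<le> w y * dist u v"
          using dist_bounded[of u y v] order.trans[OF abs_ge_zero w(2)[of 0 y]]
          by (intro mult_left_mono) (auto simp: dist_real_def)
        finally show ?thesis by (simp add: mult.commute)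
      qed
      have "\<Phi> u x - \<Phi> v x = \<delta> * rconv k ?d x"
        unfolding \<Phi>_eq right_diff_distrib[symmetric] rconv_def
        using Bochner_Integration.integral_diff[OF rconv_integrable[OF km k(2) Gi] rconv_integrable[OF km k(2) Gi], of u v x x] uv
        by (simp add: right_diff_distrib)
      moreover have "\<bar>rconv k ?d x\<bar> \<le> B * (LBINT y. dist u v * w y)"
        by (rule rconv_le[OF km k(2) _ le]) (use w(1) in auto)
      ultimately have "\<bar>\<Phi> u x - \<Phi> v x\<bar> \<le> \<delta> * (B * (LBINT y. dist u v * w y))"
        using small(1) by (simp add: abs_mult mult_left_mono)
      also have "\<dots> = (\<delta> * D) * dist u v" by (simp add: D_def)
      also have "\<dots> \<le> 1 / 2 * dist u v" using small(2) by (intro mult_right_mono) (auto simp: D_def)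
      finally show "dist (apply_bcontfun (\<Psi> u) x) (apply_bcontfun (\<Psi> v) x) \<le> 1 / 2 * dist u v"
        using uv by (simp add: \<Psi> dist_real_def)
    qed
  qed auto
  then obtain u where u: "u \<in> S" "\<Psi> u = u" by blast
  show thesis
  proof (rule that[of "apply_bcontfun u"])
    show "continuous_on UNIV (apply_bcontfun u)" by simp
    show "\<bar>apply_bcontfun u x\<bar> \<le> 1" for x by (rule u1[OF u(1)])
    show "apply_bcontfun u x = rconv k (\<lambda>y. \<delta> * G y (apply_bcontfun u y)) x" for x
      using \<Psi>[OF u(1), of x] by (simp add: u(2) \<Phi>_def)
  qed
qed

text \<open>The bound with h is asked for almost every x because h is an Lp function, and
  \<open>at_right 0\<close> expresses "all sufficiently small \<delta> > 0". The solution is real,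
  as V needs a real argument, and is embedded into the complex function spaces.\<close>

theorem theorem4p4:
  fixes s \<beta> p \<alpha> C m :: real
    and a :: "real \<Rightarrow> real"
    and \<phi> :: "real^'n \<Rightarrow> real"
    and V :: "(real^'n) \<times> real \<Rightarrow> real"
    and h :: "real^'n \<Rightarrow> real"
  assumes "s > 0" and "\<beta> > 0" and "\<beta> * s \<ge> 4 * real CARD('n)"
    and "a \<in> class_G TYPE('n) \<beta> s"
    and "1 < p"
    and "test_function \<phi>"
    and "Ck_on 1 UNIV V"
    and "\<alpha> > 1" and "C > 0" and "h \<in> Lp p"
    and "AE x in lebesgue. \<forall>y. \<forall>i.
           \<bar>V (x, y)\<bar> + \<bar>deriv (\<lambda>t. V (x + t *\<^sub>R axis i 1, y)) 0\<bar> \<le> C * (h x + \<bar>y\<bar> powr \<alpha>)"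
    and "\<forall>x y. \<bar>deriv (\<lambda>t. V (x, t)) y\<bar> \<le> C * (1 + \<bar>y\<bar> powr \<alpha>)"
    and "m > 0" and "m > real CARD('n) / (\<alpha> * p)" and "s > 4 * m * \<alpha> / \<beta>"
  shows "\<forall>\<^sub>F \<delta> in at_right 0. \<exists>u :: real^'n \<Rightarrow> real.
           (\<lambda>x. complex_of_real (u x)) \<in> H_space a s p \<and>
           op_eq a s p (\<lambda>x. complex_of_real (u x))
             (\<lambda>x. complex_of_real (\<delta> * \<phi> x * V (x, u x)))"
proof -
  note mult = class_G_multiplier[OF assms(1-4)]
  have mult_real: "multiplier a s = (\<lambda>\<xi>::real^'n. complex_of_real ((1 + a ((norm \<xi>)\<^sup>2)) powr (- s / 2)))"
    by (simp add: multiplier_def fun_eq_iff)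
  obtain k B where k: "continuous_on UNIV k" "\<And>x::real^'n. \<bar>k x\<bar> \<le> B"
    "integrable lborel (\<lambda>x. complex_of_real (k x))"
    "\<And>\<xi>. ft (\<lambda>x. complex_of_real (k x)) \<xi> = multiplier a s \<xi>"
  proof (rule ft_kernel_exists[of "\<lambda>\<xi>::real^'n. (1 + a ((norm \<xi>)\<^sup>2)) powr (- s / 2)" 1])
    show "continuous_on UNIV (\<lambda>\<xi>::real^'n. (1 + a ((norm \<xi>)\<^sup>2)) powr (- s / 2))"
      using continuous_on_Re[OF mult(1)] by (simp add: multiplier_def)
    show "\<bar>(1 + a ((norm \<xi>)\<^sup>2)) powr (- s / 2)\<bar> \<le> 1" for \<xi> :: "real^'n"
      using mult(2)[of \<xi>] by (simp add: multiplier_def)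
  qed (use mult(3,5) that in \<open>auto simp: mult_real\<close>)
  define S where "S = closure {x. \<phi> x \<noteq> 0}"
  have S: "compact S" "\<And>x. x \<notin> S \<Longrightarrow> \<phi> x = 0"
    using assms(6) closure_subset[of "{x. \<phi> x \<noteq> 0}"] by (auto simp: test_function_def S_def)
  have "Ck_on 0 UNIV \<phi>" using assms(6) unfolding test_function_def by blast
  then have \<phi>: "continuous_on UNIV \<phi>" by simp
  obtain V' where V': "\<And>z. (V has_derivative V' z) (at z)" using assms(7) by auto
  have Vc: "continuous_on A V" for A
    using V' by (meson has_derivative_at_withinI has_derivative_continuous_on)
  have Vy: "((\<lambda>t. V (x, t)) has_real_derivative deriv (\<lambda>t. V (x, t)) y) (at y)" for x y
  proof -
    have "((\<lambda>t. (x, t)) has_derivative (\<lambda>t. (0, t))) (at y)"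
      by (intro has_derivative_Pair has_derivative_const has_derivative_ident)
    from has_derivative_compose[OF this V'] have "(\<lambda>t. V (x, t)) differentiable at y"
      unfolding differentiable_def by blast
    then show ?thesis by (simp add: DERIV_deriv_iff_real_differentiable)
  qed
  \<comment> \<open>On |y| \<le> 1 the factor 1 + |y|^\<alpha> is at most 2, so 2 C bounds the
    y-derivative uniformly in x.\<close>
  have V_lip: "\<bar>V (x, y) - V (x, z)\<bar> \<le> 2 * C * \<bar>y - z\<bar>" if "\<bar>y\<bar> \<le> 1" "\<bar>z\<bar> \<le> 1" for x y z
  proof -
    have "norm (V (x, y) - V (x, z)) \<le> (2 * C) * norm (y - z)"
    proof (rule field_differentiable_bound)
      show "convex {-1..1::real}" by simp
      show "((\<lambda>t. V (x, t)) has_field_derivative deriv (\<lambda>t. V (x, t)) t) (at t within {-1..1})" for t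
        using Vy by (rule has_field_derivative_at_within)
      show "norm (deriv (\<lambda>t. V (x, t)) t) \<le> 2 * C" if "t \<in> {-1..1}" for t
      proof -
        have "\<bar>t\<bar> powr \<alpha> \<le> 1 powr \<alpha>" using that assms(8) by (intro powr_mono2) auto
        then have "C * (1 + \<bar>t\<bar> powr \<alpha>) \<le> C * 2" using assms(9) by (intro mult_left_mono) auto
        then show ?thesis using assms(12)[rule_format, of x t] by simp
      qed
    qed (use that in auto)
    then show ?thesis by simp
  qed
  have "bounded (V ` (S \<times> {-1..1}))"
    by (intro compact_imp_bounded compact_continuous_image Vc compact_Times S) auto
  then obtain M where M: "\<forall>v \<in> V ` (S \<times> {-1..1}). norm v \<le> M" unfolding bounded_iff by blast
  \<comment> \<open>M handles the size of V on the compact set and 2 C its Lipschitz constant; their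
    sum serves for both requirements of \<open>convolution_fixed_point\<close>.\<close>
  define w where "w x = (\<bar>M\<bar> + 2 * C) * \<bar>\<phi> x\<bar>" for x
  have wi: "integrable lborel w"
    unfolding w_def using bounded_compact_support_Lp(2)[OF \<phi> S, of 1] by simp
  have w1: "\<bar>\<phi> x * V (x, y)\<bar> \<le> w x" if "\<bar>y\<bar> \<le> 1" for x y
  proof (cases "x \<in> S")
    case True
    moreover have "y \<in> {-1..1}" using that by auto
    ultimately have "V (x, y) \<in> V ` (S \<times> {-1..1})" by blast
    from bspec[OF M this] have "\<bar>V (x, y)\<bar> \<le> M" by simp
    then have "\<bar>V (x, y)\<bar> \<le> \<bar>M\<bar> + 2 * C" using assms(9) by simp
    then show ?thesis unfolding w_def abs_mult by (subst mult.commute) (rule mult_right_mono, auto)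
  qed (simp add: w_def S)
  have w2: "\<bar>\<phi> x * V (x, y) - \<phi> x * V (x, z)\<bar> \<le> w x * \<bar>y - z\<bar>" if "\<bar>y\<bar> \<le> 1" "\<bar>z\<bar> \<le> 1" for x y z
  proof -
    have "\<bar>\<phi> x * V (x, y) - \<phi> x * V (x, z)\<bar> = \<bar>\<phi> x\<bar> * \<bar>V (x, y) - V (x, z)\<bar>"
      by (simp flip: abs_mult right_diff_distrib)
    also have "\<dots> \<le> \<bar>\<phi> x\<bar> * ((\<bar>M\<bar> + 2 * C) * \<bar>y - z\<bar>)"
    proof (rule mult_left_mono)
      have "2 * C * \<bar>y - z\<bar> \<le> (\<bar>M\<bar> + 2 * C) * \<bar>y - z\<bar>" by (rule mult_right_mono) auto
      then show "\<bar>V (x, y) - V (x, z)\<bar> \<le> (\<bar>M\<bar> + 2 * C) * \<bar>y - z\<bar>"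
        using V_lip[OF that, of x] by linarith
    qed simp
    finally show ?thesis by (simp add: w_def mult_ac)
  qed
  have Gc: "continuous_on UNIV (\<lambda>(x, y). \<phi> x * V (x, y))"
    unfolding split_beta'
    by (intro continuous_intros continuous_on_compose2[OF \<phi>]) (auto intro: Vc)
  define D where "D = B * (LBINT x. w x)"
  show ?thesis
    unfolding eventually_at_right_field
  \<comment> \<open>Every smaller \<delta> has \<delta> D \<le> 1/2; the summand 1 avoids a division
    by zero when D vanishes.\<close>
  proof (rule exI[of _ "1 / (2 * (\<bar>D\<bar> + 1))"], intro conjI allI impI)
    show "0 < 1 / (2 * (\<bar>D\<bar> + 1))" by simp
    fix \<delta> :: real assume \<delta>: "0 < \<delta>" "\<delta> < 1 / (2 * (\<bar>D\<bar> + 1))"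
    have "\<delta> * D \<le> \<delta> * (\<bar>D\<bar> + 1)" using \<delta>(1) by (intro mult_left_mono) auto
    also have "\<dots> \<le> 1 / (2 * (\<bar>D\<bar> + 1)) * (\<bar>D\<bar> + 1)" using \<delta>(2) by (intro mult_right_mono) auto
    also have "\<dots> = 1 / 2" using abs_ge_zero[of D] by (simp add: field_simps)
    finally have small: "\<delta> * (B * (LBINT x. w x)) \<le> 1 / 2" by (simp add: D_def)
    obtain u where u: "continuous_on UNIV u" "\<And>x. \<bar>u x\<bar> \<le> 1" "\<And>x. u x = rconv k (\<lambda>y. \<delta> * (\<phi> y * V (y, u y))) x"
      using convolution_fixed_point[OF k(1,2) Gc wi w1 w2 \<delta>(1) small] by blast
    define g where "g x = \<delta> * \<phi> x * V (x, u x)" for x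
    let ?u = "\<lambda>x. complex_of_real (u x)" and ?g = "\<lambda>x. complex_of_real (g x)" and ?k = "\<lambda>x. complex_of_real (k x)"
    have gc: "continuous_on UNIV g"
      unfolding g_def by (intro continuous_intros \<phi> continuous_on_compose2[OF Vc[of UNIV]] continuous_on_Pair u(1)) auto
    have gm: "?g \<in> borel_measurable borel"
      using gc by (intro borel_measurable_continuous_onI continuous_intros)
    have g0: "g x = 0" if "x \<notin> S" for x using S(2)[OF that] by (simp add: g_def)
    have gLp: "?g \<in> Lp r" if "r > 0" for r
      using Lp_borel(1)[OF gm, of r] bounded_compact_support_Lp(1)[OF gc S(1) g0 that] by blast
    have ug: "?u = conv ?k ?g"
    proof
      fix x
      show "?u x = conv ?k ?g x"
        unfolding conv_of_real of_real_eq_iff g_def[abs_def] mult.assoc by (rule u(3))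
    qed
    have kB: "conv_kernel ?k B" by unfold_locales (use k(2,3) in simp_all)
    \<comment> \<open>The right-hand side ?g is continuous with support in S, so it lies in both L2
      and Lp, where \<open>T_op\<close> is known to be the convolution.\<close>
    have T: "AE x in lebesgue. T_op a s p ?g x = conv ?k ?g x"
      by (rule T_op_eq_conv[OF kB _ mult(2) k(4) gm]) (use gLp assms(5) in auto)
    then have uT: "AE x in lebesgue. ?u x = T_op a s p ?g x"
      by eventually_elim (simp add: fun_cong[OF ug])
    have "?u \<in> Lp p"
    proof -
      have "conv_lebesgue ?k ?g \<in> Lp p"
        using conv_lebesgue_bounded_Lp_operator[OF kB, of p] gLp[of p] assms(5)
        by (simp add: bounded_Lp_operator_def)
      moreover have "conv_lebesgue ?k ?g = conv ?k ?g"
        by (rule conv_lebesgue_eq[OF _ borel_lebesgueI[OF gm] gm]) (use k(3) in auto)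
      ultimately show ?thesis unfolding ug by simp
    qed
    moreover have "?g \<in> Lp p" using gLp assms(5) by simp
    ultimately have "?u \<in> H_space a s p" unfolding H_space_def using uT by blast
    with \<open>?g \<in> Lp p\<close> uT show "\<exists>u :: real^'n \<Rightarrow> real.
           (\<lambda>x. complex_of_real (u x)) \<in> H_space a s p \<and>
           op_eq a s p (\<lambda>x. complex_of_real (u x))
             (\<lambda>x. complex_of_real (\<delta> * \<phi> x * V (x, u x)))"
      unfolding op_eq_def g_def by blast
  qed
qed

end
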